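(* Assume $H$ is twice continuously differentiable in a neighborhood of $\beta^*$, with $\mathcal H=\nabla^2H(\beta^* )$. Let $\epsilon_t>0$ with $\epsilon_t=o(1)$ and $\epsilon_t\sqrt t\to\infty$, and suppose $\widehat{\mathcal H}\to\mathcal H$ in probability. Let $\kappa\in(0,\infty]$, $\alpha\in(0,1)$, and let $T^\infty$ be the limit in distribution of $T^\gamma(\beta^*,\delta^* )$. If the CDF of $T^\infty$ is continuous at the $(1-\alpha)$-quantile of $T^\infty$, then $$\liminf_{t\to\infty}\ \mathbb P\big((\beta^*,\delta^* )\in C^\gamma(c^{\mathrm{boot}}_{1-\alpha})\big)\ \ge\ 1-\alpha .$$
   Context: Setting. There are $n$ buyers with budgets $b_i>0$, $b=(b_1,\dots,b_n)$, a measurable item space $\Theta$ with integrating measure $d\theta$, nonnegative integrable valuations $v_i:\Theta\to[0,\infty)$ with $\max_i\sup_\theta v_i(\theta)<\infty$, and a bounded supply function $s\ge 0$ with $\int_\Theta s\,d\theta=1$. Write $\mathbb E[g]=\int g\,s\,d\theta$. Let $\theta^1,\theta^2,\dots$ be i.i.d. draws from the density $s$ and $P_tf=\frac1t\sum_{\tau=1}^tf(\theta^\tau)$. Put $$F(\theta,\beta)=\max_{i}\beta_iv_i(\theta)-\sum_{i=1}^nb_i\log\beta_i\ \ (\beta\in(0,\infty)^n),\quad H(\beta)=\mathbb E[F(\cdot,\beta)],\quad H_t(\beta)=P_tF(\cdot,\beta),$$ with value $+\infty$ if some $\beta_i\le0$. The limit FPPE (first-price pacing equilibrium) pacing multiplier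 is $\beta^*=\operatorname{argmin}_{(0,1]^n}H$ and the finite (observed) one is $\beta^\gamma=\operatorname{argmin}_{(0,1]^n}H_t$. Leftover budgets: $\delta^*=-\nabla H(\beta^* )$ (equivalently $\delta_i^*$ is $b_i$ minus buyer $i$'s equilibrium payment). $\mathcal H$ is positive definite. Statistic and region. $L_t(\beta,\delta)=H_t(\beta)-\delta^{\top}(1_n-\beta)$, where $1_n$ is the all-ones vector. With $\mathbb B_\kappa=\{h\in\mathbb R^n:\|h\|_2\le\kappa\}$ ($\mathbb B_\infty=\mathbb R^n$), $$T^\gamma(\beta,\delta)=-\inf_{\beta'\in\beta+\frac1{\sqrt t}\mathbb B_\kappa}t\big(L_t(\beta',\delta)-L_t(\beta,\delta)\big),$$ $$C^\gamma(c)=\{(\beta,\delta):T^\gamma(\beta,\delta)\le c,\ (1_n-\beta)^{\top}\delta=0,\ 0\le\beta\le1_n,\ 0\le\delta\le b\}$$ (inequalities componentwise). Bootstrap objects. $W=(W_1,\dots,W_t)$ is multinomial with $t$ trials and probabilities $(1/t,\dots,1/t)$, independent of the data; $P_t^{\mathrm{boot}}f=\frac1t\sum_\tau W_\tau f(\theta^\tau)$. $D_F(\theta,\beta)$ is a deterministic selection from the subdifferential $\partial_\beta F(\theta,\beta)$, and $G^{\mathrm{boot}}=\sqrt t\,(P_t^{\mathrm{boot}}-P_t)D_F(\cdot,\beta^\gamma)$. $\widehat{\mathcal H}$ is the numerical-difference Hessian estimate with entries $\widehat{\mathcal H}_{k\ell}=(\widehat\nabla^2_{k\ell,\eta_t}H_t)(\beta^\gamma)$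 for a stepsize $\eta_t>0$, where $(\widehat\nabla^2_{k\ell,\eta}g)(\beta)=[g(\beta+\eta e_k+\eta e_\ell)-g(\beta-\eta e_k+\eta e_\ell)-g(\beta+\eta e_k-\eta e_\ell)+g(\beta-\eta e_k-\eta e_\ell)]/(4\eta^2)$ and $e_k$ are the unit vectors. With $\|a\|_A^2=a^{\top}Aa$, $$T^{\mathrm{boot}}=-\inf_{\beta\in\mathbb R^n_+}\Big(\epsilon_t(G^{\mathrm{boot}})^{\top}(\beta-\beta^\gamma)+\tfrac12\|\beta^\gamma-\beta\|_{\widehat{\mathcal H}}^2\Big)/\epsilon_t^2,$$ and $c^{\mathrm{boot}}_{1-\alpha}=\inf\{x:\mathbb P(T^{\mathrm{boot}}\le x\mid\theta^1,\dots,\theta^t)\ge1-\alpha\}$ is its conditional $(1-\alpha)$-quantile. *)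

theory Defs
  imports "HOL-Probability.Probability"
begin

text \<open>
  Buyers are the elements of a finite type \<open>'n\<close>, so that vectors indexed by the buyers have type
  \<open>real^'n\<close>, with the componentwise order \<open>\<le>\<close> and with \<open>1\<close> the all-ones vector.  The item
  space with its integrating measure is \<open>D\<close>, the supply function is \<open>s\<close>, the valuations are
  \<open>v\<close> and the budgets are \<open>b\<close>.  A data set consists of the first \<open>t\<close> entries
  \<open>x 0, \<dots>, x (t - 1)\<close> of a sequence \<open>x\<close> of items.
\<close>

subsection \<open>Gradient, Hessian and subdifferential\<close>

definition gradient :: "(real^'n \<Rightarrow> real) \<Rightarrow> real^'n \<Rightarrow> real^'n" where
  "gradient f x = (\<chi> i. frechet_derivative f (at x) (axis i 1))"

definition hessian :: "(real^'n \<Rightarrow> real) \<Rightarrow> real^'n \<Rightarrow> real^'n^'n" where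
  "hessian f x = jacobian (gradient f) (at x)"

definition twice_cont_diff_near :: "(real^'n \<Rightarrow> real) \<Rightarrow> real^'n \<Rightarrow> bool" where
  "twice_cont_diff_near f x \<longleftrightarrow>
     (\<exists>U. open U \<and> x \<in> U \<and> (\<forall>y\<in>U. f differentiable at y) \<and>
          (\<forall>y\<in>U. gradient f differentiable at y) \<and> continuous_on U (hessian f))"

definition positive_definite :: "real^'n^'n \<Rightarrow> bool" where
  "positive_definite A \<longleftrightarrow> transpose A = A \<and> (\<forall>x. x \<noteq> 0 \<longrightarrow> x \<bullet> (A *v x) > 0)"

definition subdifferential :: "(real^'n \<Rightarrow> ereal) \<Rightarrow> real^'n \<Rightarrow> (real^'n) set" where
  "subdifferential f x = {g. \<forall>y. f x + ereal (g \<bullet> (y - x)) \<le> f y}"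

subsection \<open>The objective functions\<close>

definition pos_orthant :: "(real^'n) set" where
  "pos_orthant = {\<beta>. \<forall>i. 0 < \<beta> $ i}"

definition infty_outside :: "(real^'n \<Rightarrow> real) \<Rightarrow> real^'n \<Rightarrow> ereal" where
  "infty_outside f \<beta> = (if \<beta> \<in> pos_orthant then ereal (f \<beta>) else \<infinity>)"

text \<open>The finite branch of \<open>F\<close>, meaningful for \<open>\<beta> \<in> pos_orthant\<close> only.\<close>

definition F_fin :: "('n::finite \<Rightarrow> 'a \<Rightarrow> real) \<Rightarrow> real^'n \<Rightarrow> 'a \<Rightarrow> real^'n \<Rightarrow> real" where
  "F_fin v b \<theta> \<beta> = (MAX i. \<beta> $ i * v i \<theta>) - (\<Sum>i\<in>UNIV. b $ i * ln (\<beta> $ i))"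

definition F :: "('n::finite \<Rightarrow> 'a \<Rightarrow> real) \<Rightarrow> real^'n \<Rightarrow> 'a \<Rightarrow> real^'n \<Rightarrow> ereal" where
  "F v b \<theta> = infty_outside (F_fin v b \<theta>)"

definition H_lim :: "'a measure \<Rightarrow> ('a \<Rightarrow> real) \<Rightarrow> ('n::finite \<Rightarrow> 'a \<Rightarrow> real) \<Rightarrow> real^'n
    \<Rightarrow> real^'n \<Rightarrow> ereal" where
  "H_lim D s v b = infty_outside (\<lambda>\<beta>. \<integral>\<theta>. F_fin v b \<theta> \<beta> * s \<theta> \<partial>D)"

definition emp_mean :: "nat \<Rightarrow> (nat \<Rightarrow> 'a) \<Rightarrow> ('a \<Rightarrow> 'b::real_vector) \<Rightarrow> 'b" where
  "emp_mean t x f = (1 / real t) *\<^sub>R (\<Sum>\<tau><t. f (x \<tau>))"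

definition H_obs :: "('n::finite \<Rightarrow> 'a \<Rightarrow> real) \<Rightarrow> real^'n \<Rightarrow> nat \<Rightarrow> (nat \<Rightarrow> 'a)
    \<Rightarrow> real^'n \<Rightarrow> ereal" where
  "H_obs v b t x = infty_outside (\<lambda>\<beta>. emp_mean t x (\<lambda>\<theta>. F_fin v b \<theta> \<beta>))"

text \<open>Both minimizers below exist and are unique, because \<open>- b $ i * ln (\<beta> $ i)\<close> is strictly
  convex and tends to infinity at \<open>0\<close>.\<close>

definition beta_lim :: "'a measure \<Rightarrow> ('a \<Rightarrow> real) \<Rightarrow> ('n::finite \<Rightarrow> 'a \<Rightarrow> real) \<Rightarrow> real^'n
    \<Rightarrow> real^'n" where
  "beta_lim D s v b = arg_min (H_lim D s v b) (\<lambda>\<beta>. \<beta> \<in> pos_orthant \<and> \<beta> \<le> 1)"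

definition beta_obs :: "('n::finite \<Rightarrow> 'a \<Rightarrow> real) \<Rightarrow> real^'n \<Rightarrow> nat \<Rightarrow> (nat \<Rightarrow> 'a)
    \<Rightarrow> real^'n" where
  "beta_obs v b t x = arg_min (H_obs v b t x) (\<lambda>\<beta>. \<beta> \<in> pos_orthant \<and> \<beta> \<le> 1)"

text \<open>\<open>real_of_ereal\<close> only serves to differentiate \<open>H_lim\<close>, which is finite near \<open>beta_lim\<close>.\<close>

definition delta_lim :: "'a measure \<Rightarrow> ('a \<Rightarrow> real) \<Rightarrow> ('n::finite \<Rightarrow> 'a \<Rightarrow> real) \<Rightarrow> real^'n
    \<Rightarrow> real^'n" where
  "delta_lim D s v b = - gradient (\<lambda>\<beta>. real_of_ereal (H_lim D s v b \<beta>)) (beta_lim D s v b)"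

definition hess_lim :: "'a measure \<Rightarrow> ('a \<Rightarrow> real) \<Rightarrow> ('n::finite \<Rightarrow> 'a \<Rightarrow> real) \<Rightarrow> real^'n
    \<Rightarrow> real^'n^'n" where
  "hess_lim D s v b = hessian (\<lambda>\<beta>. real_of_ereal (H_lim D s v b \<beta>)) (beta_lim D s v b)"

subsection \<open>The statistic and the confidence region\<close>

definition L_obs :: "('n::finite \<Rightarrow> 'a \<Rightarrow> real) \<Rightarrow> real^'n \<Rightarrow> nat \<Rightarrow> (nat \<Rightarrow> 'a)
    \<Rightarrow> real^'n \<Rightarrow> real^'n \<Rightarrow> ereal" where
  "L_obs v b t x \<beta> \<delta> = H_obs v b t x \<beta> - ereal (\<delta> \<bullet> (1 - \<beta>))"

text \<open>The radius \<open>\<kappa>\<close> may be \<open>\<infinity>\<close>, in which case the infimum is over the whole space.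
  The value of \<open>T_obs\<close> may be \<open>\<infinity>\<close>.\<close>

definition T_obs :: "ereal \<Rightarrow> ('n::finite \<Rightarrow> 'a \<Rightarrow> real) \<Rightarrow> real^'n \<Rightarrow> nat \<Rightarrow> (nat \<Rightarrow> 'a)
    \<Rightarrow> real^'n \<Rightarrow> real^'n \<Rightarrow> ereal" where
  "T_obs \<kappa> v b t x \<beta> \<delta> =
     - (INF \<beta>'\<in>{\<beta> + (1 / sqrt (real t)) *\<^sub>R h | h. ereal (norm h) \<le> \<kappa>}.
          ereal (real t) * (L_obs v b t x \<beta>' \<delta> - L_obs v b t x \<beta> \<delta>))"

definition C_obs :: "ereal \<Rightarrow> ('n::finite \<Rightarrow> 'a \<Rightarrow> real) \<Rightarrow> real^'n \<Rightarrow> nat \<Rightarrow> (nat \<Rightarrow> 'a)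
    \<Rightarrow> ereal \<Rightarrow> ((real^'n) \<times> (real^'n)) set" where
  "C_obs \<kappa> v b t x c =
     {(\<beta>, \<delta>). T_obs \<kappa> v b t x \<beta> \<delta> \<le> c \<and> (1 - \<beta>) \<bullet> \<delta> = 0 \<and>
        0 \<le> \<beta> \<and> \<beta> \<le> 1 \<and> 0 \<le> \<delta> \<and> \<delta> \<le> b}"

subsection \<open>The bootstrap\<close>

text \<open>Entry \<open>\<tau>\<close> of the multinomial vector counts how many of \<open>t\<close> independent uniform draws from
  \<open>{..<t}\<close> equal \<open>\<tau>\<close>.\<close>

definition multinomial_unif_pmf :: "nat \<Rightarrow> (nat \<Rightarrow> nat) pmf" where
  "multinomial_unif_pmf t = map_pmf count_list (replicate_pmf t (pmf_of_set {..<t}))"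

definition boot_mean :: "nat \<Rightarrow> (nat \<Rightarrow> 'a) \<Rightarrow> (nat \<Rightarrow> nat) \<Rightarrow> ('a \<Rightarrow> 'b::real_vector) \<Rightarrow> 'b" where
  "boot_mean t x w f = (1 / real t) *\<^sub>R (\<Sum>\<tau><t. real (w \<tau>) *\<^sub>R f (x \<tau>))"

definition G_boot :: "('n::finite \<Rightarrow> 'a \<Rightarrow> real) \<Rightarrow> real^'n \<Rightarrow> ('a \<Rightarrow> real^'n \<Rightarrow> real^'n)
    \<Rightarrow> nat \<Rightarrow> (nat \<Rightarrow> 'a) \<Rightarrow> (nat \<Rightarrow> nat) \<Rightarrow> real^'n" where
  "G_boot v b DF t x w = sqrt (real t) *\<^sub>R
     (boot_mean t x w (\<lambda>\<theta>. DF \<theta> (beta_obs v b t x)) - emp_mean t x (\<lambda>\<theta>. DF \<theta> (beta_obs v b t x)))"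

text \<open>If one of the four function values is infinite, so is the difference quotient, and
  \<open>real_of_ereal\<close> sets the entry of the matrix to \<open>0\<close>.\<close>

definition num_hessian :: "real \<Rightarrow> (real^'n \<Rightarrow> ereal) \<Rightarrow> real^'n \<Rightarrow> real^'n^'n" where
  "num_hessian \<eta> g \<beta> = (\<chi> k l. real_of_ereal
     ((g (\<beta> + \<eta> *\<^sub>R axis k 1 + \<eta> *\<^sub>R axis l 1) - g (\<beta> - \<eta> *\<^sub>R axis k 1 + \<eta> *\<^sub>R axis l 1)
       - g (\<beta> + \<eta> *\<^sub>R axis k 1 - \<eta> *\<^sub>R axis l 1) + g (\<beta> - \<eta> *\<^sub>R axis k 1 - \<eta> *\<^sub>R axis l 1))
      / ereal (4 * \<eta>\<^sup>2)))"

definition hess_obs :: "('n::finite \<Rightarrow> 'a \<Rightarrow> real) \<Rightarrow> real^'n \<Rightarrow> real \<Rightarrow> nat \<Rightarrow> (nat \<Rightarrow> 'a)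
    \<Rightarrow> real^'n^'n" where
  "hess_obs v b \<eta> t x = num_hessian \<eta> (H_obs v b t x) (beta_obs v b t x)"

definition T_boot :: "('n::finite \<Rightarrow> 'a \<Rightarrow> real) \<Rightarrow> real^'n \<Rightarrow> ('a \<Rightarrow> real^'n \<Rightarrow> real^'n)
    \<Rightarrow> real \<Rightarrow> real \<Rightarrow> nat \<Rightarrow> (nat \<Rightarrow> 'a) \<Rightarrow> (nat \<Rightarrow> nat) \<Rightarrow> ereal" where
  "T_boot v b DF \<epsilon> \<eta> t x w =
     - (INF \<beta>\<in>{\<beta>. 0 \<le> \<beta>}. ereal
          ((\<epsilon> * (G_boot v b DF t x w \<bullet> (\<beta> - beta_obs v b t x))
            + 1 / 2 * ((beta_obs v b t x - \<beta>) \<bullet> (hess_obs v b \<eta> t x *v (beta_obs v b t x - \<beta>))))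
           / \<epsilon>\<^sup>2))"

text \<open>The multinomial weights are independent of the data, so the conditional distribution of
  \<open>T_boot\<close> given the data \<open>x 0, \<dots>, x (t - 1)\<close> is its distribution for fixed \<open>x\<close> and random
  weights.  The quantile is \<open>\<infinity>\<close> if \<open>T_boot\<close> is infinite with probability greater than \<open>\<alpha>\<close>.\<close>

definition c_boot :: "('n::finite \<Rightarrow> 'a \<Rightarrow> real) \<Rightarrow> real^'n \<Rightarrow> ('a \<Rightarrow> real^'n \<Rightarrow> real^'n)
    \<Rightarrow> real \<Rightarrow> real \<Rightarrow> real \<Rightarrow> nat \<Rightarrow> (nat \<Rightarrow> 'a) \<Rightarrow> ereal" where
  "c_boot v b DF \<epsilon> \<eta> \<alpha> t x =
     Inf {ereal c | c. measure_pmf.prob (multinomial_unif_pmf t)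
                         {w. T_boot v b DF \<epsilon> \<eta> t x w \<le> ereal c} \<ge> 1 - \<alpha>}"

subsection \<open>Probabilistic notions\<close>

definition converges_in_prob :: "'w measure \<Rightarrow> (nat \<Rightarrow> 'w \<Rightarrow> 'b::metric_space) \<Rightarrow> 'b \<Rightarrow> bool" where
  "converges_in_prob M X c \<longleftrightarrow>
     (\<forall>e>0. (\<lambda>t. measure M {\<omega> \<in> space M. dist (X t \<omega>) c > e}) \<longlonglongrightarrow> 0)"

text \<open>The variables may take infinite values, while the limit distribution \<open>N\<close> is one on the
  real line.\<close>

definition converges_in_distr :: "'w measure \<Rightarrow> (nat \<Rightarrow> 'w \<Rightarrow> ereal) \<Rightarrow> real measure \<Rightarrow> bool" where
  "converges_in_distr M X N \<longleftrightarrow>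
     weak_conv (\<lambda>t x. measure M {\<omega> \<in> space M. X t \<omega> \<le> ereal x}) (cdf N)"

definition quantile :: "real measure \<Rightarrow> real \<Rightarrow> real" where
  "quantile N p = Inf {x. cdf N x \<ge> p}"

end

theory Submission
  imports Defs
begin

text \<open>
  Write \<open>S\<close> for the normalized sum of the centred scores \<open>DF \<theta> \<beta>\<^sup>* + \<delta>\<^sup>*\<close> over the data, where \<open>\<beta>\<^sup>*\<close>
  and \<open>\<delta>\<^sup>*\<close> are the limit multiplier and the leftover budgets, and let \<open>q g = g \<bullet> (A *v g) / 2\<close> with
  \<open>A\<close> the inverse of the limit Hessian.  Three comparisons carry the proof.

  The observed statistic is at most \<open>q S\<close>, up to a vanishing error (\<open>T_obs_upper_bound\<close>).  In the
  local coordinate \<open>h\<close> with \<open>\<beta> = \<beta>\<^sup>* + h / \<surd>t\<close> the rescaled Lagrangian difference is convex and,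
  at every \<open>h\<close>, close in probability to the quadratic \<open>S \<bullet> h + h \<bullet> (Hess *v h) / 2\<close>.  Convexity turns closeness at
  finitely many points into a lower bound for the infimum over all \<open>h\<close>, and therefore over any ball:
  it is at least \<open>- q S\<close> minus a small error, for every \<open>\<kappa>\<close>.

  The bootstrap statistic is at least \<open>q G\<close>, up to a vanishing error, where \<open>G\<close> is the bootstrap
  sum (\<open>T_boot_lower_bound\<close>).  It is a supremum, so it suffices to exhibit one point: a multiple of
  \<open>- A *v G\<close>, which the constraint \<open>0 \<le> \<beta>\<close> admits because the stepsize \<open>\<epsilon>\<close> tends to \<open>0\<close>.

  The law of \<open>q S\<close> and the conditional law of \<open>q G\<close> given the data are asymptotically the same
  (\<open>quadratic_form_comparison\<close>).  Both \<open>S\<close> and \<open>G\<close> are normalized sums of bounded centred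
  independent vectors, and their covariances approach each other (\<open>boot_covariance\<close>), so replacing
  the summands one by one, as in Lindeberg's proof of the central limit theorem, compares the two
  laws directly.

  Together: below the \<open>(1 - \<alpha>)\<close>-quantile of the limit distribution, the conditional distribution
  function of the bootstrap statistic is eventually less than \<open>1 - \<alpha>\<close>, with probability tending to
  one.  So the bootstrap quantile exceeds every number \<open>q0\<close> below the limit quantile
  (\<open>c_boot_lower_bound\<close>), the coverage is asymptotically at least the limit distribution function
  at \<open>q0\<close>, and continuity at the quantile lets \<open>q0\<close> increase to it.  The remaining conditions that
  define the region hold at \<open>(\<beta>\<^sup>*, \<delta>\<^sup>*)\<close> by the optimality conditions (\<open>KKT\<close>).
\<close>

section \<open>Statements that hold with probability tending to one\<close>

text \<open>
  The statement is guaranteed on measurable events only, so that it can be combined with others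
  without checking that it describes a measurable set itself.
\<close>

definition whp :: "'w measure \<Rightarrow> (nat \<Rightarrow> 'w \<Rightarrow> bool) \<Rightarrow> bool" where
  "whp M P \<longleftrightarrow> (\<exists>E. (\<forall>t. E t \<in> sets M) \<and> (\<lambda>t. measure M (E t)) \<longlonglongrightarrow> 1 \<and>
     (\<forall>\<^sub>F t in sequentially. \<forall>\<omega>\<in>E t. P t \<omega>))"

lemma whp_mono:
  assumes "whp M P" "\<forall>\<^sub>F t in sequentially. \<forall>\<omega>\<in>space M. P t \<omega> \<longrightarrow> Q t \<omega>"
  shows "whp M Q"
proof -
  obtain E where E: "\<And>t. E t \<in> sets M" "(\<lambda>t. measure M (E t)) \<longlonglongrightarrow> 1"
    "\<forall>\<^sub>F t in sequentially. \<forall>\<omega>\<in>E t. P t \<omega>"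
    using assms(1) unfolding whp_def by auto
  have "\<forall>\<^sub>F t in sequentially. \<forall>\<omega>\<in>E t. Q t \<omega>"
    using E(3) assms(2) by eventually_elim (use sets.sets_into_space[OF E(1)] in blast)
  with E show ?thesis unfolding whp_def by blast
qed

lemma whp_mono_eventually:
  assumes "whp M P" "\<forall>\<^sub>F t in sequentially. R t"
    and "\<And>t \<omega>. R t \<Longrightarrow> 0 < t \<Longrightarrow> \<omega> \<in> space M \<Longrightarrow> P t \<omega> \<Longrightarrow> Q t \<omega>"
  shows "whp M Q"
  using assms(1)
proof (rule whp_mono)
  show "\<forall>\<^sub>F t in sequentially. \<forall>\<omega>\<in>space M. P t \<omega> \<longrightarrow> Q t \<omega>"
    using assms(2) eventually_gt_at_top[of 0] by eventually_elim (use assms(3) in auto)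
qed

context prob_space begin

lemma whp_eventually:
  assumes "\<forall>\<^sub>F t in sequentially. \<forall>\<omega>\<in>space M. P t \<omega>"
  shows "whp M P"
  unfolding whp_def using assms by (intro exI[of _ "\<lambda>_. space M"]) (auto simp: prob_space)

lemma whp_conj:
  assumes "whp M P" "whp M Q"
  shows "whp M (\<lambda>t \<omega>. P t \<omega> \<and> Q t \<omega>)"
proof -
  obtain E where E: "\<And>t. E t \<in> sets M" "(\<lambda>t. prob (E t)) \<longlonglongrightarrow> 1"
    "\<forall>\<^sub>F t in sequentially. \<forall>\<omega>\<in>E t. P t \<omega>"
    using assms(1) unfolding whp_def by auto
  obtain E' where E': "\<And>t. E' t \<in> sets M" "(\<lambda>t. prob (E' t)) \<longlonglongrightarrow> 1"
    "\<forall>\<^sub>F t in sequentially. \<forall>\<omega>\<in>E' t. Q t \<omega>"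
    using assms(2) unfolding whp_def by auto
  have "(\<lambda>t. prob (E t \<inter> E' t)) \<longlonglongrightarrow> 1"
  proof (rule real_tendsto_sandwich)
    have "prob (E t \<inter> E' t) \<ge> prob (E t) + prob (E' t) - 1" for t
    proof -
      have "prob (E t \<union> E' t) = prob (E t) + prob (E' t) - prob (E t \<inter> E' t)"
        using measure_Un3[of "E t" M "E' t"] E(1) E'(1) by (simp add: fmeasurable_eq_sets)
      then show ?thesis using prob_le_1[of "E t \<union> E' t"] by linarith
    qed
    then show "\<forall>\<^sub>F t in sequentially. prob (E t) + prob (E' t) - 1 \<le> prob (E t \<inter> E' t)"
      by simp
    show "(\<lambda>t. prob (E t) + prob (E' t) - 1) \<longlonglongrightarrow> 1"
      using tendsto_diff[OF tendsto_add[OF E(2) E'(2)] tendsto_const[of 1]] by simp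
  qed auto
  moreover have "\<forall>\<^sub>F t in sequentially. \<forall>\<omega>\<in>E t \<inter> E' t. P t \<omega> \<and> Q t \<omega>"
    using E(3) E'(3) by eventually_elim auto
  ultimately show ?thesis
    unfolding whp_def using E(1) E'(1) by (intro exI[of _ "\<lambda>t. E t \<inter> E' t"]) auto
qed

lemma whp_ball_finite:
  assumes "finite I" "\<And>i. i \<in> I \<Longrightarrow> whp M (P i)"
  shows "whp M (\<lambda>t \<omega>. \<forall>i\<in>I. P i t \<omega>)"
  using assms
proof (induction I)
  case empty
  show ?case by (rule whp_eventually) simp
next
  case (insert i I)
  show ?case
    by (rule whp_mono[OF whp_conj[of "P i" "\<lambda>t \<omega>. \<forall>i\<in>I. P i t \<omega>"]]) (use insert in auto)
qed

text \<open>
  The way in: a bad event whose probability is bounded by a null sequence.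
\<close>

lemma whp_by_bound:
  assumes "\<forall>\<^sub>F t in sequentially. B t \<in> events \<and> prob (B t) \<le> r t"
    and "r \<longlonglongrightarrow> 0"
    and "\<forall>\<^sub>F t in sequentially. \<forall>\<omega>\<in>space M - B t. P t \<omega>"
  shows "whp M P"
proof -
  define E where "E t = (if B t \<in> events \<and> prob (B t) \<le> r t then space M - B t else space M)" for t
  have "(\<lambda>t. prob (E t)) \<longlonglongrightarrow> 1"
  proof (rule real_tendsto_sandwich)
    show "\<forall>\<^sub>F t in sequentially. 1 - r t \<le> prob (E t)"
      using assms(1) by eventually_elim (auto simp: E_def prob_compl)
    show "(\<lambda>t. 1 - r t) \<longlonglongrightarrow> 1"
      using tendsto_diff[OF tendsto_const[of 1] assms(2)] by simp
  qed (auto simp: prob_space)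
  moreover have "\<forall>\<^sub>F t in sequentially. \<forall>\<omega>\<in>E t. P t \<omega>"
    using assms(1,3) by eventually_elim (auto simp: E_def)
  ultimately show ?thesis
    unfolding whp_def by (intro exI[of _ E]) (auto simp: E_def)
qed

text \<open>
  The way out: once a set is known to be measurable, a statement that excludes it makes its
  probability vanish.
\<close>

lemma whp_prob_vanishes:
  assumes "whp M P" "\<forall>\<^sub>F t in sequentially. \<forall>\<omega>\<in>space M. \<omega> \<in> B t \<longrightarrow> \<not> P t \<omega>"
    "\<forall>\<^sub>F t in sequentially. B t \<in> events"
  shows "(\<lambda>t. prob (B t)) \<longlonglongrightarrow> 0"
proof -
  obtain E where E: "\<And>t. E t \<in> sets M" "(\<lambda>t. prob (E t)) \<longlonglongrightarrow> 1"
    "\<forall>\<^sub>F t in sequentially. \<forall>\<omega>\<in>E t. P t \<omega>"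
    using assms(1) unfolding whp_def by auto
  show ?thesis
  proof (rule real_tendsto_sandwich[OF always_eventually _ tendsto_const])
    show "\<forall>\<^sub>F t in sequentially. prob (B t) \<le> 1 - prob (E t)"
      using E(3) assms(2,3)
    proof eventually_elim
      case (elim t)
      then have "B t \<subseteq> space M - E t" using sets.sets_into_space by blast
      then have "prob (B t) \<le> prob (space M - E t)"
        using E(1) by (intro finite_measure_mono) auto
      then show ?case using E(1) by (simp add: prob_compl)
    qed
    show "(\<lambda>t. 1 - prob (E t)) \<longlonglongrightarrow> 0"
      using tendsto_diff[OF tendsto_const[of 1] E(2)] by simp
  qed (auto intro: always_eventually)
qed

end

section \<open>Independent samples\<close>

lemma norm_square_le: "norm (x\<^sup>2) \<le> B\<^sup>2" if "\<bar>x\<bar> \<le> B" for x B :: real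
  using that power_mono[OF that abs_ge_zero, of 2] by simp

locale iid_sample = prob_space M for M :: "'w measure" +
  fixes P :: "'a measure" and X :: "nat \<Rightarrow> 'w \<Rightarrow> 'a"
  assumes indep: "indep_vars (\<lambda>_. P) X UNIV"
    and law: "\<And>\<tau>. distr M P (X \<tau>) = P"
begin

lemma X_measurable [measurable]: "X \<tau> \<in> M \<rightarrow>\<^sub>M P"
  using indep by (simp add: indep_vars_def)

sublocale P: prob_space P
  using prob_space_distr[OF X_measurable, of 0] law[of 0] by simp

abbreviation sample :: "'w \<Rightarrow> nat \<Rightarrow> 'a" where
  "sample \<omega> \<equiv> \<lambda>\<tau>. X \<tau> \<omega>"

definition normalized_sum :: "('a \<Rightarrow> 'b::real_vector) \<Rightarrow> nat \<Rightarrow> 'w \<Rightarrow> 'b" where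
  "normalized_sum Y t \<omega> = (1 / sqrt (real t)) *\<^sub>R (\<Sum>\<tau><t. Y (X \<tau> \<omega>))"

lemma X_in_space: "\<omega> \<in> space M \<Longrightarrow> X \<tau> \<omega> \<in> space P"
  by (rule measurable_space[OF X_measurable])

lemma expectation_X:
  fixes f :: "'a \<Rightarrow> 'b::{banach, second_countable_topology}"
  assumes "f \<in> borel_measurable P"
  shows "expectation (\<lambda>\<omega>. f (X \<tau> \<omega>)) = integral\<^sup>L P f"
  using integral_distr[OF X_measurable assms, of \<tau>] law[of \<tau>] by simp

lemma integrable_X:
  fixes f :: "'a \<Rightarrow> 'b::{banach, second_countable_topology}"
  assumes "integrable P f"
  shows "integrable M (\<lambda>\<omega>. f (X \<tau> \<omega>))"
  using integrable_distr_eq[OF X_measurable borel_measurable_integrable[OF assms], of \<tau>] law[of \<tau>] assms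
  by simp

lemma bounded_integrable:
  fixes f :: "'a \<Rightarrow> real"
  assumes "f \<in> borel_measurable P" "\<And>\<theta>. \<theta> \<in> space P \<Longrightarrow> \<bar>f \<theta>\<bar> \<le> B"
  shows "integrable P f"
  using assms by (intro P.integrable_const_bound[of _ B] AE_I2) auto

text \<open>
  The next observation is independent of the partial sum of the earlier ones, so it may be integrated
  out first (Fubini).
\<close>

lemma expectation_partial_sum:
  fixes Y :: "'a \<Rightarrow> 'b::euclidean_space" and g :: "'b \<Rightarrow> 'a \<Rightarrow> real"
  assumes Y [measurable]: "Y \<in> borel_measurable P"
    and g [measurable]: "(\<lambda>(x, \<theta>). g x \<theta>) \<in> borel_measurable (borel \<Otimes>\<^sub>M P)"
    and int: "integrable M (\<lambda>\<omega>. g (\<Sum>\<tau><k. Y (X \<tau> \<omega>)) (X k \<omega>))"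
  shows "expectation (\<lambda>\<omega>. g (\<Sum>\<tau><k. Y (X \<tau> \<omega>)) (X k \<omega>)) =
    expectation (\<lambda>\<omega>. \<integral>\<theta>. g (\<Sum>\<tau><k. Y (X \<tau> \<omega>)) \<theta> \<partial>P)"
proof -
  define R where "R A \<omega> = restrict (\<lambda>i. X i \<omega>) A" for A :: "nat set" and \<omega>
  define N where "N A = PiM A (\<lambda>_. P)" for A :: "nat set"
  have R [measurable]: "R A \<in> M \<rightarrow>\<^sub>M N A" for A unfolding R_def N_def by measurable
  interpret R: prob_space "distr M (N A) (R A)" for A by (rule prob_space_distr) simp
  interpret pair_sigma_finite "distr M (N {..<k}) (R {..<k})" "distr M (N {k}) (R {k})" ..
  have eq: "distr M (N {..<k}) (R {..<k}) \<Otimes>\<^sub>M distr M (N {k}) (R {k}) =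
    distr M (N {..<k} \<Otimes>\<^sub>M N {k}) (\<lambda>\<omega>. (R {..<k} \<omega>, R {k} \<omega>))"
    using indep_var_restrict[OF indep, of "{..<k}" "{k}"]
    unfolding indep_var_distribution_eq R_def N_def by simp
  have [measurable]: "(\<lambda>f. f i) \<in> N A \<rightarrow>\<^sub>M P" if "i \<in> A" for i A
    unfolding N_def using that by measurable
  define s where "s f = (\<Sum>\<tau><k. Y (f \<tau>))" for f :: "nat \<Rightarrow> 'a"
  have s [measurable]: "s \<in> borel_measurable (N {..<k})"
    unfolding s_def by (intro borel_measurable_sum measurable_compose[OF _ Y]) simp
  have [measurable]: "(\<lambda>f. f k) \<in> N {k} \<rightarrow>\<^sub>M P" by simp
  have gs [measurable]: "(\<lambda>(f, f'). g (s f) (f' k)) \<in> borel_measurable (N {..<k} \<Otimes>\<^sub>M N {k})"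
    by measurable
  have sR: "s (R {..<k} \<omega>) = (\<Sum>\<tau><k. Y (X \<tau> \<omega>))" for \<omega> by (simp add: s_def R_def)
  have int': "integrable (distr M (N {..<k}) (R {..<k}) \<Otimes>\<^sub>M distr M (N {k}) (R {k}))
      (\<lambda>(f, f'). g (s f) (f' k))"
    unfolding eq using int by (subst integrable_distr_eq) (auto simp: sR, simp add: R_def)
  have "expectation (\<lambda>\<omega>. g (\<Sum>\<tau><k. Y (X \<tau> \<omega>)) (X k \<omega>)) =
    integral\<^sup>L (distr M (N {..<k}) (R {..<k}) \<Otimes>\<^sub>M distr M (N {k}) (R {k})) (\<lambda>(f, f'). g (s f) (f' k))"
    unfolding eq by (subst integral_distr) (auto simp: sR, simp add: R_def)
  also have "\<dots> = (\<integral>f. (\<integral>f'. g (s f) (f' k) \<partial>distr M (N {k}) (R {k})) \<partial>distr M (N {..<k}) (R {..<k}))"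
    using integral_fst'[OF int'] by simp
  also have "\<dots> = (\<integral>f. (\<integral>\<theta>. g (s f) \<theta> \<partial>P) \<partial>distr M (N {..<k}) (R {..<k}))"
  proof (rule Bochner_Integration.integral_cong[OF refl])
    fix f
    have "(\<integral>f'. g (s f) (f' k) \<partial>distr M (N {k}) (R {k})) = expectation (\<lambda>\<omega>. g (s f) (X k \<omega>))"
      by (subst integral_distr) (auto simp: R_def)
    also have "\<dots> = (\<integral>\<theta>. g (s f) \<theta> \<partial>P)" by (rule expectation_X) simp
    finally show "(\<integral>f'. g (s f) (f' k) \<partial>distr M (N {k}) (R {k})) = (\<integral>\<theta>. g (s f) \<theta> \<partial>P)" .
  qed
  also have "\<dots> = expectation (\<lambda>\<omega>. \<integral>\<theta>. g (\<Sum>\<tau><k. Y (X \<tau> \<omega>)) \<theta> \<partial>P)"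
    by (subst integral_distr) (auto simp: sR)
  finally show ?thesis .
qed

lemma second_moment_partial_sum:
  fixes f :: "'a \<Rightarrow> real"
  assumes f [measurable]: "f \<in> borel_measurable P" and bd: "\<And>\<theta>. \<theta> \<in> space P \<Longrightarrow> \<bar>f \<theta>\<bar> \<le> B"
    and mean: "integral\<^sup>L P f = 0"
  shows "expectation (\<lambda>\<omega>. (\<Sum>\<tau><k. f (X \<tau> \<omega>))\<^sup>2) = real k * (\<integral>\<theta>. (f \<theta>)\<^sup>2 \<partial>P)"
proof (induction k)
  case 0
  show ?case by simp
next
  case (Suc k)
  define S where "S \<omega> = (\<Sum>\<tau><k. f (X \<tau> \<omega>))" for \<omega>
  have S [measurable]: "S \<in> borel_measurable M" unfolding S_def by measurable
  have bdX: "\<bar>f (X \<tau> \<omega>)\<bar> \<le> B" if "\<omega> \<in> space M" for \<tau> \<omega> using bd X_in_space[OF that] by auto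
  have bdS: "\<bar>S \<omega>\<bar> \<le> real k * B" if "\<omega> \<in> space M" for \<omega>
  proof -
    have "\<bar>S \<omega>\<bar> \<le> (\<Sum>\<tau><k. \<bar>f (X \<tau> \<omega>)\<bar>)" unfolding S_def by (rule sum_abs)
    also have "\<dots> \<le> (\<Sum>\<tau><k. B)" by (rule sum_mono) (use bdX[OF that] in auto)
    finally show ?thesis by simp
  qed
  have B: "0 \<le> B" using bd P.not_empty by (meson abs_ge_zero all_not_in_conv order_trans)
  have i1: "integrable M (\<lambda>\<omega>. (S \<omega>)\<^sup>2)"
    by (rule integrable_const_bound[of _ "(real k * B)\<^sup>2"])
      (use bdS norm_square_le in \<open>auto intro!: AE_I2\<close>)
  have i2: "integrable M (\<lambda>\<omega>. S \<omega> * f (X k \<omega>))"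
    by (rule integrable_const_bound[of _ "(real k * B) * B"])
      (use bdS bdX B in \<open>auto intro!: AE_I2 mult_mono simp: abs_mult\<close>)
  have if2: "integrable P (\<lambda>\<theta>. (f \<theta>)\<^sup>2)"
    by (rule P.integrable_const_bound[of _ "B\<^sup>2"])
      (use bd norm_square_le in \<open>auto intro!: AE_I2\<close>)
  have i3: "integrable M (\<lambda>\<omega>. (f (X k \<omega>))\<^sup>2)" by (rule integrable_X[OF if2])
  have "expectation (\<lambda>\<omega>. S \<omega> * f (X k \<omega>)) = expectation (\<lambda>\<omega>. \<integral>\<theta>. S \<omega> * f \<theta> \<partial>P)"
    using expectation_partial_sum[OF f, of "\<lambda>x \<theta>. x * f \<theta>" k] i2 unfolding S_def by simp
  also have "\<dots> = 0" using mean by simp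
  finally have cross: "expectation (\<lambda>\<omega>. S \<omega> * f (X k \<omega>)) = 0" .
  have "expectation (\<lambda>\<omega>. (\<Sum>\<tau><Suc k. f (X \<tau> \<omega>))\<^sup>2)
      = expectation (\<lambda>\<omega>. (S \<omega>)\<^sup>2 + 2 * (S \<omega> * f (X k \<omega>)) + (f (X k \<omega>))\<^sup>2)"
    by (rule Bochner_Integration.integral_cong) (auto simp: S_def power2_eq_square algebra_simps)
  also have "\<dots> = expectation (\<lambda>\<omega>. (S \<omega>)\<^sup>2) + expectation (\<lambda>\<omega>. (f (X k \<omega>))\<^sup>2)"
    using i1 i2 i3 cross by simp
  also have "expectation (\<lambda>\<omega>. (f (X k \<omega>))\<^sup>2) = (\<integral>\<theta>. (f \<theta>)\<^sup>2 \<partial>P)"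
    by (rule expectation_X) simp
  finally show ?case using Suc by (simp add: S_def algebra_simps)
qed

text \<open>
  Chebyshev's inequality, with the variance bounded by the second moment.  The bound is explicit
  because it will also be applied to functions \<open>f\<close> that shrink as the sample grows.
\<close>

lemma sum_deviation:
  fixes f :: "'a \<Rightarrow> real"
  assumes f [measurable]: "f \<in> borel_measurable P" and bd: "\<And>\<theta>. \<theta> \<in> space P \<Longrightarrow> \<bar>f \<theta>\<bar> \<le> B"
    and a: "0 < a"
  shows "prob {\<omega> \<in> space M. a \<le> \<bar>(\<Sum>\<tau><k. f (X \<tau> \<omega>)) - real k * integral\<^sup>L P f\<bar>} \<le>
    real k * (\<integral>\<theta>. (f \<theta>)\<^sup>2 \<partial>P) / a\<^sup>2"
proof -
  define m where "m = integral\<^sup>L P f"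
  define f0 where "f0 \<theta> = f \<theta> - m" for \<theta>
  have f0 [measurable]: "f0 \<in> borel_measurable P" unfolding f0_def by measurable
  have if1: "integrable P f" using bounded_integrable[OF f bd] .
  have B: "0 \<le> B" using bd P.not_empty by (meson abs_ge_zero all_not_in_conv order_trans)
  have if2: "integrable P (\<lambda>\<theta>. (f \<theta>)\<^sup>2)"
    by (rule P.integrable_const_bound[of _ "B\<^sup>2"])
      (use bd norm_square_le in \<open>auto intro!: AE_I2\<close>)
  have m0: "integral\<^sup>L P f0 = 0" unfolding f0_def m_def using if1 by (simp add: P.prob_space)
  have bd0: "\<bar>f0 \<theta>\<bar> \<le> B + \<bar>m\<bar>" if "\<theta> \<in> space P" for \<theta> using bd[OF that] unfolding f0_def by linarith
  have sq: "(\<integral>\<theta>. (f0 \<theta>)\<^sup>2 \<partial>P) \<le> (\<integral>\<theta>. (f \<theta>)\<^sup>2 \<partial>P)"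
  proof -
    have "(\<integral>\<theta>. (f0 \<theta>)\<^sup>2 \<partial>P) = (\<integral>\<theta>. (f \<theta>)\<^sup>2 \<partial>P) - m\<^sup>2"
      unfolding f0_def m_def using P.variance_eq[OF if1 if2] by simp
    then show ?thesis by simp
  qed
  define S where "S \<omega> = (\<Sum>\<tau><k. f0 (X \<tau> \<omega>))" for \<omega>
  have S [measurable]: "S \<in> borel_measurable M" unfolding S_def by measurable
  have bdX: "\<bar>f0 (X \<tau> \<omega>)\<bar> \<le> B + \<bar>m\<bar>" if "\<omega> \<in> space M" for \<tau> \<omega> using bd0 X_in_space[OF that] by auto
  have bdS: "\<bar>S \<omega>\<bar> \<le> real k * (B + \<bar>m\<bar>)" if "\<omega> \<in> space M" for \<omega>
  proof -
    have "\<bar>S \<omega>\<bar> \<le> (\<Sum>\<tau><k. \<bar>f0 (X \<tau> \<omega>)\<bar>)" unfolding S_def by (rule sum_abs)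
    also have "\<dots> \<le> (\<Sum>\<tau><k. B + \<bar>m\<bar>)" by (rule sum_mono) (use bdX[OF that] in auto)
    finally show ?thesis by simp
  qed
  have i1: "integrable M (\<lambda>\<omega>. (S \<omega>)\<^sup>2)"
    by (rule integrable_const_bound[of _ "(real k * (B + \<bar>m\<bar>))\<^sup>2"])
      (use bdS norm_square_le in \<open>auto intro!: AE_I2\<close>)
  have "prob {\<omega> \<in> space M. a\<^sup>2 \<le> (S \<omega>)\<^sup>2} \<le> expectation (\<lambda>\<omega>. (S \<omega>)\<^sup>2) / a\<^sup>2"
    using i1 a by (intro integral_Markov_inequality_measure[where A="{}"]) auto
  also have "expectation (\<lambda>\<omega>. (S \<omega>)\<^sup>2) = real k * (\<integral>\<theta>. (f0 \<theta>)\<^sup>2 \<partial>P)"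
    unfolding S_def by (rule second_moment_partial_sum[OF f0 bd0 m0])
  also have "\<dots> / a\<^sup>2 \<le> real k * (\<integral>\<theta>. (f \<theta>)\<^sup>2 \<partial>P) / a\<^sup>2"
    using sq a by (intro divide_right_mono mult_left_mono) auto
  also have "{\<omega> \<in> space M. a\<^sup>2 \<le> (S \<omega>)\<^sup>2} =
     {\<omega> \<in> space M. a \<le> \<bar>(\<Sum>\<tau><k. f (X \<tau> \<omega>)) - real k * integral\<^sup>L P f\<bar>}"
    using a by (auto simp: S_def f0_def m_def sum_subtractf abs_le_square_iff[symmetric])
  finally show ?thesis .
qed

lemma law_of_large_numbers:
  fixes f :: "'a \<Rightarrow> real"
  assumes f [measurable]: "f \<in> borel_measurable P" and bd: "\<And>\<theta>. \<theta> \<in> space P \<Longrightarrow> \<bar>f \<theta>\<bar> \<le> B"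
    and a: "0 < a"
  shows "whp M (\<lambda>t \<omega>. \<bar>emp_mean t (\<lambda>\<tau>. X \<tau> \<omega>) f - integral\<^sup>L P f\<bar> < a)"
proof (rule whp_by_bound)
  let ?B = "\<lambda>t. {\<omega> \<in> space M. real t * a \<le> \<bar>(\<Sum>\<tau><t. f (X \<tau> \<omega>)) - real t * integral\<^sup>L P f\<bar>}"
  let ?v = "\<integral>\<theta>. (f \<theta>)\<^sup>2 \<partial>P"
  show "\<forall>\<^sub>F t in sequentially. ?B t \<in> events \<and> prob (?B t) \<le> (?v / a\<^sup>2) / real t"
    using eventually_gt_at_top[of 0]
  proof eventually_elim
    case (elim t)
    then have "prob (?B t) \<le> real t * ?v / (real t * a)\<^sup>2"
      using a by (intro sum_deviation[OF f bd]) auto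
    also have "\<dots> = (?v / a\<^sup>2) / real t"
      using elim a by (simp add: power2_eq_square field_simps)
    finally show ?case by simp
  qed
  show "(\<lambda>t. (?v / a\<^sup>2) / real t) \<longlonglongrightarrow> 0"
    by (rule lim_const_over_n)
  show "\<forall>\<^sub>F t in sequentially. \<forall>\<omega>\<in>space M - ?B t. \<bar>emp_mean t (\<lambda>\<tau>. X \<tau> \<omega>) f - integral\<^sup>L P f\<bar> < a"
    using eventually_gt_at_top[of 0]
  proof eventually_elim
    case (elim t)
    show ?case
    proof
      fix \<omega> assume "\<omega> \<in> space M - ?B t"
      then have *: "\<bar>(\<Sum>\<tau><t. f (X \<tau> \<omega>)) - real t * integral\<^sup>L P f\<bar> < real t * a" by auto
      have eq: "emp_mean t (\<lambda>\<tau>. X \<tau> \<omega>) f - integral\<^sup>L P f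
        = ((\<Sum>\<tau><t. f (X \<tau> \<omega>)) - real t * integral\<^sup>L P f) / real t"
        using elim by (simp add: emp_mean_def field_simps)
      show "\<bar>emp_mean t (\<lambda>\<tau>. X \<tau> \<omega>) f - integral\<^sup>L P f\<bar> < a"
        unfolding eq abs_divide using * elim by (simp add: divide_less_eq mult.commute)
    qed
  qed
qed

end

section \<open>Exchanging the summands of two independent sums\<close>

lemma finite_set_replicate_pmf: "finite (set_pmf p) \<Longrightarrow> finite (set_pmf (replicate_pmf k p))"
  unfolding set_replicate_pmf lists_eq_set using finite_lists_length_eq[of "set_pmf p" k]
  by (simp add: conj_commute Collect_conj_eq)

lemma expectation_finite_pmf:
  fixes f :: "'c \<Rightarrow> real"
  assumes "finite (set_pmf p)"
  shows "measure_pmf.expectation p f = (\<Sum>j\<in>set_pmf p. pmf p j * f j)"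
  using integral_measure_pmf[of "set_pmf p" p f] assms by simp

lemma expectation_replicate_pmf_Suc:
  fixes f :: "'c list \<Rightarrow> real"
  assumes "finite (set_pmf p)"
  shows "measure_pmf.expectation (replicate_pmf (Suc k) p) f =
    (\<Sum>j\<in>set_pmf p. pmf p j * measure_pmf.expectation (replicate_pmf k p) (\<lambda>l. f (j # l)))"
proof -
  have eq: "replicate_pmf (Suc k) p = p \<bind> (\<lambda>j. map_pmf ((#) j) (replicate_pmf k p))"
    by (simp add: map_pmf_def)
  show ?thesis unfolding eq
    using assms finite_set_replicate_pmf[OF assms, of k]
    by (subst pmf_expectation_bind[of "set_pmf p"]) simp_all
qed

context iid_sample begin

text \<open>
  Let \<open>U\<close> and \<open>V\<close> average a function over one step of the first and of the second walk.  The two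
  expectations are the \<open>k\<close>-fold iterates of \<open>U\<close> and \<open>V\<close> applied to \<open>\<phi>\<close>.  Averaging does not increase
  the supremum norm, and \<open>U\<close> and \<open>V\<close> commute because \<open>V\<close> is a finite sum; so telescoping costs at most
  \<open>e\<close> per step, and the one-step bound is needed for the original function \<open>\<phi>\<close> only, not for its
  iterates.
\<close>

lemma lindeberg_exchange:
  fixes Y :: "'a \<Rightarrow> 'b::euclidean_space" and z :: "'c \<Rightarrow> 'b" and \<phi> :: "'b \<Rightarrow> real"
  assumes Y [measurable]: "Y \<in> borel_measurable P" and p: "finite (set_pmf p)"
    and \<phi> [measurable]: "\<phi> \<in> borel_measurable borel" and bd: "\<And>x. \<bar>\<phi> x\<bar> \<le> B"
    and step: "\<And>x. \<bar>(\<integral>\<theta>. \<phi> (x + Y \<theta>) \<partial>P) - measure_pmf.expectation p (\<lambda>j. \<phi> (x + z j))\<bar> \<le> e"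
  shows "\<bar>expectation (\<lambda>\<omega>. \<phi> (x + (\<Sum>\<tau><k. Y (X \<tau> \<omega>)))) -
      measure_pmf.expectation (replicate_pmf k p) (\<lambda>l. \<phi> (x + sum_list (map z l)))\<bar> \<le> real k * e"
proof (induction k arbitrary: x)
  case 0
  show ?case by (simp add: prob_space)
next
  case (Suc k)
  define S where "S \<omega> = (\<Sum>\<tau><k. Y (X \<tau> \<omega>))" for \<omega>
  have S [measurable]: "S \<in> borel_measurable M" unfolding S_def by measurable
  define U where "U x = (\<integral>\<theta>. \<phi> (x + Y \<theta>) \<partial>P)" for x
  define V where "V x = (\<Sum>j\<in>set_pmf p. pmf p j * \<phi> (x + z j))" for x
  have [measurable]: "U \<in> borel_measurable borel" "V \<in> borel_measurable borel"
    unfolding U_def V_def by measurable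
  have int\<phi>: "integrable M (\<lambda>\<omega>. \<phi> (f \<omega>))" if [measurable]: "f \<in> borel_measurable M" for f
    by (rule integrable_const_bound[of _ B]) (use bd in \<open>auto intro!: AE_I2\<close>)
  have bdU: "\<bar>U x\<bar> \<le> B" for x
  proof -
    have "\<bar>U x\<bar> \<le> (\<integral>\<theta>. \<bar>\<phi> (x + Y \<theta>)\<bar> \<partial>P)" unfolding U_def by (rule integral_abs_bound)
    also have "\<dots> \<le> (\<integral>\<theta>. B \<partial>P)"
      by (rule integral_mono) (auto intro!: P.integrable_const_bound[of _ B] AE_I2 bd)
    finally show ?thesis by (simp add: P.prob_space)
  qed
  have intU: "integrable M (\<lambda>\<omega>. U (x + S \<omega>))"
    by (rule integrable_const_bound[of _ B]) (use bdU in \<open>auto intro!: AE_I2\<close>)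
  have intV: "integrable M (\<lambda>\<omega>. V (x + S \<omega>))"
    unfolding V_def by (intro Bochner_Integration.integrable_sum integrable_mult_right int\<phi>) measurable
  have UV: "\<bar>U x - V x\<bar> \<le> e" for x
    using step[of x] unfolding U_def V_def expectation_finite_pmf[OF p] .
  \<comment> \<open>Replace the last summand of the first sum.\<close>
  have "expectation (\<lambda>\<omega>. \<phi> (x + (\<Sum>\<tau><Suc k. Y (X \<tau> \<omega>)))) = expectation (\<lambda>\<omega>. \<phi> ((x + S \<omega>) + Y (X k \<omega>)))"
    by (simp add: S_def add_ac)
  also have "\<dots> = expectation (\<lambda>\<omega>. U (x + S \<omega>))"
    using expectation_partial_sum[OF Y, of "\<lambda>s \<theta>. \<phi> ((x + s) + Y \<theta>)" k] int\<phi>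
    unfolding U_def S_def by simp
  finally have 1: "\<bar>expectation (\<lambda>\<omega>. \<phi> (x + (\<Sum>\<tau><Suc k. Y (X \<tau> \<omega>)))) - expectation (\<lambda>\<omega>. V (x + S \<omega>))\<bar> \<le> e"
  proof -
    assume eq: "expectation (\<lambda>\<omega>. \<phi> (x + (\<Sum>\<tau><Suc k. Y (X \<tau> \<omega>)))) = expectation (\<lambda>\<omega>. U (x + S \<omega>))"
    have "\<bar>expectation (\<lambda>\<omega>. U (x + S \<omega>)) - expectation (\<lambda>\<omega>. V (x + S \<omega>))\<bar>
      = \<bar>expectation (\<lambda>\<omega>. U (x + S \<omega>) - V (x + S \<omega>))\<bar>"
      using intU intV by simp
    also have "\<dots> \<le> expectation (\<lambda>\<omega>. \<bar>U (x + S \<omega>) - V (x + S \<omega>)\<bar>)" by (rule integral_abs_bound)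
    also have "\<dots> \<le> expectation (\<lambda>\<omega>. e)"
      using intU intV UV by (intro integral_mono) auto
    finally show ?thesis unfolding eq by (simp add: prob_space)
  qed
  \<comment> \<open>Averaging over the finite law commutes with the expectation.\<close>
  define a where "a x = expectation (\<lambda>\<omega>. \<phi> (x + S \<omega>))" for x
  define b where "b x = measure_pmf.expectation (replicate_pmf k p) (\<lambda>l. \<phi> (x + sum_list (map z l)))" for x
  have "expectation (\<lambda>\<omega>. V (x + S \<omega>)) = (\<Sum>j\<in>set_pmf p. pmf p j * expectation (\<lambda>\<omega>. \<phi> (x + S \<omega> + z j)))"
    unfolding V_def using int\<phi> by (subst Bochner_Integration.integral_sum) auto
  also have "\<dots> = (\<Sum>j\<in>set_pmf p. pmf p j * a (x + z j))"
    unfolding a_def by (simp add: add_ac)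
  finally have 2: "expectation (\<lambda>\<omega>. V (x + S \<omega>)) = (\<Sum>j\<in>set_pmf p. pmf p j * a (x + z j))" .
  have 3: "measure_pmf.expectation (replicate_pmf (Suc k) p) (\<lambda>l. \<phi> (x + sum_list (map z l)))
      = (\<Sum>j\<in>set_pmf p. pmf p j * b (x + z j))"
    unfolding expectation_replicate_pmf_Suc[OF p] b_def by (simp add: add_ac)
  have ab: "\<bar>a x - b x\<bar> \<le> real k * e" for x
    using Suc.IH[of x] unfolding a_def b_def S_def .
  have "\<bar>(\<Sum>j\<in>set_pmf p. pmf p j * a (x + z j)) - (\<Sum>j\<in>set_pmf p. pmf p j * b (x + z j))\<bar>
    = \<bar>\<Sum>j\<in>set_pmf p. pmf p j * (a (x + z j) - b (x + z j))\<bar>"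
    by (simp add: sum_subtractf algebra_simps)
  also have "\<dots> \<le> (\<Sum>j\<in>set_pmf p. \<bar>pmf p j * (a (x + z j) - b (x + z j))\<bar>)" by (rule sum_abs)
  also have "\<dots> \<le> (\<Sum>j\<in>set_pmf p. pmf p j * (real k * e))"
    by (rule sum_mono) (auto simp: abs_mult intro!: mult_left_mono ab)
  also have "\<dots> = real k * e"
    using sum_pmf_eq_1[OF p order_refl] by (simp add: sum_distrib_right[symmetric])
  finally show ?case using 1 2 3 by (simp add: algebra_simps)
qed

end

section \<open>Smooth test functions\<close>

text \<open>
  A second-order expansion at every point, whose quadratic coefficients are bounded and whose
  remainder is cubic, with one constant for all base points.  This is exactly what one exchange step
  consumes; derivatives are not mentioned, so that closure under linear combinations is immediate.
\<close>

definition third_order_smooth :: "(real^'n \<Rightarrow> real) \<Rightarrow> bool" where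
  "third_order_smooth \<phi> \<longleftrightarrow> (\<exists>a B C. \<forall>x. (\<forall>i j. \<bar>B x i j\<bar> \<le> C) \<and>
     (\<forall>y. \<bar>\<phi> (x + y) - \<phi> x - a x \<bullet> y - (\<Sum>i\<in>UNIV. \<Sum>j\<in>UNIV. B x i j * (y $ i * y $ j))\<bar>
        \<le> C * norm y ^ 3))"

lemma third_order_smoothE:
  assumes "third_order_smooth \<phi>"
  obtains a B C where "\<And>x i j. \<bar>B x i j\<bar> \<le> C"
    "\<And>x y. \<bar>\<phi> (x + y) - \<phi> x - a x \<bullet> y - (\<Sum>i\<in>UNIV. \<Sum>j\<in>UNIV. B x i j * (y $ i * y $ j))\<bar>
        \<le> C * norm y ^ 3"
proof -
  obtain a B C where *: "\<forall>x. (\<forall>i j. \<bar>B x i j\<bar> \<le> C) \<and>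
     (\<forall>y. \<bar>\<phi> (x + y) - \<phi> x - a x \<bullet> y - (\<Sum>i\<in>UNIV. \<Sum>j\<in>UNIV. B x i j * (y $ i * y $ j))\<bar>
        \<le> C * norm y ^ 3)"
    using assms unfolding third_order_smooth_def by blast
  show ?thesis by (rule that[of B C a]) (use * in blast)+
qed

lemma third_order_smooth_scale:
  assumes "third_order_smooth \<phi>"
  shows "third_order_smooth (\<lambda>x. c * \<phi> x)"
proof -
  obtain a B C where *: "\<And>x i j. \<bar>B x i j\<bar> \<le> C"
     "\<And>x y. \<bar>\<phi> (x + y) - \<phi> x - a x \<bullet> y - (\<Sum>i\<in>UNIV. \<Sum>j\<in>UNIV. B x i j * (y $ i * y $ j))\<bar>
        \<le> C * norm y ^ 3"
    by (rule third_order_smoothE[OF assms]) (rule that; assumption)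
  show ?thesis unfolding third_order_smooth_def
  proof (intro exI allI conjI)
    fix x i j
    show "\<bar>c * B x i j\<bar> \<le> \<bar>c\<bar> * C" using * by (simp add: abs_mult mult_left_mono)
  next
    fix x y
    have "\<bar>c * (\<phi> (x + y) - \<phi> x - a x \<bullet> y - (\<Sum>i\<in>UNIV. \<Sum>j\<in>UNIV. B x i j * (y $ i * y $ j)))\<bar>
        \<le> \<bar>c\<bar> * (C * norm y ^ 3)" using * by (simp add: abs_mult mult_left_mono)
    then show "\<bar>c * \<phi> (x + y) - c * \<phi> x - (c *\<^sub>R a x) \<bullet> y -
      (\<Sum>i\<in>UNIV. \<Sum>j\<in>UNIV. c * B x i j * (y $ i * y $ j))\<bar> \<le> \<bar>c\<bar> * C * norm y ^ 3"
      by (simp add: algebra_simps sum_distrib_left)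
  qed
qed

lemma third_order_smooth_add:
  assumes "third_order_smooth \<phi>" "third_order_smooth \<psi>"
  shows "third_order_smooth (\<lambda>x. \<phi> x + \<psi> x)"
proof -
  obtain a B C where *: "\<And>x i j. \<bar>B x i j\<bar> \<le> C"
     "\<And>x y. \<bar>\<phi> (x + y) - \<phi> x - a x \<bullet> y - (\<Sum>i\<in>UNIV. \<Sum>j\<in>UNIV. B x i j * (y $ i * y $ j))\<bar>
        \<le> C * norm y ^ 3"
    by (rule third_order_smoothE[OF assms(1)]) (rule that; assumption)
  obtain a' B' C' where **: "\<And>x i j. \<bar>B' x i j\<bar> \<le> C'"
     "\<And>x y. \<bar>\<psi> (x + y) - \<psi> x - a' x \<bullet> y - (\<Sum>i\<in>UNIV. \<Sum>j\<in>UNIV. B' x i j * (y $ i * y $ j))\<bar>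
        \<le> C' * norm y ^ 3"
    by (rule third_order_smoothE[OF assms(2)]) (rule that; assumption)
  show ?thesis unfolding third_order_smooth_def
  proof (intro exI allI conjI)
    fix x i j
    show "\<bar>B x i j + B' x i j\<bar> \<le> C + C'" using *(1)[of x i j] **(1)[of x i j] by linarith
  next
    fix x y
    have "(\<Sum>i\<in>UNIV. \<Sum>j\<in>UNIV. (B x i j + B' x i j) * (y $ i * y $ j)) =
      (\<Sum>i\<in>UNIV. \<Sum>j\<in>UNIV. B x i j * (y $ i * y $ j)) + (\<Sum>i\<in>UNIV. \<Sum>j\<in>UNIV. B' x i j * (y $ i * y $ j))"
      by (simp add: algebra_simps sum.distrib)
    moreover have "(a x + a' x) \<bullet> y = a x \<bullet> y + a' x \<bullet> y" by (rule inner_add_left)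
    ultimately show "\<bar>\<phi> (x + y) + \<psi> (x + y) - (\<phi> x + \<psi> x) - (a x + a' x) \<bullet> y -
      (\<Sum>i\<in>UNIV. \<Sum>j\<in>UNIV. (B x i j + B' x i j) * (y $ i * y $ j))\<bar> \<le> (C + C') * norm y ^ 3"
      using *(2)[of x y] **(2)[of x y] unfolding distrib_right by linarith
  qed
qed

lemma third_order_smooth_sum:
  assumes "\<And>i. i \<in> I \<Longrightarrow> third_order_smooth (\<phi> i)"
  shows "third_order_smooth (\<lambda>x. \<Sum>i\<in>I. \<phi> i x)"
proof -
  have 0: "third_order_smooth (\<lambda>x. 0)" unfolding third_order_smooth_def
    by (intro exI[of _ "\<lambda>_. 0"] exI[of _ "\<lambda>_ _ _. 0"] exI[of _ 0]) simp
  show ?thesis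
    using assms
  proof (induction I rule: infinite_finite_induct)
    case (insert i I)
    then show ?case using third_order_smooth_add[of "\<phi> i" "\<lambda>x. \<Sum>i\<in>I. \<phi> i x"] by auto
  qed (simp_all add: 0)
qed

definition qform :: "real^'n^'n \<Rightarrow> real^'n \<Rightarrow> real" where
  "qform A x = (x \<bullet> (A *v x)) / 2"

definition psd :: "real^'n^'n \<Rightarrow> bool" where
  "psd A \<longleftrightarrow> transpose A = A \<and> (\<forall>x. 0 \<le> x \<bullet> (A *v x))"

lemma symmetric_inner: "transpose A = A \<Longrightarrow> x \<bullet> (A *v y) = y \<bullet> (A *v x)" for A :: "real^'n^'n"
  by (metis dot_lmul_matrix inner_commute transpose_matrix_vector)

lemma qform_add:
  assumes "transpose A = A"
  shows "qform A (x + y) = qform A x + x \<bullet> (A *v y) + qform A y"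
  using symmetric_inner[OF assms, of y x]
  by (simp add: qform_def matrix_vector_right_distrib inner_add_left inner_add_right field_simps)

lemma qform_scaleR: "qform A (c *\<^sub>R x) = c\<^sup>2 * qform A x"
  by (simp add: qform_def matrix_vector_mult_scaleR power2_eq_square)

lemma psd_qform_nonneg: "psd A \<Longrightarrow> 0 \<le> qform A x"
  by (simp add: psd_def qform_def)

text \<open>
  A nonnegative quadratic polynomial in \<open>r\<close>, the form at \<open>x + r *\<^sub>R y\<close>, has a nonpositive
  discriminant; if it degenerates to a linear polynomial, its slope is zero.
\<close>

lemma psd_cauchy_schwarz:
  assumes "psd A"
  shows "(x \<bullet> (A *v y))\<^sup>2 \<le> 4 * qform A x * qform A y"
proof -
  define m where "m = x \<bullet> (A *v y)"
  have tr: "transpose A = A" using assms by (simp add: psd_def)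
  have *: "0 \<le> qform A x + r * m + r\<^sup>2 * qform A y" for r
    using psd_qform_nonneg[OF assms, of "x + r *\<^sub>R y"]
    by (simp add: qform_add[OF tr] qform_scaleR matrix_vector_mult_scaleR m_def)
  show ?thesis
  proof (cases "qform A y = 0")
    case True
    have "m = 0"
    proof (rule ccontr)
      assume "m \<noteq> 0"
      then show False using *[of "- (qform A x + 1) / m"] True by (simp add: field_simps)
    qed
    then show ?thesis by (simp add: m_def[symmetric] True)
  next
    case False
    then have k: "0 < qform A y" using psd_qform_nonneg[OF assms, of y] by simp
    have "0 \<le> qform A x - m\<^sup>2 / (4 * qform A y)"
      using *[of "- m / (2 * qform A y)"] k by (simp add: power2_eq_square field_simps)
    then have "m\<^sup>2 / (4 * qform A y) \<le> qform A x" by simp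
    then show ?thesis using k by (simp add: m_def[symmetric] field_simps)
  qed
qed

lemma qform_le_norm: "\<exists>L\<ge>0. \<forall>x. qform A x \<le> L * (norm x)\<^sup>2" for A :: "real^'n^'n"
proof -
  have bl: "bounded_linear ((*v) A)" by (rule matrix_vector_mul_bounded_linear)
  obtain L where L: "0 \<le> L" "\<And>x. norm (A *v x) \<le> norm x * L"
    using bounded_linear.nonneg_bounded[OF bl] by blast
  have "qform A x \<le> (L / 2) * (norm x)\<^sup>2" for x
  proof -
    have "x \<bullet> (A *v x) \<le> norm x * norm (A *v x)" by (rule norm_cauchy_schwarz)
    also have "\<dots> \<le> norm x * (norm x * L)" using L by (intro mult_left_mono) auto
    finally show ?thesis by (simp add: qform_def power2_eq_square algebra_simps)
  qed
  then show ?thesis using L(1) by (intro exI[of _ "L / 2"]) auto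
qed

text \<open>
  The left-hand side is the third derivative of \<open>exp (- p r)\<close> for a quadratic polynomial \<open>p\<close> with
  \<open>p r = u\<close>, \<open>p' r = v\<close> and \<open>p'' = 2 k\<close>.  The hypothesis on \<open>v\<close> comes from the Cauchy-Schwarz
  inequality; the powers of \<open>u\<close> that it introduces are absorbed by the exponential.
\<close>

lemma gaussian_derivative_bounds:
  fixes u k v :: real
  assumes "0 \<le> u" "0 \<le> k" "v\<^sup>2 \<le> 4 * u * k"
  shows "\<bar>(6 * k * v - v ^ 3) * exp (- u)\<bar> \<le> 20 * (sqrt k) ^ 3"
proof -
  define w where "w = sqrt u"
  have w: "0 \<le> w" "w\<^sup>2 = u" using assms by (auto simp: w_def)
  define r where "r = sqrt k"
  have r: "0 \<le> r" "r\<^sup>2 = k" using assms by (auto simp: r_def)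
  have v: "\<bar>v\<bar> \<le> 2 * w * r"
  proof (rule power2_le_imp_le)
    show "\<bar>v\<bar>\<^sup>2 \<le> (2 * w * r)\<^sup>2" using assms(3) w r by (simp add: power_mult_distrib)
  qed (use w r in auto)
  have "exp u \<ge> 1 + u + u\<^sup>2 / 2" using exp_lower_Taylor_quadratic[OF assms(1)] .
  then have eu: "exp u \<ge> 1 + w\<^sup>2 + w ^ 4 / 2" by (simp add: w(2)[symmetric] power_mult[symmetric])
  have a1: "w \<le> exp u"
  proof -
    have "0 \<le> (w - 1)\<^sup>2" by simp
    then have "2 * w \<le> 1 + w\<^sup>2" by (simp add: power2_eq_square algebra_simps)
    moreover have "0 \<le> w ^ 4" using w by simp
    ultimately show ?thesis using eu w by linarith
  qed
  have a2: "w ^ 3 \<le> exp u"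
  proof -
    have "0 \<le> w\<^sup>2 * (w - 1)\<^sup>2" by simp
    also have "w\<^sup>2 * (w - 1)\<^sup>2 = w ^ 4 - 2 * w ^ 3 + w\<^sup>2" by algebra
    finally have "2 * w ^ 3 \<le> w\<^sup>2 + w ^ 4" by simp
    moreover have "0 \<le> w\<^sup>2" by simp
    ultimately show ?thesis using eu by linarith
  qed
  have "\<bar>6 * k * v - v ^ 3\<bar> \<le> 6 * k * \<bar>v\<bar> + \<bar>v\<bar> ^ 3"
    using abs_triangle_ineq4[of "6 * k * v" "v ^ 3"] assms by (simp add: abs_mult power_abs)
  also have "\<dots> \<le> 6 * k * (2 * w * r) + (2 * w * r) ^ 3"
    using v assms by (intro add_mono mult_left_mono power_mono) auto
  also have "\<dots> = 12 * w * r ^ 3 + 8 * w ^ 3 * r ^ 3"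
    unfolding r(2)[symmetric] by algebra
  also have "\<dots> \<le> 12 * exp u * r ^ 3 + 8 * exp u * r ^ 3"
    using a1 a2 r by (intro add_mono mult_right_mono mult_left_mono) auto
  finally have "\<bar>6 * k * v - v ^ 3\<bar> \<le> 20 * r ^ 3 * exp u" by (simp add: mult_ac)
  then have "\<bar>6 * k * v - v ^ 3\<bar> * exp (- u) \<le> 20 * r ^ 3 * exp u * exp (- u)"
    by (intro mult_right_mono) auto
  then show ?thesis by (simp add: abs_mult r_def mult.assoc exp_minus)
qed

text \<open>
  Taylor's theorem along the segment from \<open>x\<close> to \<open>x + y\<close>.  The third derivative is bounded by a
  multiple of \<open>qform A y\<close> to the power \<open>3 / 2\<close>, uniformly in the base point.
\<close>

lemma third_order_smooth_gaussian:
  assumes A: "psd A"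
  shows "third_order_smooth (\<lambda>x. exp (- qform A x))"
proof -
  have tr: "transpose A = A" using A by (simp add: psd_def)
  obtain L where L: "0 \<le> L" "\<And>x. qform A x \<le> L * (norm x)\<^sup>2" using qform_le_norm[of A] by auto
  define a where "a x = - exp (- qform A x) *\<^sub>R (A *v x)" for x
  define B where "B x i j = (1 / 2) * (((A *v x) $ i * (A *v x) $ j - A $ i $ j) * exp (- qform A x))" for x i j
  define CA where "CA = (\<Sum>i\<in>UNIV. \<Sum>j\<in>UNIV. \<bar>A $ i $ j\<bar>)"
  have CA: "\<bar>A $ i $ j\<bar> \<le> CA" for i j
  proof -
    have "\<bar>A $ i $ j\<bar> \<le> (\<Sum>j\<in>UNIV. \<bar>A $ i $ j\<bar>)" by (rule member_le_sum) auto
    also have "\<dots> \<le> CA" unfolding CA_def by (rule member_le_sum) (auto intro: sum_nonneg)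
    finally show ?thesis .
  qed
  define C where "C = 4 * L + CA + 20 * sqrt L ^ 3"
  have CA0: "0 \<le> CA" unfolding CA_def by (intro sum_nonneg) auto
  have Ai: "((A *v x) $ i)\<^sup>2 \<le> 4 * qform A x * L" for x i
  proof -
    have "(A *v x) $ i = axis i 1 \<bullet> (A *v x)" by (simp add: inner_axis')
    then have "((A *v x) $ i)\<^sup>2 \<le> 4 * qform A (axis i 1) * qform A x"
      using psd_cauchy_schwarz[OF A, of "axis i 1" x] by simp
    also have "\<dots> \<le> 4 * L * qform A x"
      using L(2)[of "axis i 1"] psd_qform_nonneg[OF A, of x]
      by (intro mult_right_mono mult_left_mono) (auto simp: norm_axis_1)
    finally show ?thesis by (simp add: mult_ac)
  qed
  have Bbd: "\<bar>B x i j\<bar> \<le> C" for x i j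
  proof -
    define u where "u = qform A x"
    have u: "0 \<le> u" unfolding u_def by (rule psd_qform_nonneg[OF A])
    have "\<bar>(A *v x) $ i * (A *v x) $ j\<bar> \<le> (((A *v x) $ i)\<^sup>2 + ((A *v x) $ j)\<^sup>2) / 2"
      using sum_squares_bound[of "\<bar>(A *v x) $ i\<bar>" "\<bar>(A *v x) $ j\<bar>"] by (simp add: abs_mult)
    also have "\<dots> \<le> 4 * u * L" using Ai[of x i] Ai[of x j] unfolding u_def by simp
    finally have "\<bar>(A *v x) $ i * (A *v x) $ j\<bar> * exp (- u) \<le> 4 * u * L * exp (- u)"
      by (intro mult_right_mono) auto
    also have "\<dots> = 4 * L * (u * exp (- u))" by simp
    also have "\<dots> \<le> 4 * L * 1"
    proof (intro mult_left_mono)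
      have "u \<le> exp u" using exp_ge_add_one_self[of u] by linarith
      then show "u * exp (- u) \<le> 1" by (simp add: exp_minus field_simps)
    qed (use L in auto)
    finally have 1: "\<bar>(A *v x) $ i * (A *v x) $ j\<bar> * exp (- u) \<le> 4 * L" by simp
    have 2: "\<bar>A $ i $ j\<bar> * exp (- u) \<le> CA * 1" using CA[of i j] u by (intro mult_mono) (auto simp: CA0)
    have "\<bar>((A *v x) $ i * (A *v x) $ j - A $ i $ j) * exp (- u)\<bar> \<le>
      (\<bar>(A *v x) $ i * (A *v x) $ j\<bar> + \<bar>A $ i $ j\<bar>) * exp (- u)"
      unfolding abs_mult[of _ "exp (- u)"] by (simp add: abs_triangle_ineq4)
    also have "\<dots> \<le> 4 * L + CA" using 1 2 unfolding distrib_right by linarith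
    finally have "\<bar>B x i j\<bar> \<le> 1/2 * (4 * L + CA)" unfolding B_def u_def abs_mult by simp
    also have "\<dots> \<le> C" unfolding C_def using L(1) CA0 by simp
    finally show ?thesis .
  qed
  have taylor: "\<bar>exp (- qform A (x + y)) - exp (- qform A x) - a x \<bullet> y -
      (\<Sum>i\<in>UNIV. \<Sum>j\<in>UNIV. B x i j * (y $ i * y $ j))\<bar> \<le> C * norm y ^ 3" for x y
  proof -
    define m k where "m = x \<bullet> (A *v y)" and "k = qform A y"
    define p where "p r = qform A x + r * m + r\<^sup>2 * k" for r
    have p: "p r = qform A (x + r *\<^sub>R y)" for r
      by (simp add: p_def m_def k_def qform_add[OF tr] qform_scaleR matrix_vector_mult_scaleR)
    define diff :: "nat \<Rightarrow> real \<Rightarrow> real" where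
      "diff n r = (if n = 0 then exp (- p r) else if n = 1 then - (m + 2 * r * k) * exp (- p r)
        else if n = 2 then ((m + 2 * r * k)\<^sup>2 - 2 * k) * exp (- p r)
        else (6 * k * (m + 2 * r * k) - (m + 2 * r * k) ^ 3) * exp (- p r))" for n r
    have D: "(diff n has_real_derivative diff (Suc n) r) (at r)" if "n < 3" for n r
    proof -
      have "n = 0 \<or> n = 1 \<or> n = 2" using that by auto
      then show ?thesis
        unfolding diff_def p_def
        by (elim disjE) (auto intro!: derivative_eq_intros simp: power2_eq_square power3_eq_cube algebra_simps)
    qed
    have d0: "diff 0 = (\<lambda>r. exp (- p r))" by (rule ext) (simp add: diff_def)
    obtain r where r: "0 < r" "r < 1"
      "exp (- p 1) = (\<Sum>n<3. (diff n 0 / fact n) * 1 ^ n) + (diff 3 r / fact 3) * 1 ^ 3"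
      using Maclaurin[of 1 3 diff "\<lambda>r. exp (- p r)"] D d0 by auto
    have "exp (- qform A (x + y)) - exp (- qform A x) + m * exp (- qform A x)
        - (1 / 2) * ((m\<^sup>2 - 2 * k) * exp (- qform A x)) = diff 3 r / 6"
    proof -
      have "(\<Sum>n<3. (diff n 0 / fact n) * 1 ^ n) = diff 0 0 + diff 1 0 + diff 2 0 / 2"
        by (simp add: numeral_3_eq_3 numeral_2_eq_2)
      moreover have "diff 0 0 = exp (- qform A x)" "diff 1 0 = - m * exp (- qform A x)"
        "diff 2 0 = (m\<^sup>2 - 2 * k) * exp (- qform A x)"
        by (simp_all add: diff_def p_def)
      moreover have "fact 3 = (6 :: real)" by (simp add: fact_numeral)
      moreover have "p 1 = qform A (x + y)" by (simp add: p)
      ultimately show ?thesis using r(3) by simp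
    qed
    moreover have "a x \<bullet> y = - (m * exp (- qform A x))"
      unfolding a_def m_def by (simp add: symmetric_inner[OF tr, of x y] inner_commute)
    moreover have "(\<Sum>i\<in>UNIV. \<Sum>j\<in>UNIV. B x i j * (y $ i * y $ j)) =
       (1 / 2) * ((m\<^sup>2 - 2 * k) * exp (- qform A x))"
    proof -
      have m: "m = (\<Sum>i\<in>UNIV. (A *v x) $ i * y $ i)"
        unfolding m_def symmetric_inner[OF tr, of x y] by (simp add: inner_vec_def mult.commute)
      have 1: "(\<Sum>i\<in>UNIV. \<Sum>j\<in>UNIV. (A *v x) $ i * (A *v x) $ j * (y $ i * y $ j)) = m\<^sup>2"
        unfolding m power2_eq_square sum_product by (simp add: mult_ac)
      have 2: "(\<Sum>i\<in>UNIV. \<Sum>j\<in>UNIV. A $ i $ j * (y $ i * y $ j)) = 2 * k"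
        unfolding k_def qform_def
        by (simp add: inner_vec_def matrix_vector_mult_def sum_distrib_left mult_ac)
      have "(\<Sum>i\<in>UNIV. \<Sum>j\<in>UNIV. B x i j * (y $ i * y $ j)) = (1 / 2) * exp (- qform A x) *
         ((\<Sum>i\<in>UNIV. \<Sum>j\<in>UNIV. (A *v x) $ i * (A *v x) $ j * (y $ i * y $ j))
          - (\<Sum>i\<in>UNIV. \<Sum>j\<in>UNIV. A $ i $ j * (y $ i * y $ j)))"
        unfolding B_def sum_subtractf[symmetric] sum_distrib_left by (simp add: algebra_simps)
      then show ?thesis unfolding 1 2 by simp
    qed
    ultimately have "exp (- qform A (x + y)) - exp (- qform A x) - a x \<bullet> y -
      (\<Sum>i\<in>UNIV. \<Sum>j\<in>UNIV. B x i j * (y $ i * y $ j)) = diff 3 r / 6" by linarith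
    then have "\<bar>exp (- qform A (x + y)) - exp (- qform A x) - a x \<bullet> y -
      (\<Sum>i\<in>UNIV. \<Sum>j\<in>UNIV. B x i j * (y $ i * y $ j))\<bar> = \<bar>diff 3 r\<bar> / 6"
      by (simp only: abs_divide abs_numeral)
    also have "\<dots> \<le> \<bar>diff 3 r\<bar>" by simp
    also have "\<bar>diff 3 r\<bar> \<le> 20 * sqrt k ^ 3"
    proof -
      have "m + 2 * r * k = (x + r *\<^sub>R y) \<bullet> (A *v y)"
        by (simp add: m_def k_def qform_def inner_add_left)
      then have "(m + 2 * r * k)\<^sup>2 \<le> 4 * p r * k"
        using psd_cauchy_schwarz[OF A, of "x + r *\<^sub>R y" y] unfolding p k_def by simp
      moreover have "0 \<le> p r" "0 \<le> k"
        unfolding p k_def using psd_qform_nonneg[OF A] by auto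
      ultimately have "\<bar>(6 * k * (m + 2 * r * k) - (m + 2 * r * k) ^ 3) * exp (- p r)\<bar> \<le> 20 * sqrt k ^ 3"
        by (intro gaussian_derivative_bounds)
      then show ?thesis by (simp add: diff_def)
    qed
    also have "\<dots> \<le> 20 * (sqrt L * norm y) ^ 3"
    proof (intro mult_left_mono power_mono)
      have "sqrt k \<le> sqrt (L * (norm y)\<^sup>2)" unfolding k_def using L(2) by (rule real_sqrt_le_mono)
      then show "sqrt k \<le> sqrt L * norm y" by (simp add: real_sqrt_mult)
    qed (use psd_qform_nonneg[OF A] in \<open>auto simp: k_def\<close>)
    also have "\<dots> = 20 * sqrt L ^ 3 * norm y ^ 3" by (simp add: power_mult_distrib)
    also have "\<dots> \<le> C * norm y ^ 3"
      unfolding C_def using L(1) CA0 by (intro mult_right_mono) auto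
    finally show ?thesis .
  qed
  show ?thesis unfolding third_order_smooth_def
    using Bbd taylor by blast
qed

section \<open>Comparison of normalized sums\<close>

lemma inverse_sqrt_tendsto_0: "(\<lambda>t. 1 / sqrt (real t)) \<longlonglongrightarrow> 0"
proof -
  have "(\<lambda>t. sqrt (1 / real t)) \<longlonglongrightarrow> sqrt 0" by (intro tendsto_real_sqrt lim_1_over_n)
  then show ?thesis by (simp add: real_sqrt_divide)
qed

lemma measurable_vec_nth_real [measurable (raw)]:
  fixes f :: "'a \<Rightarrow> real^'n"
  shows "f \<in> borel_measurable M \<Longrightarrow> (\<lambda>x. f x $ i) \<in> borel_measurable M"
  by (rule borel_measurable_continuous_on[where f="\<lambda>v. v $ i"]) (auto intro!: continuous_intros)

text \<open>
  For a centred vector the linear term of the expansion integrates to zero, so that the one-step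
  average depends on the law through its second moments, up to an error of third order in \<open>h\<close>.
\<close>

lemma (in prob_space) taylor_expectation:
  fixes \<phi> :: "real^'n \<Rightarrow> real" and Z :: "'a \<Rightarrow> real^'n"
  assumes C: "\<And>i j. \<bar>B i j\<bar> \<le> C"
    and taylor: "\<And>y. \<bar>\<phi> (x + y) - \<phi> x - a \<bullet> y - (\<Sum>i\<in>UNIV. \<Sum>j\<in>UNIV. B i j * (y $ i * y $ j))\<bar>
        \<le> C * norm y ^ 3"
    and \<phi> [measurable]: "\<phi> \<in> borel_measurable borel" and bd: "\<And>x. \<bar>\<phi> x\<bar> \<le> b"
    and Z [measurable]: "Z \<in> borel_measurable M" and K: "\<And>\<omega>. \<omega> \<in> space M \<Longrightarrow> norm (Z \<omega>) \<le> K"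
    and mean: "expectation Z = 0" and h: "0 \<le> h"
  shows "\<bar>expectation (\<lambda>\<omega>. \<phi> (x + h *\<^sub>R Z \<omega>)) - \<phi> x
    - h\<^sup>2 * (\<Sum>i\<in>UNIV. \<Sum>j\<in>UNIV. B i j * expectation (\<lambda>\<omega>. Z \<omega> $ i * Z \<omega> $ j))\<bar> \<le> C * h ^ 3 * K ^ 3"
proof -
  have C0: "0 \<le> C" using C[of undefined undefined] by linarith
  obtain \<omega>0 where "\<omega>0 \<in> space M" using not_empty by blast
  then have K0: "0 \<le> K" using K[of \<omega>0] norm_ge_zero order_trans by blast
  have intZ: "integrable M Z"
    by (rule integrable_const_bound[of _ K]) (use K in \<open>auto intro!: AE_I2\<close>)
  have int\<phi>: "integrable M (\<lambda>\<omega>. \<phi> (x + h *\<^sub>R Z \<omega>))"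
    by (rule integrable_const_bound[of _ b]) (use bd in \<open>auto intro!: AE_I2\<close>)
  have intZZ: "integrable M (\<lambda>\<omega>. Z \<omega> $ i * Z \<omega> $ j)" for i j
  proof (rule integrable_const_bound[of _ "K * K"])
    show "AE \<omega> in M. norm (Z \<omega> $ i * Z \<omega> $ j) \<le> K * K"
    proof (rule AE_I2)
      fix \<omega> assume "\<omega> \<in> space M"
      then have "norm (Z \<omega>) \<le> K" by (rule K)
      moreover have "\<bar>Z \<omega> $ i\<bar> \<le> norm (Z \<omega>)" "\<bar>Z \<omega> $ j\<bar> \<le> norm (Z \<omega>)"
        by (rule component_le_norm_cart)+
      ultimately show "norm (Z \<omega> $ i * Z \<omega> $ j) \<le> K * K"
        by (auto simp: abs_mult intro!: mult_mono)
    qed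
  qed simp
  have maZ: "expectation (\<lambda>\<omega>. a \<bullet> (h *\<^sub>R Z \<omega>)) = 0"
  proof -
    have "expectation (\<lambda>\<omega>. a \<bullet> (h *\<^sub>R Z \<omega>)) = expectation (\<lambda>\<omega>. h * (Z \<omega> \<bullet> a))"
      by (simp add: inner_commute)
    also have "\<dots> = h * (expectation Z \<bullet> a)" using intZ by simp
    finally show ?thesis using mean by simp
  qed
  have iaZ: "integrable M (\<lambda>\<omega>. a \<bullet> (h *\<^sub>R Z \<omega>))" using intZ by simp
  define q where "q y = (\<Sum>i\<in>UNIV. \<Sum>j\<in>UNIV. B i j * (y $ i * y $ j))" for y :: "real^'n"
  have iq: "integrable M (\<lambda>\<omega>. q (h *\<^sub>R Z \<omega>))"
  proof -
    have "(\<lambda>\<omega>. q (h *\<^sub>R Z \<omega>)) = (\<lambda>\<omega>. \<Sum>i\<in>UNIV. \<Sum>j\<in>UNIV. (B i j * (h * h)) * (Z \<omega> $ i * Z \<omega> $ j))"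
      unfolding q_def by (simp add: mult_ac)
    then show ?thesis using intZZ by simp
  qed
  have eq: "expectation (\<lambda>\<omega>. q (h *\<^sub>R Z \<omega>)) =
    h\<^sup>2 * (\<Sum>i\<in>UNIV. \<Sum>j\<in>UNIV. B i j * expectation (\<lambda>\<omega>. Z \<omega> $ i * Z \<omega> $ j))"
  proof -
    have "(\<lambda>\<omega>. q (h *\<^sub>R Z \<omega>)) = (\<lambda>\<omega>. \<Sum>i\<in>UNIV. \<Sum>j\<in>UNIV. (B i j * (h * h)) * (Z \<omega> $ i * Z \<omega> $ j))"
      unfolding q_def by (simp add: mult_ac)
    then have "expectation (\<lambda>\<omega>. q (h *\<^sub>R Z \<omega>)) =
       (\<Sum>i\<in>UNIV. \<Sum>j\<in>UNIV. (B i j * (h * h)) * expectation (\<lambda>\<omega>. Z \<omega> $ i * Z \<omega> $ j))"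
      using intZZ by simp
    then show ?thesis by (simp add: sum_distrib_left power2_eq_square mult_ac)
  qed
  define R where "R \<omega> = \<phi> (x + h *\<^sub>R Z \<omega>) - \<phi> x - a \<bullet> (h *\<^sub>R Z \<omega>) - q (h *\<^sub>R Z \<omega>)" for \<omega>
  have iR: "integrable M R" unfolding R_def using int\<phi> iaZ iq by simp
  have Rb: "\<bar>R \<omega>\<bar> \<le> C * h ^ 3 * K ^ 3" if "\<omega> \<in> space M" for \<omega>
  proof -
    have "\<bar>R \<omega>\<bar> \<le> C * norm (h *\<^sub>R Z \<omega>) ^ 3" unfolding R_def q_def by (rule taylor)
    also have "\<dots> \<le> C * (h * K) ^ 3"
      using K[OF that] h C0 by (intro mult_left_mono power_mono) (auto intro: mult_left_mono)
    finally show ?thesis by (simp add: power_mult_distrib)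
  qed
  have "\<bar>expectation R\<bar> \<le> expectation (\<lambda>\<omega>. \<bar>R \<omega>\<bar>)" by (rule integral_abs_bound)
  also have "\<dots> \<le> expectation (\<lambda>\<omega>. C * h ^ 3 * K ^ 3)"
    using iR Rb by (intro integral_mono) auto
  finally have "\<bar>expectation R\<bar> \<le> C * h ^ 3 * K ^ 3" by (simp add: prob_space)
  moreover have "expectation R = expectation (\<lambda>\<omega>. \<phi> (x + h *\<^sub>R Z \<omega>)) - \<phi> x
    - h\<^sup>2 * (\<Sum>i\<in>UNIV. \<Sum>j\<in>UNIV. B i j * expectation (\<lambda>\<omega>. Z \<omega> $ i * Z \<omega> $ j))"
    unfolding R_def using int\<phi> iaZ iq maZ eq by (simp add: prob_space)
  ultimately show ?thesis by simp
qed

definition normalized_list_sum :: "('c \<Rightarrow> 'b::real_vector) \<Rightarrow> nat \<Rightarrow> 'c list \<Rightarrow> 'b" where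
  "normalized_list_sum z t l = (1 / sqrt (real t)) *\<^sub>R sum_list (map z l)"

context iid_sample begin

text \<open>
  A finite law that may replace the law of \<open>Y\<close>: centred, bounded by the same constant, and with
  second moments that differ by at most \<open>d\<close>.
\<close>

definition matches :: "('a \<Rightarrow> real^'n) \<Rightarrow> real \<Rightarrow> real \<Rightarrow> 'c pmf \<Rightarrow> ('c \<Rightarrow> real^'n) \<Rightarrow> bool" where
  "matches Y K d p z \<longleftrightarrow> finite (set_pmf p) \<and> (\<forall>j. norm (z j) \<le> K) \<and> measure_pmf.expectation p z = 0 \<and>
    (\<forall>i j. \<bar>(\<integral>\<theta>. Y \<theta> $ i * Y \<theta> $ j \<partial>P) - measure_pmf.expectation p (\<lambda>l. z l $ i * z l $ j)\<bar> \<le> d)"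

text \<open>
  With summands of size \<open>1 / \<surd>t\<close>, one exchange costs at most a multiple of \<open>d / t\<close> for the second
  moments and a multiple of \<open>t\<close> to the power \<open>- 3 / 2\<close> for the third-order remainders; there are
  \<open>t\<close> exchanges.
\<close>

lemma lindeberg_comparison:
  fixes Y :: "'a \<Rightarrow> real^'n" and \<phi> :: "real^'n \<Rightarrow> real"
  assumes smooth: "third_order_smooth \<phi>"
    and \<phi> [measurable]: "\<phi> \<in> borel_measurable borel" and bd: "\<And>x. \<bar>\<phi> x\<bar> \<le> b"
    and Y [measurable]: "Y \<in> borel_measurable P" and K: "\<And>\<theta>. \<theta> \<in> space P \<Longrightarrow> norm (Y \<theta>) \<le> K"
    and mean: "integral\<^sup>L P Y = 0" and e: "0 < e"
  shows "\<exists>d>0. \<forall>\<^sub>F t in sequentially. \<forall>(p :: 'c pmf) z. matches Y K d p z \<longrightarrow>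
    \<bar>expectation (\<lambda>\<omega>. \<phi> (normalized_sum Y t \<omega>)) -
      measure_pmf.expectation (replicate_pmf t p) (\<lambda>l. \<phi> (normalized_list_sum z t l))\<bar> \<le> e"
    (is "\<exists>d>0. eventually (?G d) sequentially")
proof -
  obtain a B C where C: "\<And>x i j. \<bar>B x i j\<bar> \<le> C"
     "\<And>x y. \<bar>\<phi> (x + y) - \<phi> x - a x \<bullet> y - (\<Sum>i\<in>UNIV. \<Sum>j\<in>UNIV. B x i j * (y $ i * y $ j))\<bar>
        \<le> C * norm y ^ 3"
    by (rule third_order_smoothE[OF smooth]) (rule that; assumption)
  have C0: "0 \<le> C" using C(1)[of undefined undefined undefined] by linarith
  obtain \<theta>0 where "\<theta>0 \<in> space P" using P.not_empty by blast
  then have K0: "0 \<le> K" using K[of \<theta>0] norm_ge_zero order_trans by blast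
  define N where "N = real CARD('n) * real CARD('n)"
  \<comment> \<open>\<open>N\<close> counts the entries of the second-moment matrix; half of \<open>e\<close> is left for the third-order terms.\<close>
  define d where "d = e / (2 * ((C + 1) * (N + 1)))"
  have N0: "0 \<le> N" by (simp add: N_def)
  have d0: "0 < d" unfolding d_def using e C0 N0 by simp
  have Cd: "C * N * d \<le> e / 2"
  proof -
    have "C * N * d \<le> (C + 1) * (N + 1) * d" using C0 N0 d0 by (intro mult_right_mono mult_mono) auto
    also have "\<dots> = e / 2"
    proof -
      have "C + 1 \<noteq> 0" "N + 1 \<noteq> 0" using C0 N0 by auto
      then have "(C + 1) * (N + 1) \<noteq> 0" by simp
      moreover have "c * (e / (2 * c)) = e / 2" if "c \<noteq> 0" for c :: real
        using that by simp
      ultimately show ?thesis unfolding d_def by blast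
    qed
    finally show ?thesis .
  qed
  have lim: "(\<lambda>t. 2 * C * K ^ 3 * (1 / sqrt (real t))) \<longlonglongrightarrow> 2 * C * K ^ 3 * 0"
    by (intro tendsto_mult tendsto_const inverse_sqrt_tendsto_0)
  then have "\<forall>\<^sub>F t in sequentially. 2 * C * K ^ 3 * (1 / sqrt (real t)) < e / 2"
    using e by (intro order_tendstoD(2)[OF lim]) auto
  then have "eventually (?G d) sequentially"
    using eventually_gt_at_top[of 0]
  proof eventually_elim
    case (elim t)
    define h where "h = 1 / sqrt (real t)"
    have h: "0 \<le> h" "h\<^sup>2 * real t = 1" "h ^ 3 * real t = h"
      using elim(2) by (auto simp: h_def power2_eq_square power3_eq_cube field_simps)
    show ?case
    proof (intro allI impI)
      fix p :: "'c pmf" and z :: "'c \<Rightarrow> real^'n"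
      assume match: "matches Y K d p z"
      have p: "finite (set_pmf p)" and z: "\<And>j. norm (z j) \<le> K" "measure_pmf.expectation p z = 0"
        and cov: "\<And>i j. \<bar>(\<integral>\<theta>. Y \<theta> $ i * Y \<theta> $ j \<partial>P) - measure_pmf.expectation p (\<lambda>l. z l $ i * z l $ j)\<bar> \<le> d"
        using match by (auto simp: matches_def)
      define e1 where "e1 = h\<^sup>2 * (C * N * d) + 2 * C * h ^ 3 * K ^ 3"
      have step: "\<bar>(\<integral>\<theta>. \<phi> (x + h *\<^sub>R Y \<theta>) \<partial>P) - measure_pmf.expectation p (\<lambda>j. \<phi> (x + h *\<^sub>R z j))\<bar> \<le> e1" for x
      proof -
        let ?c1 = "\<lambda>i j. \<integral>\<theta>. Y \<theta> $ i * Y \<theta> $ j \<partial>P"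
        let ?c2 = "\<lambda>i j. measure_pmf.expectation p (\<lambda>l. z l $ i * z l $ j)"
        have 1: "\<bar>(\<integral>\<theta>. \<phi> (x + h *\<^sub>R Y \<theta>) \<partial>P) - \<phi> x - h\<^sup>2 * (\<Sum>i\<in>UNIV. \<Sum>j\<in>UNIV. B x i j * ?c1 i j)\<bar> \<le> C * h ^ 3 * K ^ 3"
          by (rule P.taylor_expectation[OF C(1) C(2) \<phi> bd Y K mean h(1)])
        have 2: "\<bar>measure_pmf.expectation p (\<lambda>l. \<phi> (x + h *\<^sub>R z l)) - \<phi> x - h\<^sup>2 * (\<Sum>i\<in>UNIV. \<Sum>j\<in>UNIV. B x i j * ?c2 i j)\<bar> \<le> C * h ^ 3 * K ^ 3"
          by (rule measure_pmf.taylor_expectation[OF C(1) C(2) \<phi> bd _ _ z(2) h(1)]) (use z(1) in auto)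
        have "\<bar>(\<Sum>i\<in>UNIV. \<Sum>j\<in>UNIV. B x i j * ?c1 i j) - (\<Sum>i\<in>UNIV. \<Sum>j\<in>UNIV. B x i j * ?c2 i j)\<bar> =
          \<bar>\<Sum>i\<in>UNIV. \<Sum>j\<in>UNIV. B x i j * (?c1 i j - ?c2 i j)\<bar>"
          by (simp add: sum_subtractf right_diff_distrib)
        also have "\<dots> \<le> (\<Sum>i\<in>(UNIV :: 'n set). \<Sum>j\<in>(UNIV :: 'n set). \<bar>B x i j * (?c1 i j - ?c2 i j)\<bar>)"
          by (rule order_trans[OF sum_abs sum_mono[OF sum_abs]])
        also have "\<dots> \<le> (\<Sum>i\<in>(UNIV :: 'n set). \<Sum>j\<in>(UNIV :: 'n set). C * d)"
          unfolding abs_mult using C(1) cov d0 C0 by (intro sum_mono mult_mono) auto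
        also have "\<dots> = C * N * d" by (simp add: N_def)
        finally have "\<bar>(\<Sum>i\<in>UNIV. \<Sum>j\<in>UNIV. B x i j * ?c1 i j) - (\<Sum>i\<in>UNIV. \<Sum>j\<in>UNIV. B x i j * ?c2 i j)\<bar> \<le> C * N * d" .
        then have "h\<^sup>2 * \<bar>(\<Sum>i\<in>UNIV. \<Sum>j\<in>UNIV. B x i j * ?c1 i j) - (\<Sum>i\<in>UNIV. \<Sum>j\<in>UNIV. B x i j * ?c2 i j)\<bar> \<le> h\<^sup>2 * (C * N * d)"
          by (rule mult_left_mono) simp
        then have "\<bar>h\<^sup>2 * (\<Sum>i\<in>UNIV. \<Sum>j\<in>UNIV. B x i j * ?c1 i j) - h\<^sup>2 * (\<Sum>i\<in>UNIV. \<Sum>j\<in>UNIV. B x i j * ?c2 i j)\<bar> \<le> h\<^sup>2 * (C * N * d)"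
          by (simp add: right_diff_distrib[symmetric] abs_mult)
        with 1 2 show ?thesis unfolding e1_def by linarith
      qed
      have [measurable]: "(\<lambda>\<theta>. h *\<^sub>R Y \<theta>) \<in> borel_measurable P" by measurable
      have hs: "h *\<^sub>R sum_list (map z l) = sum_list (map (\<lambda>j. h *\<^sub>R z j) l)" for l
        by (induction l) (auto simp: scaleR_add_right)
      have "\<bar>expectation (\<lambda>\<omega>. \<phi> (0 + (\<Sum>\<tau><t. h *\<^sub>R Y (X \<tau> \<omega>)))) -
        measure_pmf.expectation (replicate_pmf t p) (\<lambda>l. \<phi> (0 + sum_list (map (\<lambda>j. h *\<^sub>R z j) l)))\<bar> \<le> real t * e1"
        by (rule lindeberg_exchange[OF _ p \<phi> bd step]) simp
      also have "real t * e1 = C * N * d + 2 * C * K ^ 3 * h"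
        using h(2,3) unfolding e1_def by (simp add: algebra_simps)
      also have "\<dots> \<le> e" using Cd elim(1) unfolding h_def by linarith
      finally show "\<bar>expectation (\<lambda>\<omega>. \<phi> (normalized_sum Y t \<omega>)) -
        measure_pmf.expectation (replicate_pmf t p) (\<lambda>l. \<phi> (normalized_list_sum z t l))\<bar> \<le> e"
        unfolding normalized_sum_def normalized_list_sum_def h_def[symmetric] hs by (simp add: scaleR_sum_right)
    qed
  qed
  then show ?thesis using d0 by blast
qed

end

text \<open>
  A cutoff function in the variable \<open>u\<close> is a continuous function of \<open>exp (- u)\<close> on \<open>{0..1}\<close>, hence
  close to a polynomial in \<open>exp (- u)\<close>.  Composed with a quadratic form, such a polynomial is a linear
  combination of the Gaussian-type functions for which expansions are available.
\<close>

lemma exponential_cutoff: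
  fixes m1 m2 e :: real
  assumes "m1 < m2" "0 < e"
  shows "\<exists>(a :: nat \<Rightarrow> real) N. \<forall>u\<ge>0. let p = (\<Sum>i\<le>N. a i * exp (- (real i * u))) in
    - e \<le> p \<and> p \<le> 1 + e \<and> (u \<le> m1 \<longrightarrow> 1 - e \<le> p) \<and> (m2 \<le> u \<longrightarrow> p \<le> e)"
proof -
  define c1 c2 where "c1 = exp (- m1)" and "c2 = exp (- m2)"
  have c: "c2 < c1" using assms by (simp add: c1_def c2_def)
  define f where "f s = max 0 (min 1 ((s - c2) / (c1 - c2)))" for s :: real
  have "continuous_on {0..1} f" unfolding f_def using c by (intro continuous_intros) auto
  then obtain g where g: "real_polynomial_function g" "\<And>s. s \<in> {0..1} \<Longrightarrow> \<bar>f s - g s\<bar> < e"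
    using Stone_Weierstrass_real_polynomial_function[of "{0..1::real}" f e] assms by auto
  obtain a N where gN: "g = (\<lambda>s. \<Sum>i\<le>N. a i * s ^ i)"
    using g(1) real_polynomial_function_iff_sum by auto
  have "let p = (\<Sum>i\<le>N. a i * exp (- (real i * u))) in
    - e \<le> p \<and> p \<le> 1 + e \<and> (u \<le> m1 \<longrightarrow> 1 - e \<le> p) \<and> (m2 \<le> u \<longrightarrow> p \<le> e)" if u: "0 \<le> u" for u
  proof -
    have p: "(\<Sum>i\<le>N. a i * exp (- (real i * u))) = g (exp (- u))"
      by (simp add: gN exp_of_nat_mult[symmetric])
    have b: "\<bar>f (exp (- u)) - g (exp (- u))\<bar> < e" using u by (intro g(2)) auto
    have "0 \<le> f (exp (- u))" "f (exp (- u)) \<le> 1" by (auto simp: f_def)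
    moreover have "f (exp (- u)) = 1" if "u \<le> m1"
    proof -
      have "c1 \<le> exp (- u)" using that by (simp add: c1_def)
      then have "1 \<le> (exp (- u) - c2) / (c1 - c2)" using c by (simp add: field_simps)
      then show ?thesis by (simp add: f_def)
    qed
    moreover have "f (exp (- u)) = 0" if "m2 \<le> u"
    proof -
      have "exp (- u) \<le> c2" using that by (simp add: c2_def)
      then have "(exp (- u) - c2) / (c1 - c2) \<le> 0" using c by (simp add: divide_le_0_iff)
      then show ?thesis by (simp add: f_def)
    qed
    ultimately show ?thesis using b unfolding p Let_def by linarith
  qed
  then show ?thesis by blast
qed

lemma continuous_qform: "continuous_on S (qform A)" for A :: "real^'n^'n"
  unfolding qform_def
  by (intro continuous_intros linear_continuous_on matrix_vector_mul_bounded_linear) auto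

lemma measurable_qform [measurable]: "qform A \<in> borel_measurable borel"
  by (rule borel_measurable_continuous_onI[OF continuous_qform])

context iid_sample begin

text \<open>
  The indicators of the two events are separated by a smooth cutoff of the quadratic form, up to a
  small error, and the expectations of the cutoff are compared by exchange.  The gap between \<open>m1\<close> and
  \<open>m2\<close> makes room for the cutoff.
\<close>

lemma quadratic_form_comparison:
  fixes Y :: "'a \<Rightarrow> real^'n"
  assumes A: "psd A" and m: "m1 < m2" and e: "0 < e"
    and Y [measurable]: "Y \<in> borel_measurable P" and K: "\<And>\<theta>. \<theta> \<in> space P \<Longrightarrow> norm (Y \<theta>) \<le> K"
    and mean: "integral\<^sup>L P Y = 0"
  shows "\<exists>d>0. \<forall>\<^sub>F t in sequentially. \<forall>(p :: 'c pmf) z. matches Y K d p z \<longrightarrow>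
    measure_pmf.prob (replicate_pmf t p) {l. qform A (normalized_list_sum z t l) \<le> m1}
     \<le> prob {\<omega> \<in> space M. qform A (normalized_sum Y t \<omega>) < m2} + e"
    (is "\<exists>d>0. eventually (?G d) sequentially")
proof -
  obtain a :: "nat \<Rightarrow> real" and N where cut: "\<And>u. 0 \<le> u \<Longrightarrow> let p = (\<Sum>i\<le>N. a i * exp (- (real i * u))) in
    - (e / 4) \<le> p \<and> p \<le> 1 + e / 4 \<and> (u \<le> m1 \<longrightarrow> 1 - e / 4 \<le> p) \<and> (m2 \<le> u \<longrightarrow> p \<le> e / 4)"
    using exponential_cutoff[OF m, of "e / 4"] e by auto
  define \<phi> where "\<phi> x = (\<Sum>i\<le>N. a i * exp (- (real i * qform A x)))" for x
  have scaled: "qform (real i *\<^sub>R A) x = real i * qform A x" for i x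
    by (simp add: qform_def scaleR_matrix_vector_assoc[symmetric])
  have "psd (real i *\<^sub>R A)" for i
    using A by (auto simp: psd_def transpose_scalar scaleR_matrix_vector_assoc[symmetric])
  then have smooth: "third_order_smooth \<phi>"
    unfolding \<phi>_def scaled[symmetric]
    by (intro third_order_smooth_sum third_order_smooth_scale third_order_smooth_gaussian)
  have \<phi> [measurable]: "\<phi> \<in> borel_measurable borel" unfolding \<phi>_def by measurable
  have \<phi>': "- (e / 4) \<le> \<phi> x" "\<phi> x \<le> 1 + e / 4" "qform A x \<le> m1 \<Longrightarrow> 1 - e / 4 \<le> \<phi> x"
      "m2 \<le> qform A x \<Longrightarrow> \<phi> x \<le> e / 4" for x
    using cut[OF psd_qform_nonneg[OF A, of x]] unfolding \<phi>_def Let_def by auto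
  have bd: "\<bar>\<phi> x\<bar> \<le> 1 + e / 4" for x using \<phi>'(1,2)[of x] e by linarith
  obtain d where d: "0 < d" "\<forall>\<^sub>F t in sequentially. \<forall>(p :: 'c pmf) z. matches Y K d p z \<longrightarrow>
    \<bar>expectation (\<lambda>\<omega>. \<phi> (normalized_sum Y t \<omega>)) -
      measure_pmf.expectation (replicate_pmf t p) (\<lambda>l. \<phi> (normalized_list_sum z t l))\<bar> \<le> e / 2"
    using lindeberg_comparison[OF smooth \<phi> bd Y K mean, of "e / 2"] e by auto
  have "eventually (?G d) sequentially"
    using d(2)
  proof eventually_elim
    case (elim t)
    show ?case
    proof (intro allI impI)
      fix p :: "'c pmf" and z :: "'c \<Rightarrow> real^'n"
      assume match: "matches Y K d p z"
      then have p: "finite (set_pmf p)" by (simp add: matches_def)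
      define S where "S = normalized_sum Y t"
      define G where "G = normalized_list_sum z t"
      have [measurable]: "S \<in> borel_measurable M" unfolding S_def normalized_sum_def[abs_def] by measurable
      have close: "\<bar>expectation (\<lambda>\<omega>. \<phi> (S \<omega>)) - measure_pmf.expectation (replicate_pmf t p) (\<lambda>l. \<phi> (G l))\<bar> \<le> e / 2"
        using elim match unfolding S_def G_def by blast
      let ?I = "{l. qform A (G l) \<le> m1}"
      let ?J = "{\<omega> \<in> space M. qform A (S \<omega>) < m2}"
      have "measure_pmf.prob (replicate_pmf t p) ?I = measure_pmf.expectation (replicate_pmf t p) (indicator ?I)"
        by simp
      also have "\<dots> \<le> measure_pmf.expectation (replicate_pmf t p) (\<lambda>l. \<phi> (G l) + e / 4)"
      proof (rule integral_mono)
        show "integrable (measure_pmf (replicate_pmf t p)) (\<lambda>l. \<phi> (G l) + e / 4)"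
          by (intro integrable_measure_pmf_finite finite_set_replicate_pmf p)
        fix l show "indicator ?I l \<le> \<phi> (G l) + e / 4"
          using \<phi>'(1,3)[of "G l"] by (auto simp: indicator_def)
      qed (intro integrable_measure_pmf_finite finite_set_replicate_pmf p)
      also have "\<dots> = measure_pmf.expectation (replicate_pmf t p) (\<lambda>l. \<phi> (G l)) + e / 4"
        by (subst Bochner_Integration.integral_add)
          (auto intro!: integrable_measure_pmf_finite finite_set_replicate_pmf p)
      also have "\<dots> \<le> expectation (\<lambda>\<omega>. \<phi> (S \<omega>)) + e / 2 + e / 4"
        using close by linarith
      also have "expectation (\<lambda>\<omega>. \<phi> (S \<omega>)) \<le> expectation (\<lambda>\<omega>. indicator ?J \<omega> + e / 4)"
      proof (rule integral_mono)
        show "integrable M (\<lambda>\<omega>. \<phi> (S \<omega>))"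
          by (rule integrable_const_bound[of _ "1 + e / 4"]) (use bd in \<open>auto intro!: AE_I2\<close>)
        show "integrable M (\<lambda>\<omega>. indicator ?J \<omega> + e / 4)"
          by (intro Bochner_Integration.integrable_add integrable_real_indicator) (auto simp: emeasure_eq_measure)
        fix \<omega> assume "\<omega> \<in> space M"
        then show "\<phi> (S \<omega>) \<le> indicator ?J \<omega> + e / 4"
          using \<phi>'(2,4)[of "S \<omega>"] by (auto simp: indicator_def)
      qed
      also have "expectation (\<lambda>\<omega>. indicator ?J \<omega> + e / 4) = prob ?J + e / 4"
        by (subst Bochner_Integration.integral_add) (auto simp: emeasure_eq_measure prob_space)
      finally show "measure_pmf.prob (replicate_pmf t p) {l. qform A (normalized_list_sum z t l) \<le> m1}
         \<le> prob {\<omega> \<in> space M. qform A (normalized_sum Y t \<omega>) < m2} + e"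
        unfolding S_def G_def by simp
    qed
  qed
  then show ?thesis using d(1) by blast
qed

end

section \<open>Second-order expansions and convex functions near a quadratic\<close>

lemma gradient_has_derivative:
  assumes "f differentiable at x"
  shows "(f has_derivative (\<lambda>h. gradient f x \<bullet> h)) (at x)"
proof -
  define f' where "f' = frechet_derivative f (at x)"
  have D: "(f has_derivative f') (at x)"
    using assms unfolding f'_def frechet_derivative_works .
  then have lin: "linear f'" by (rule has_derivative_linear)
  have "f' h = gradient f x \<bullet> h" for h
  proof -
    have "f' h = f' (\<Sum>i\<in>UNIV. (h $ i) *\<^sub>R axis i 1)"
      using basis_expansion[of h] by (simp add: scalar_mult_eq_scaleR)
    also have "\<dots> = (\<Sum>i\<in>UNIV. h $ i * f' (axis i 1))"
      using lin by (simp add: linear_sum linear_scale)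
    finally show ?thesis by (simp add: gradient_def f'_def inner_vec_def mult.commute)
  qed
  then have "f' = (\<lambda>h. gradient f x \<bullet> h)" by auto
  then show ?thesis using D by simp
qed

text \<open>
  One application of l'Hospital's rule, because the gradient is only known to be differentiable at
  the single point \<open>x\<close>.
\<close>

lemma second_order_expansion:
  fixes f :: "real^'n \<Rightarrow> real"
  assumes U: "open U" "x \<in> U" and diff: "\<And>y. y \<in> U \<Longrightarrow> f differentiable at y"
    and diff2: "gradient f differentiable at x"
  shows "((\<lambda>s. (f (x + s *\<^sub>R h) - f x - s * (gradient f x \<bullet> h)) / s\<^sup>2) \<longlongrightarrow> qform (hessian f x) h) (at_right 0)"
proof -
  define \<phi>' where "\<phi>' s = gradient f (x + s *\<^sub>R h) \<bullet> h" for s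
  have inner_line: "((\<lambda>s. x + s *\<^sub>R h) has_derivative (\<lambda>r. r *\<^sub>R h)) (at s)" for s
    by (auto intro!: derivative_eq_intros)
  have "\<forall>\<^sub>F s in at 0. x + s *\<^sub>R h \<in> U"
  proof (rule topological_tendstoD)
    have "((\<lambda>s. x + s *\<^sub>R h) \<longlongrightarrow> x + 0 *\<^sub>R h) (at 0)" by (intro tendsto_intros)
    then show "((\<lambda>s. x + s *\<^sub>R h) \<longlongrightarrow> x) (at 0)" by simp
  qed (use U in auto)
  then have evU: "\<forall>\<^sub>F s in at_right 0. x + s *\<^sub>R h \<in> U"
    using filter_leD[OF at_le[of "{0<..}" UNIV 0]] by simp
  have D1: "((\<lambda>s. f (x + s *\<^sub>R h)) has_real_derivative \<phi>' s) (at s)" if "x + s *\<^sub>R h \<in> U" for s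
  proof -
    have "((\<lambda>s. f (x + s *\<^sub>R h)) has_derivative (\<lambda>r. gradient f (x + s *\<^sub>R h) \<bullet> (r *\<^sub>R h))) (at s)"
      by (rule has_derivative_compose[OF inner_line gradient_has_derivative[OF diff[OF that]]])
    moreover have "(\<lambda>r. gradient f (x + s *\<^sub>R h) \<bullet> (r *\<^sub>R h)) = (*) (\<phi>' s)"
      by (auto simp: fun_eq_iff \<phi>'_def)
    ultimately show ?thesis unfolding has_field_derivative_def by simp
  qed
  have D2: "(\<phi>' has_real_derivative (hessian f x *v h) \<bullet> h) (at 0)"
  proof -
    have g: "(gradient f has_derivative (\<lambda>v. hessian f x *v v)) (at (x + 0 *\<^sub>R h))"
      using diff2 unfolding hessian_def jacobian_works by simp
    have "((\<lambda>s. gradient f (x + s *\<^sub>R h)) has_derivative (\<lambda>r. hessian f x *v (r *\<^sub>R h))) (at 0)"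
      by (rule has_derivative_compose[OF inner_line g])
    then have "(\<phi>' has_derivative (\<lambda>r. (hessian f x *v (r *\<^sub>R h)) \<bullet> h)) (at 0)"
      unfolding \<phi>'_def by (rule has_derivative_inner_left)
    moreover have "(\<lambda>r. (hessian f x *v (r *\<^sub>R h)) \<bullet> h) = (*) ((hessian f x *v h) \<bullet> h)"
      by (auto simp: fun_eq_iff matrix_vector_mult_scaleR)
    ultimately show ?thesis unfolding has_field_derivative_def by simp
  qed
  have "((\<lambda>s. (\<phi>' s - \<phi>' 0) / (s - 0)) \<longlongrightarrow> (hessian f x *v h) \<bullet> h) (at 0)"
    using D2 unfolding has_field_derivative_iff by simp
  then have "((\<lambda>s. (\<phi>' s - \<phi>' 0) / (s - 0)) \<longlongrightarrow> (hessian f x *v h) \<bullet> h) (at_right 0)"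
    by (rule tendsto_mono[OF at_le, rotated]) simp
  then have lim: "((\<lambda>s. ((\<phi>' s - \<phi>' 0) / (s - 0)) / 2) \<longlongrightarrow> ((hessian f x *v h) \<bullet> h) / 2) (at_right 0)"
    by (intro tendsto_divide tendsto_const) auto
  have lim': "((\<lambda>s. (\<phi>' s - \<phi>' 0) / (2 * s)) \<longlongrightarrow> qform (hessian f x) h) (at_right 0)"
    using lim by (simp add: qform_def inner_commute mult.commute)
  have cont: "((\<lambda>s. f (x + s *\<^sub>R h) - f x - s * \<phi>' 0) \<longlongrightarrow> 0) (at_right 0)"
  proof -
    have "isCont (\<lambda>s. f (x + s *\<^sub>R h)) 0" using D1[of 0] U(2) by (intro DERIV_isCont) auto
    then have "((\<lambda>s. f (x + s *\<^sub>R h)) \<longlongrightarrow> f x) (at 0)" by (simp add: isCont_def)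
    then have "((\<lambda>s. f (x + s *\<^sub>R h)) \<longlongrightarrow> f x) (at_right 0)"
      by (rule tendsto_mono[OF at_le, rotated]) simp
    then have "((\<lambda>s. f (x + s *\<^sub>R h) - f x - s * \<phi>' 0) \<longlongrightarrow> f x - f x - 0 * \<phi>' 0) (at_right 0)"
      by (intro tendsto_intros)
    then show ?thesis by simp
  qed
  have "((\<lambda>s. (f (x + s *\<^sub>R h) - f x - s * \<phi>' 0) / s\<^sup>2) \<longlongrightarrow> qform (hessian f x) h) (at_right 0)"
  proof (rule lhopital_right_0[OF cont, where f' = "\<lambda>s. \<phi>' s - \<phi>' 0" and g' = "\<lambda>s. 2 * s"])
    have "((\<lambda>s :: real. s\<^sup>2) \<longlongrightarrow> 0\<^sup>2) (at_right 0)" by (intro tendsto_intros)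
    then show "((\<lambda>s :: real. s\<^sup>2) \<longlongrightarrow> 0) (at_right 0)" by simp
    show "\<forall>\<^sub>F s in at_right 0. s\<^sup>2 \<noteq> (0 :: real)" "\<forall>\<^sub>F s in at_right 0. 2 * s \<noteq> (0 :: real)"
      by (auto simp: eventually_at_right_field intro: exI[of _ 1])
    show "\<forall>\<^sub>F s in at_right 0. ((\<lambda>s. f (x + s *\<^sub>R h) - f x - s * \<phi>' 0) has_real_derivative \<phi>' s - \<phi>' 0) (at s)"
      using evU by eventually_elim (auto intro!: derivative_eq_intros D1)
    show "\<forall>\<^sub>F s in at_right 0. ((\<lambda>s :: real. s\<^sup>2) has_real_derivative 2 * s) (at s)"
      by (intro always_eventually allI) (auto intro!: derivative_eq_intros)
    show "((\<lambda>s. (\<phi>' s - \<phi>' 0) / (2 * s)) \<longlongrightarrow> qform (hessian f x) h) (at_right 0)" by (rule lim')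
  qed
  then show ?thesis by (simp add: \<phi>'_def)
qed

lemma positive_definite_coercive:
  assumes "positive_definite A"
  shows "\<exists>l>0. \<forall>x. l * (norm x)\<^sup>2 \<le> qform A x"
proof -
  have "\<exists>x\<in>sphere 0 1. \<forall>y\<in>sphere 0 1. qform A x \<le> qform A y"
    by (rule continuous_attains_inf) (use continuous_qform in \<open>auto intro!: exI[of _ "axis undefined 1"] simp: norm_axis_1\<close>)
  then obtain x where x: "norm x = 1" "\<And>y. norm y = 1 \<Longrightarrow> qform A x \<le> qform A y" by auto
  have pos: "0 < qform A x"
    using assms x(1) unfolding positive_definite_def qform_def by (metis half_gt_zero norm_zero zero_neq_one)
  have "qform A x * (norm y)\<^sup>2 \<le> qform A y" for y
  proof (cases "y = 0")
    case True
    then show ?thesis by (simp add: qform_def)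
  next
    case False
    have "qform A x \<le> qform A ((1 / norm y) *\<^sub>R y)" by (rule x(2)) (use False in simp)
    also have "\<dots> = qform A y / (norm y)\<^sup>2" by (simp add: qform_scaleR power_divide)
    finally show ?thesis using False by (simp add: field_simps)
  qed
  then show ?thesis using pos by blast
qed

lemma qform_abs_le: "\<bar>qform A x\<bar> \<le> (real CARD('n))\<^sup>2 * norm A * (norm x)\<^sup>2" for A :: "real^'n^'n"
proof -
  have "\<bar>x \<bullet> (A *v x)\<bar> = \<bar>\<Sum>i\<in>UNIV. \<Sum>j\<in>UNIV. x $ i * (A $ i $ j * x $ j)\<bar>"
    by (simp add: inner_vec_def matrix_vector_mult_def sum_distrib_left)
  also have "\<dots> \<le> (\<Sum>i\<in>(UNIV::'n set). \<Sum>j\<in>(UNIV::'n set). \<bar>x $ i * (A $ i $ j * x $ j)\<bar>)"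
    by (rule order_trans[OF sum_abs sum_mono[OF sum_abs]])
  also have "\<dots> \<le> (\<Sum>i\<in>(UNIV::'n set). \<Sum>j\<in>(UNIV::'n set). norm x * (norm A * norm x))"
  proof (intro sum_mono)
    fix i j
    have "\<bar>A $ i $ j\<bar> \<le> norm A"
      using component_le_norm_cart[of "A $ i" j] Finite_Cartesian_Product.norm_nth_le[of A i] by linarith
    then show "\<bar>x $ i * (A $ i $ j * x $ j)\<bar> \<le> norm x * (norm A * norm x)"
      unfolding abs_mult by (intro mult_mono component_le_norm_cart) auto
  qed
  also have "\<dots> = (real CARD('n))\<^sup>2 * norm A * (norm x)\<^sup>2"
    by (simp add: power2_eq_square)
  finally have "\<bar>x \<bullet> (A *v x)\<bar> \<le> (real CARD('n))\<^sup>2 * norm A * (norm x)\<^sup>2" .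
  moreover have "\<bar>qform A x\<bar> \<le> \<bar>x \<bullet> (A *v x)\<bar>" by (simp add: qform_def)
  ultimately show ?thesis by linarith
qed

text \<open>
  If a convex function \<open>Q\<close> is close to a positive definite quadratic \<open>q\<close> on a suitable finite set, its
  infimum is not much smaller than that of \<open>q\<close>, which is \<open>- qform H hs\<close> for the minimizer \<open>hs\<close>.  The
  finite set depends on the bound \<open>R\<close> for the minimizer but not on the linear term \<open>S\<close>, which will be
  random.
  
  The tangents of \<open>Q\<close> at the points of a fine net bound \<open>Q\<close> from below near these points, provided
  their slopes are under control; the values of \<open>Q\<close> one unit away in each coordinate direction do
  this.  Far from \<open>hs\<close> convexity takes over: on a unit sphere around a net point near \<open>hs\<close> the function
  \<open>Q\<close> exceeds its value at the centre, so it is at least as large beyond that sphere.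
\<close>

lemma convex_near_quadratic:
  fixes H :: "real^'n^'n"
  assumes pd: "positive_definite H" and \<eta>: "0 < \<eta>" and R: "0 \<le> R"
  obtains N e R' where "finite N" "0 < e"
    "\<And>S hs (Q :: real^'n \<Rightarrow> real) Dom h. H *v hs = - S \<Longrightarrow> norm hs \<le> R \<Longrightarrow> cball 0 R' \<subseteq> Dom \<Longrightarrow>
      (\<forall>h\<in>Dom. \<exists>g. \<forall>h'\<in>Dom. Q h + g \<bullet> (h' - h) \<le> Q h') \<Longrightarrow>
      (\<forall>k\<in>N. \<bar>Q k - (S \<bullet> k + qform H k)\<bar> \<le> e) \<Longrightarrow> h \<in> Dom \<Longrightarrow> - qform H hs - \<eta> \<le> Q h"
proof -
  have tr: "transpose H = H" using pd by (simp add: positive_definite_def)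
  obtain l where l: "0 < l" "\<And>x. l * (norm x)\<^sup>2 \<le> qform H x"
    using positive_definite_coercive[OF pd] by auto
  obtain L where L: "0 \<le> L" "\<And>x. qform H x \<le> L * (norm x)\<^sup>2" using qform_le_norm[of H] by auto
  define K2 where "K2 = real CARD('n) * (L + 2)"
  have K2: "0 \<le> K2" using L by (simp add: K2_def)
  \<comment> \<open>The accuracy \<open>\<eta>\<close> is aimed at near the minimizer; a quarter of the curvature constant \<open>l\<close> decides on the sphere.\<close>
  define m where "m = min (l / 16) (\<eta> / 2)"
  have m: "0 < m" "m \<le> l / 16" "m \<le> \<eta> / 2" using l \<eta> by (auto simp: m_def)
  \<comment> \<open>\<open>\<rho>\<close> is the mesh of the net and \<open>e\<close> the accuracy on it; \<open>K2\<close> bounds the error of the slopes.\<close>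
  define \<rho> where "\<rho> = min (1 / 2) (m / (K2 + 2 * L + 1))"
  have \<rho>: "0 < \<rho>" "\<rho> \<le> 1 / 2" using m K2 L unfolding \<rho>_def by (simp_all only: min_less_iff_conj min.cobounded1) simp
  have \<rho>m: "\<rho> * (K2 + 2 * L) \<le> m"
  proof -
    have "\<rho> * (K2 + 2 * L) \<le> m / (K2 + 2 * L + 1) * (K2 + 2 * L + 1)"
      using m K2 L \<rho>(1) by (intro mult_mono) (auto simp: \<rho>_def)
    also have "\<dots> = m" using K2 L by simp
    finally show ?thesis .
  qed
  define e where "e = min 1 m"
  have e: "0 < e" "e \<le> 1" "e \<le> m" using m by (auto simp: e_def)
  define err where "err = e + \<rho> * K2 + L * \<rho>"
  have Lr: "0 \<le> L * \<rho>" using L \<rho> by simp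
  have err: "err \<le> \<eta>" "L * \<rho> + e + err \<le> l / 4"
    using \<rho>m m e Lr unfolding err_def by (auto simp: algebra_simps)
  obtain N0 where N0: "finite N0" "N0 \<subseteq> cball (0 :: real^'n) (R + 2)" "cball (0 :: real^'n) (R + 2) \<subseteq> (\<Union>k\<in>N0. ball k \<rho>)"
    using seq_compact_imp_totally_bounded[of "cball (0 :: real^'n) (R + 2)"] \<rho>(1)
      compact_imp_seq_compact[OF compact_cball] by blast
  define N where "N = N0 \<union> (\<lambda>(k, i). k + axis i 1) ` (N0 \<times> UNIV) \<union> (\<lambda>(k, i). k - axis i 1) ` (N0 \<times> UNIV)"
  have fN: "finite N" unfolding N_def using N0(1) by auto
  have main: "\<forall>h\<in>Dom. - qform H hs - \<eta> \<le> Q h"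
    if hs: "H *v hs = - S" "norm hs \<le> R" and Dom: "cball 0 (R + 4) \<subseteq> Dom"
      and sub: "\<forall>h\<in>Dom. \<exists>g. \<forall>h'\<in>Dom. Q h + g \<bullet> (h' - h) \<le> (Q h' :: real)"
      and close: "\<forall>k\<in>N. \<bar>Q k - (S \<bullet> k + qform H k)\<bar> \<le> e" for S hs Q Dom
  proof
    fix h assume h: "h \<in> Dom"
    define q where "q x = S \<bullet> x + qform H x" for x
    have q_add: "q (x + v) = q x + (S + H *v x) \<bullet> v + qform H v" for x v
      unfolding q_def qform_add[OF tr] symmetric_inner[OF tr, of x v]
      by (simp add: inner_add_left inner_add_right inner_commute)
    have q_hs: "q (hs + v) = q hs + qform H v" for v
      unfolding q_add using hs(1) by simp
    have qs: "q hs = - qform H hs"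
    proof -
      have "S = - (H *v hs)" using hs(1) by simp
      then show ?thesis unfolding q_def by (simp add: qform_def inner_commute)
    qed
    have slope: "norm (g - (S + H *v k)) \<le> K2"
      if k: "k \<in> N0" and g: "\<forall>h'\<in>Dom. Q k + g \<bullet> (h' - k) \<le> Q h'" for k g
    proof -
      have "\<bar>(g - (S + H *v k)) $ i\<bar> \<le> L + 2" for i
      proof -
        have kR: "norm k \<le> R + 2" using k N0(2) by auto
        have in_Dom: "k + axis i 1 \<in> Dom" "k - axis i 1 \<in> Dom"
        proof -
          have "norm (k + axis i 1) \<le> R + 4" "norm (k - axis i 1) \<le> R + 4"
            using norm_triangle_ineq[of k "axis i 1"] norm_triangle_ineq4[of k "axis i 1"] kR
            by (simp_all add: norm_axis_1)
          then show "k + axis i 1 \<in> Dom" "k - axis i 1 \<in> Dom" using Dom by auto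
        qed
        have c: "\<bar>Q k - q k\<bar> \<le> e" "\<bar>Q (k + axis i 1) - q (k + axis i 1)\<bar> \<le> e"
          "\<bar>Q (k - axis i 1) - q (k - axis i 1)\<bar> \<le> e"
          using close k unfolding q_def N_def by force+
        have a: "qform H (axis i 1) \<le> L" "qform H (- axis i 1) \<le> L"
          using L(2)[of "axis i 1"] L(2)[of "- axis i 1"] by (simp_all add: norm_axis_1)
        have "g \<bullet> axis i 1 \<le> Q (k + axis i 1) - Q k" using g in_Dom(1) by force
        moreover have "- (g \<bullet> axis i 1) \<le> Q (k - axis i 1) - Q k" using g in_Dom(2) by force
        moreover have "q (k + axis i 1) = q k + (S + H *v k) \<bullet> axis i 1 + qform H (axis i 1)" by (rule q_add)
        moreover have "q (k - axis i 1) = q k - (S + H *v k) \<bullet> axis i 1 + qform H (- axis i 1)"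
          using q_add[of k "- axis i 1"] by simp
        ultimately have "\<bar>g \<bullet> axis i 1 - (S + H *v k) \<bullet> axis i 1\<bar> \<le> L + 2 * e"
          using c a by linarith
        then show ?thesis using e(2) by (simp add: inner_axis)
      qed
      then have "(\<Sum>i\<in>UNIV. \<bar>(g - (S + H *v k)) $ i\<bar>) \<le> (\<Sum>i\<in>(UNIV :: 'n set). L + 2)"
        by (intro sum_mono)
      then show ?thesis using norm_le_l1_cart[of "g - (S + H *v k)"] by (simp add: K2_def)
    qed
    \<comment> \<open>The tangent at a net point near \<open>x\<close>.\<close>
    have lower: "q x - err \<le> Q x" if x: "norm x \<le> R + 2" for x
    proof -
      have "x \<in> cball 0 (R + 2)" using x by simp
      then obtain k where k: "k \<in> N0" "dist k x < \<rho>" using N0(3) by auto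
      have "norm k \<le> R + 4" using k(1) N0(2) R by fastforce
      then have "k \<in> Dom" using Dom by auto
      then obtain g where g: "\<forall>h'\<in>Dom. Q k + g \<bullet> (h' - k) \<le> Q h'" using sub by blast
      have "x \<in> Dom" using x Dom by auto
      then have 1: "Q k + g \<bullet> (x - k) \<le> Q x" using g by blast
      have xk: "norm (x - k) \<le> \<rho>" using k(2) by (simp add: dist_norm norm_minus_commute)
      have "\<bar>(g - (S + H *v k)) \<bullet> (x - k)\<bar> \<le> norm (g - (S + H *v k)) * norm (x - k)"
        by (rule Cauchy_Schwarz_ineq2)
      also have "\<dots> \<le> K2 * \<rho>" using slope[OF k(1) g] xk K2 by (intro mult_mono) auto
      finally have 2: "(S + H *v k) \<bullet> (x - k) - K2 * \<rho> \<le> g \<bullet> (x - k)"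
        by (simp add: inner_diff_left)
      have 3: "q x = q k + (S + H *v k) \<bullet> (x - k) + qform H (x - k)" using q_add[of k "x - k"] by simp
      have "qform H (x - k) \<le> L * (norm (x - k))\<^sup>2" by (rule L(2))
      also have "\<dots> \<le> L * \<rho>"
      proof (rule mult_left_mono)
        have "(norm (x - k))\<^sup>2 \<le> \<rho>\<^sup>2" using xk by (intro power_mono) auto
        also have "\<dots> \<le> \<rho> * 1" unfolding power2_eq_square using \<rho> by (intro mult_left_mono) auto
        finally show "(norm (x - k))\<^sup>2 \<le> \<rho>" by simp
      qed (rule L(1))
      finally have 4: "qform H (x - k) \<le> L * \<rho>" .
      have "\<bar>Q k - q k\<bar> \<le> e" using close k(1) unfolding q_def N_def by blast
      then show ?thesis using 1 2 3 4 unfolding err_def by (simp add: mult.commute)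
    qed
    have "hs \<in> cball 0 (R + 2)" using hs(2) by simp
    then obtain k where k: "k \<in> N0" "dist k hs < \<rho>" using N0(3) by auto
    have kh: "norm (k - hs) \<le> \<rho>" using k(2) by (simp add: dist_norm)
    have Qk: "Q k \<le> q hs + L * \<rho> + e"
    proof -
      have "qform H (k - hs) \<le> L * (norm (k - hs))\<^sup>2" by (rule L(2))
      also have "\<dots> \<le> L * \<rho>"
      proof (rule mult_left_mono)
        have "(norm (k - hs))\<^sup>2 \<le> \<rho>\<^sup>2" using kh by (intro power_mono) auto
        also have "\<dots> \<le> \<rho> * 1" unfolding power2_eq_square using \<rho> by (intro mult_left_mono) auto
        finally show "(norm (k - hs))\<^sup>2 \<le> \<rho>" by simp
      qed (rule L(1))
      finally have "q k \<le> q hs + L * \<rho>" using q_hs[of "k - hs"] by simp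
      moreover have "\<bar>Q k - q k\<bar> \<le> e" using close k(1) unfolding q_def N_def by blast
      ultimately show ?thesis by linarith
    qed
    have q_min: "q hs \<le> q x" for x
    proof -
      have "0 \<le> qform H (x - hs)" using l(2)[of "x - hs"] l(1) by (meson mult_nonneg_nonneg less_imp_le order_trans zero_le_power2)
      then show ?thesis using q_hs[of "x - hs"] by simp
    qed
    have nk: "norm k \<le> R + 1 / 2" using norm_triangle_sub[of k hs] kh hs(2) \<rho>(2) by linarith
    have "q hs - err \<le> Q h"
    proof (cases "norm (h - k) \<le> 1")
      case True
      then have "norm h \<le> R + 2" using norm_triangle_sub[of h k] nk by linarith
      then show ?thesis using lower[of h] q_min[of h] by linarith
    next
      case False
      define r where "r = norm (h - k)"
      have r: "1 < r" using False by (simp add: r_def)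
      define u where "u = (1 / r) *\<^sub>R (h - k)"
      have u: "norm u = 1" "h - k = r *\<^sub>R u" using r by (auto simp: u_def r_def)
      define z where "z = k + u"
      have nz: "norm z \<le> R + 2" using norm_triangle_ineq[of k u] nk u(1) unfolding z_def by linarith
      then have "z \<in> Dom" using Dom by auto
      then obtain g where g: "\<forall>h'\<in>Dom. Q z + g \<bullet> (h' - z) \<le> Q h'" using sub by blast
      have "1 - \<rho> \<le> norm (z - hs)"
        using norm_triangle_ineq3[of u "hs - k"] kh u(1) unfolding z_def
        by (simp add: algebra_simps norm_minus_commute)
      then have "(1 / 2)\<^sup>2 \<le> (norm (z - hs))\<^sup>2" using \<rho>(2) by (intro power_mono) auto
      then have "l * (1 / 4) \<le> l * (norm (z - hs))\<^sup>2"
        using l(1) by (intro mult_left_mono) (auto simp: power2_eq_square)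
      also have "\<dots> \<le> qform H (z - hs)" by (rule l(2))
      finally have "q hs + l / 4 \<le> q z" using q_hs[of "z - hs"] by simp
      then have Qz: "q hs + l / 4 - err \<le> Q z" using lower[OF nz] by linarith
      have "k \<in> Dom" using nk Dom by auto
      then have "Q z + g \<bullet> (k - z) \<le> Q k" using g by blast
      then have "Q z - g \<bullet> u \<le> Q k" by (simp add: z_def)
      then have gu: "0 \<le> g \<bullet> u" using Qz Qk err(2) by linarith
      have "h - z = (r - 1) *\<^sub>R u" using u(2) by (simp add: z_def algebra_simps)
      then have "Q z + (r - 1) * (g \<bullet> u) \<le> Q h" using g h by (metis inner_scaleR_right)
      moreover have "0 \<le> (r - 1) * (g \<bullet> u)" using r gu by simp
      ultimately show ?thesis using Qz l(1) by linarith
    qed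
    then show "- qform H hs - \<eta> \<le> Q h" using err(1) qs by linarith
  qed
  show ?thesis
    by (rule that[of N e "R + 4", OF fN e(1)]) (rule main[THEN bspec]; assumption)
qed

section \<open>The pacing objective\<close>

abbreviation feasible :: "real^'n \<Rightarrow> bool" where
  "feasible \<beta> \<equiv> \<beta> \<in> pos_orthant \<and> \<beta> \<le> 1"

lemma pos_orthant_Inter: "pos_orthant = (\<Inter>i. {\<beta> :: real^'n. axis i 1 \<bullet> \<beta> > 0})"
  by (auto simp: pos_orthant_def inner_axis')

lemma open_pos_orthant: "open (pos_orthant :: (real^'n) set)"
  unfolding pos_orthant_Inter by (intro open_INT ballI open_halfspace_gt) auto

lemma infty_outside_pos [simp]: "\<beta> \<in> pos_orthant \<Longrightarrow> infty_outside f \<beta> = ereal (f \<beta>)"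
  by (simp add: infty_outside_def)

lemma directional_derivative:
  assumes "f differentiable at x"
  shows "((\<lambda>s. (f (x + s *\<^sub>R d) - f x) / s) \<longlongrightarrow> gradient f x \<bullet> d) (at_right 0)"
proof -
  have "((\<lambda>s. x + s *\<^sub>R d) has_derivative (\<lambda>r. r *\<^sub>R d)) (at 0)"
    by (auto intro!: derivative_eq_intros)
  moreover have "(f has_derivative (\<lambda>h. gradient f x \<bullet> h)) (at (x + 0 *\<^sub>R d))"
    using gradient_has_derivative[OF assms] by simp
  ultimately have "((\<lambda>s. f (x + s *\<^sub>R d)) has_derivative (\<lambda>r. gradient f x \<bullet> (r *\<^sub>R d))) (at 0)"
    by (rule has_derivative_compose)
  moreover have "(\<lambda>r. gradient f x \<bullet> (r *\<^sub>R d)) = (*) (gradient f x \<bullet> d)" by (auto simp: fun_eq_iff)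
  ultimately have "((\<lambda>s. f (x + s *\<^sub>R d)) has_real_derivative gradient f x \<bullet> d) (at 0)"
    unfolding has_field_derivative_def by simp
  then have "((\<lambda>s. (f (x + s *\<^sub>R d) - f x) / s) \<longlongrightarrow> gradient f x \<bullet> d) (at 0)"
    unfolding has_field_derivative_iff by simp
  then show ?thesis by (rule tendsto_mono[OF at_le, rotated]) simp
qed

text \<open>
  The logarithmic barrier bounds every coordinate away from zero on the sublevel set of \<open>\<beta>0\<close>, so the
  minimum may be sought in a compact box.
\<close>

lemma barrier_attains_min:
  fixes g :: "real^'n \<Rightarrow> real"
  assumes b: "\<And>i. 0 < b $ i" and cont: "continuous_on pos_orthant g"
    and barrier: "\<And>\<beta>. feasible \<beta> \<Longrightarrow> - (\<Sum>i\<in>UNIV. b $ i * ln (\<beta> $ i)) \<le> g \<beta>"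
    and C: "closed C" and \<beta>0: "\<beta>0 \<in> C" "feasible \<beta>0"
  shows "\<exists>\<beta>\<in>C. feasible \<beta> \<and> (\<forall>\<beta>'\<in>C. feasible \<beta>' \<longrightarrow> g \<beta> \<le> g \<beta>')"
proof -
  \<comment> \<open>Each summand of the barrier is nonnegative on the box and at most \<open>g \<beta>0\<close> on the sublevel set.\<close>
  define l where "l = Min (range (\<lambda>i. exp (- (g \<beta>0 / b $ i))))"
  have l: "0 < l" unfolding l_def by (subst Min_gr_iff) auto
  have far: "l \<le> \<beta> $ i" if \<beta>: "feasible \<beta>" and le: "g \<beta> \<le> g \<beta>0" for \<beta> i
  proof -
    have pos: "0 < \<beta> $ j" "\<beta> $ j \<le> 1" for j using \<beta> by (auto simp: pos_orthant_def less_eq_vec_def)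
    have "b $ i * - ln (\<beta> $ i) \<le> (\<Sum>j\<in>UNIV. b $ j * - ln (\<beta> $ j))"
    proof (rule member_le_sum)
      show "0 \<le> b $ j * - ln (\<beta> $ j)" for j
        using pos[of j] b[of j] by (intro mult_nonneg_nonneg) auto
    qed auto
    also have "\<dots> \<le> g \<beta>0" using barrier[OF \<beta>] le by (simp add: sum_negf)
    finally have "- ln (\<beta> $ i) \<le> g \<beta>0 / b $ i" using b[of i] by (simp add: field_simps)
    then have "exp (- (g \<beta>0 / b $ i)) \<le> exp (ln (\<beta> $ i))" by simp
    then have "exp (- (g \<beta>0 / b $ i)) \<le> \<beta> $ i" using pos by simp
    moreover have "l \<le> exp (- (g \<beta>0 / b $ i))" unfolding l_def by (rule Min_le) auto
    ultimately show ?thesis by linarith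
  qed
  define K where "K = C \<inter> cbox (\<chi> i. l) 1"
  have K: "\<beta> \<in> K \<longleftrightarrow> \<beta> \<in> C \<and> (\<forall>i. l \<le> \<beta> $ i \<and> \<beta> $ i \<le> 1)" for \<beta>
    by (auto simp: K_def mem_box_cart)
  have Kfeas: "feasible \<beta>" if "\<beta> \<in> K" for \<beta>
    using that l unfolding K by (auto simp: pos_orthant_def less_eq_vec_def intro: less_le_trans)
  have "\<beta>0 \<in> K" using far[of \<beta>0] \<beta>0 unfolding K by (auto simp: less_eq_vec_def)
  moreover have "compact K" unfolding K_def using C by (intro closed_Int_compact compact_cbox)
  moreover have "continuous_on K g" by (rule continuous_on_subset[OF cont]) (use Kfeas in auto)
  ultimately obtain \<beta> where \<beta>: "\<beta> \<in> K" "\<And>\<beta>'. \<beta>' \<in> K \<Longrightarrow> g \<beta> \<le> g \<beta>'"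
    using continuous_attains_inf[of K g] by blast
  have "g \<beta> \<le> g \<beta>'" if "\<beta>' \<in> C" "feasible \<beta>'" for \<beta>'
  proof (cases "g \<beta>' \<le> g \<beta>0")
    case True
    then have "\<beta>' \<in> K" using far[OF that(2)] that unfolding K by (auto simp: less_eq_vec_def)
    then show ?thesis by (rule \<beta>(2))
  next
    case False
    then show ?thesis using \<beta>(2)[OF \<open>\<beta>0 \<in> K\<close>] by linarith
  qed
  then show ?thesis using \<beta>(1) Kfeas[OF \<beta>(1)] unfolding K by blast
qed

text \<open>
  The setting of the theorem, with the data but without the stepsizes and the limit law.
\<close>

locale fppe =
  fixes D :: "'a measure" and s :: "'a \<Rightarrow> real" and v :: "'n::finite \<Rightarrow> 'a \<Rightarrow> real"
    and b :: "real^'n" and DF :: "'a \<Rightarrow> real^'n \<Rightarrow> real^'n"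
    and M :: "'w measure" and X :: "nat \<Rightarrow> 'w \<Rightarrow> 'a"
  assumes budgets: "\<And>i. 0 < b $ i"
    and valuations: "\<And>i. integrable D (v i)"
      "\<And>i \<theta>. \<theta> \<in> space D \<Longrightarrow> 0 \<le> v i \<theta>"
      "\<And>i. bdd_above (v i ` space D)"
    and supply_fun: "\<And>\<theta>. \<theta> \<in> space D \<Longrightarrow> 0 \<le> s \<theta>" "has_bochner_integral D s 1"
    and data: "prob_space M"
      "prob_space.indep_vars M (\<lambda>_. D) X UNIV"
      "\<And>\<tau>. distributed M D (X \<tau>) (\<lambda>\<theta>. ennreal (s \<theta>))"
    and smooth: "twice_cont_diff_near (\<lambda>\<beta>. real_of_ereal (H_lim D s v b \<beta>)) (beta_lim D s v b)"
    and pos_def: "positive_definite (hess_lim D s v b)"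
    and selection: "\<And>\<theta> \<beta>. \<theta> \<in> space D \<Longrightarrow> \<beta> \<in> pos_orthant \<Longrightarrow> DF \<theta> \<beta> \<in> subdifferential (F v b \<theta>) \<beta>"
      "(\<lambda>(\<theta>, \<beta>). DF \<theta> \<beta>) \<in> borel_measurable (D \<Otimes>\<^sub>M restrict_space borel pos_orthant)"
begin

text \<open>
  The distribution of a single item.
\<close>

definition P :: "'a measure" where "P = density D (\<lambda>\<theta>. ennreal (s \<theta>))"

lemma space_P [simp]: "space P = space D" and sets_P [simp, measurable_cong]: "sets P = sets D"
  by (simp_all add: P_def)

sublocale iid_sample M P X
proof -
  interpret prob_space M by (rule data)
  show "iid_sample M P X"
  proof
    show "indep_vars (\<lambda>_. P) X UNIV"
      using data(2) unfolding indep_vars_def by (simp cong: measurable_cong_sets)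
    show "distr M P (X \<tau>) = P" for \<tau>
      using distributed_distr_eq_density[OF data(3), of \<tau>] unfolding P_def
      by (subst distr_cong[OF refl, of _ D]) simp_all
  qed
qed

lemma P_space_D [simp]: "measure P (space D) = 1"
  using P.prob_space by simp

lemma v_measurable [measurable]: "v i \<in> borel_measurable D"
  using valuations(1) by auto

text \<open>
  The real-valued branch of \<open>F\<close>; below, \<open>h\<close> and \<open>hobs\<close> are those of \<open>H_lim\<close> and \<open>H_obs\<close>.
\<close>

definition f :: "'a \<Rightarrow> real^'n \<Rightarrow> real" where "f = F_fin v b"

lemma f_measurable: "f' \<in> borel_measurable N \<Longrightarrow> g \<in> N \<rightarrow>\<^sub>M D \<Longrightarrow> (\<lambda>x. f (g x) (f' x)) \<in> borel_measurable N"
  unfolding f_def F_fin_def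
  using measurable_compose[of g N D "v _", OF _ v_measurable]
  by (intro borel_measurable_diff borel_measurable_Max borel_measurable_sum borel_measurable_times
    borel_measurable_ln measurable_vec_nth_real) auto

lemma f_measurable_P [measurable]: "(\<lambda>\<theta>. f \<theta> \<beta>) \<in> borel_measurable P"
  by (rule f_measurable) auto

lemma v_bound: "\<exists>V\<ge>0. \<forall>i. \<forall>\<theta>\<in>space D. v i \<theta> \<le> V"
proof -
  have "\<forall>i. \<exists>B. \<forall>\<theta>\<in>space D. v i \<theta> \<le> B"
    using valuations(3) unfolding bdd_above_def by fast
  then obtain B where B: "\<And>i \<theta>. \<theta> \<in> space D \<Longrightarrow> v i \<theta> \<le> B i" by metis
  define V where "V = (\<Sum>i\<in>UNIV. \<bar>B i\<bar>)"
  have "v i \<theta> \<le> V" if "\<theta> \<in> space D" for i \<theta>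
  proof -
    have "v i \<theta> \<le> \<bar>B i\<bar>" using B[OF that, of i] by linarith
    also have "\<dots> \<le> V" unfolding V_def by (rule member_le_sum) auto
    finally show ?thesis .
  qed
  moreover have "0 \<le> V" unfolding V_def by (simp add: sum_nonneg)
  ultimately show ?thesis by blast
qed

text \<open>
  Averaging preserves this inequality, so that it also provides subgradients of the limit objective
  and of the sample objectives.
\<close>

lemma subgradient:
  assumes "\<theta> \<in> space D" "\<beta> \<in> pos_orthant" "\<beta>' \<in> pos_orthant"
  shows "f \<theta> \<beta> + DF \<theta> \<beta> \<bullet> (\<beta>' - \<beta>) \<le> f \<theta> \<beta>'"
proof -
  have "F v b \<theta> \<beta> + ereal (DF \<theta> \<beta> \<bullet> (\<beta>' - \<beta>)) \<le> F v b \<theta> \<beta>'"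
    using selection(1)[OF assms(1,2)] unfolding subdifferential_def by auto
  then show ?thesis using assms by (simp add: F_def f_def)
qed

definition box_lu :: "real \<Rightarrow> real \<Rightarrow> (real^'n) set" where
  "box_lu l u = {\<beta>. \<forall>i. l \<le> \<beta> $ i \<and> \<beta> $ i \<le> u}"

lemma box_lu_pos: "0 < l \<Longrightarrow> box_lu l u \<subseteq> pos_orthant"
  by (auto simp: box_lu_def pos_orthant_def intro: less_le_trans)

lemma f_bounded_on_box:
  assumes "0 < l"
  shows "\<exists>C. \<forall>\<theta>\<in>space D. \<forall>\<beta>\<in>box_lu l u. \<bar>f \<theta> \<beta>\<bar> \<le> C"
proof -
  obtain V where V: "0 \<le> V" "\<And>i \<theta>. \<theta> \<in> space D \<Longrightarrow> v i \<theta> \<le> V" using v_bound by blast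
  define m where "m = max \<bar>ln l\<bar> \<bar>ln u\<bar>"
  define C where "C = \<bar>u\<bar> * V + (\<Sum>i\<in>UNIV. b $ i * m)"
  have "\<bar>f \<theta> \<beta>\<bar> \<le> C" if \<theta>: "\<theta> \<in> space D" and \<beta>: "\<beta> \<in> box_lu l u" for \<theta> \<beta>
  proof -
    have lu: "l \<le> \<beta> $ i" "\<beta> $ i \<le> u" "0 < \<beta> $ i" for i
      using \<beta> assms by (auto simp: box_lu_def intro: less_le_trans)
    have each: "0 \<le> \<beta> $ i * v i \<theta>" "\<beta> $ i * v i \<theta> \<le> \<bar>u\<bar> * V" for i
    proof -
      show "0 \<le> \<beta> $ i * v i \<theta>" using lu(3)[of i] valuations(2)[OF \<theta>, of i] by simp
      show "\<beta> $ i * v i \<theta> \<le> \<bar>u\<bar> * V"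
        using lu(2,3)[of i] valuations(2)[OF \<theta>, of i] V(2)[OF \<theta>, of i] by (intro mult_mono) auto
    qed
    have "(MAX i. \<beta> $ i * v i \<theta>) \<in> range (\<lambda>i. \<beta> $ i * v i \<theta>)" by (rule Max_in) auto
    then obtain i where "(MAX i. \<beta> $ i * v i \<theta>) = \<beta> $ i * v i \<theta>" by blast
    then have "\<bar>MAX i. \<beta> $ i * v i \<theta>\<bar> \<le> \<bar>u\<bar> * V" using each[of i] by simp
    moreover have "\<bar>\<Sum>i\<in>UNIV. b $ i * ln (\<beta> $ i)\<bar> \<le> (\<Sum>i\<in>UNIV. b $ i * m)"
    proof (rule order_trans[OF sum_abs sum_mono])
      fix i
      have "ln l \<le> ln (\<beta> $ i)" "ln (\<beta> $ i) \<le> ln u" using lu[of i] assms by auto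
      then have "\<bar>ln (\<beta> $ i)\<bar> \<le> m" unfolding m_def by linarith
      then show "\<bar>b $ i * ln (\<beta> $ i)\<bar> \<le> b $ i * m" using budgets[of i] by (simp add: abs_mult)
    qed
    ultimately show ?thesis unfolding f_def F_fin_def C_def by linarith
  qed
  then show ?thesis by blast
qed

text \<open>
  A subgradient is bounded by difference quotients, taken in a slightly larger box.
\<close>

lemma DF_bounded_on_box:
  assumes "0 < l"
  shows "\<exists>C. \<forall>\<theta>\<in>space D. \<forall>\<beta>\<in>box_lu l u. norm (DF \<theta> \<beta>) \<le> C"
proof -
  define r where "r = l / 2"
  have r: "0 < r" "0 < l - r" using assms by (auto simp: r_def)
  obtain C where C: "\<And>\<theta> \<beta>. \<theta> \<in> space D \<Longrightarrow> \<beta> \<in> box_lu (l - r) (u + r) \<Longrightarrow> \<bar>f \<theta> \<beta>\<bar> \<le> C"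
    using f_bounded_on_box[OF r(2)] by blast
  have "norm (DF \<theta> \<beta>) \<le> real CARD('n) * (2 * C / r)"
    if \<theta>: "\<theta> \<in> space D" and \<beta>: "\<beta> \<in> box_lu l u" for \<theta> \<beta>
  proof -
    have "\<bar>DF \<theta> \<beta> $ i\<bar> \<le> 2 * C / r" for i
    proof -
      have in_box: "\<beta> \<in> box_lu (l - r) (u + r)" "\<beta> + r *\<^sub>R axis i 1 \<in> box_lu (l - r) (u + r)"
        "\<beta> - r *\<^sub>R axis i 1 \<in> box_lu (l - r) (u + r)"
        using \<beta> r(1) by (auto simp: box_lu_def axis_def algebra_simps intro: order_trans)
          (smt (verit, best))+
      note in_pos = in_box[THEN box_lu_pos[OF r(2), THEN subsetD]]
      note bd = in_box[THEN C[OF \<theta>]]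
      have "f \<theta> \<beta> + r * DF \<theta> \<beta> $ i \<le> f \<theta> (\<beta> + r *\<^sub>R axis i 1)"
        using subgradient[OF \<theta> in_pos(1,2)] by (simp add: inner_axis)
      moreover have "f \<theta> \<beta> - r * DF \<theta> \<beta> $ i \<le> f \<theta> (\<beta> - r *\<^sub>R axis i 1)"
        using subgradient[OF \<theta> in_pos(1,3)] by (simp add: inner_axis)
      ultimately have "\<bar>r * DF \<theta> \<beta> $ i\<bar> \<le> 2 * C" using bd by linarith
      then show ?thesis using r(1) by (simp add: abs_mult field_simps)
    qed
    then have "(\<Sum>i\<in>UNIV. \<bar>DF \<theta> \<beta> $ i\<bar>) \<le> (\<Sum>i\<in>(UNIV :: 'n set). 2 * C / r)" by (intro sum_mono)
    then show ?thesis using norm_le_l1_cart[of "DF \<theta> \<beta>"] by simp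
  qed
  then show ?thesis by blast
qed

lemma f_Lipschitz:
  assumes C: "\<forall>\<theta>\<in>space D. \<forall>\<beta>\<in>box_lu l u. norm (DF \<theta> \<beta>) \<le> C" and l: "0 < l"
    and \<theta>: "\<theta> \<in> space D" and \<beta>: "\<beta> \<in> box_lu l u" "\<beta>' \<in> box_lu l u"
  shows "\<bar>f \<theta> \<beta> - f \<theta> \<beta>'\<bar> \<le> C * norm (\<beta> - \<beta>')"
proof -
  note pos = \<beta>[THEN box_lu_pos[OF l, THEN subsetD]]
  have "\<bar>DF \<theta> \<beta> \<bullet> (\<beta>' - \<beta>)\<bar> \<le> norm (DF \<theta> \<beta>) * norm (\<beta>' - \<beta>)" by (rule Cauchy_Schwarz_ineq2)
  also have "\<dots> \<le> C * norm (\<beta> - \<beta>')" unfolding norm_minus_commute[of \<beta>' \<beta>]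
    using C \<theta> \<beta>(1) by (intro mult_right_mono) auto
  finally have 1: "\<bar>DF \<theta> \<beta> \<bullet> (\<beta>' - \<beta>)\<bar> \<le> C * norm (\<beta> - \<beta>')" .
  have "\<bar>DF \<theta> \<beta>' \<bullet> (\<beta> - \<beta>')\<bar> \<le> norm (DF \<theta> \<beta>') * norm (\<beta> - \<beta>')" by (rule Cauchy_Schwarz_ineq2)
  also have "\<dots> \<le> C * norm (\<beta> - \<beta>')"
    using C \<theta> \<beta>(2) by (intro mult_right_mono) auto
  finally have 2: "\<bar>DF \<theta> \<beta>' \<bullet> (\<beta> - \<beta>')\<bar> \<le> C * norm (\<beta> - \<beta>')" .
  show ?thesis
    using 1 2 subgradient[OF \<theta> pos(1) pos(2)] subgradient[OF \<theta> pos(2) pos(1)] by linarith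
qed

lemma singleton_box:
  assumes "\<beta> \<in> pos_orthant"
  shows "\<exists>l u. 0 < l \<and> \<beta> \<in> box_lu l u"
proof (intro exI conjI)
  show "0 < Min (range (\<lambda>i. \<beta> $ i))" using assms by (subst Min_gr_iff) (auto simp: pos_orthant_def)
  show "\<beta> \<in> box_lu (Min (range (\<lambda>i. \<beta> $ i))) (Max (range (\<lambda>i. \<beta> $ i)))"
    by (auto simp: box_lu_def)
qed

lemma f_integrable: "\<beta> \<in> pos_orthant \<Longrightarrow> integrable P (\<lambda>\<theta>. f \<theta> \<beta>)"
proof -
  assume "\<beta> \<in> pos_orthant"
  then obtain l u where lu: "0 < l" "\<beta> \<in> box_lu l u" using singleton_box by blast
  obtain C where "\<forall>\<theta>\<in>space D. \<forall>\<beta>\<in>box_lu l u. \<bar>f \<theta> \<beta>\<bar> \<le> C" using f_bounded_on_box[OF lu(1)] by blast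
  then show ?thesis using lu(2) by (intro bounded_integrable[of _ C]) auto
qed

lemma DF_measurable:
  assumes [measurable]: "g \<in> N \<rightarrow>\<^sub>M D" "f' \<in> borel_measurable N" and "\<And>x. x \<in> space N \<Longrightarrow> f' x \<in> pos_orthant"
  shows "(\<lambda>x. DF (g x) (f' x)) \<in> borel_measurable N"
proof -
  have "f' \<in> N \<rightarrow>\<^sub>M restrict_space borel pos_orthant"
    using assms by (intro measurable_restrict_space2) auto
  then have "(\<lambda>x. (g x, f' x)) \<in> N \<rightarrow>\<^sub>M D \<Otimes>\<^sub>M restrict_space borel pos_orthant" by simp
  from measurable_compose[OF this selection(2)] show ?thesis by simp
qed

lemma DF_measurable_P: "\<beta> \<in> pos_orthant \<Longrightarrow> (\<lambda>\<theta>. DF \<theta> \<beta>) \<in> borel_measurable P"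
  by (rule DF_measurable) auto

lemma DF_integrable: "\<beta> \<in> pos_orthant \<Longrightarrow> integrable P (\<lambda>\<theta>. DF \<theta> \<beta>)"
proof -
  assume \<beta>: "\<beta> \<in> pos_orthant"
  then obtain l u where lu: "0 < l" "\<beta> \<in> box_lu l u" using singleton_box by blast
  obtain C where "\<forall>\<theta>\<in>space D. \<forall>\<beta>\<in>box_lu l u. norm (DF \<theta> \<beta>) \<le> C" using DF_bounded_on_box[OF lu(1)] by blast
  then show ?thesis using lu(2) DF_measurable_P[OF \<beta>]
    by (intro P.integrable_const_bound[of _ C] AE_I2) auto
qed

definition h :: "real^'n \<Rightarrow> real" where "h \<beta> = (\<integral>\<theta>. f \<theta> \<beta> \<partial>P)"

abbreviation Hr :: "real^'n \<Rightarrow> real" where "Hr \<equiv> \<lambda>\<beta>. real_of_ereal (H_lim D s v b \<beta>)"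

lemma H_lim_eq: "\<beta> \<in> pos_orthant \<Longrightarrow> H_lim D s v b \<beta> = ereal (h \<beta>)"
proof -
  assume "\<beta> \<in> pos_orthant"
  moreover have "h \<beta> = (\<integral>\<theta>. s \<theta> * f \<theta> \<beta> \<partial>D)"
    unfolding h_def P_def using supply_fun f_measurable_P[of \<beta>]
    by (intro integral_real_density) (auto simp: has_bochner_integral_iff)
  ultimately show ?thesis by (simp add: H_lim_def f_def mult.commute)
qed

lemma Hr_eq: "\<beta> \<in> pos_orthant \<Longrightarrow> Hr \<beta> = h \<beta>"
  by (simp add: H_lim_eq)

abbreviation \<beta>s :: "real^'n" where "\<beta>s \<equiv> beta_lim D s v b"
abbreviation \<delta>s :: "real^'n" where "\<delta>s \<equiv> delta_lim D s v b"
abbreviation Hess :: "real^'n^'n" where "Hess \<equiv> hess_lim D s v b"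

lemma f_barrier:
  assumes \<theta>: "\<theta> \<in> space D" and \<beta>: "\<beta> \<in> pos_orthant"
  shows "- (\<Sum>i\<in>UNIV. b $ i * ln (\<beta> $ i)) \<le> f \<theta> \<beta>"
proof -
  have "0 \<le> \<beta> $ undefined * v undefined \<theta>"
    using \<beta> valuations(2)[OF \<theta>, of undefined]
    by (intro mult_nonneg_nonneg) (auto simp: pos_orthant_def intro: less_imp_le)
  also have "\<dots> \<le> (MAX i. \<beta> $ i * v i \<theta>)" by (rule Max_ge) auto
  finally show ?thesis by (simp add: f_def F_fin_def)
qed

lemma h_barrier:
  assumes \<beta>: "\<beta> \<in> pos_orthant"
  shows "- (\<Sum>i\<in>UNIV. b $ i * ln (\<beta> $ i)) \<le> h \<beta>"
proof -
  have "(\<integral>\<theta>. - (\<Sum>i\<in>UNIV. b $ i * ln (\<beta> $ i)) \<partial>P) \<le> h \<beta>"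
    unfolding h_def using f_barrier[OF _ \<beta>] f_integrable[OF \<beta>]
    by (intro integral_mono) auto
  then show ?thesis by (simp add: P.prob_space)
qed

text \<open>
  Every point of the open orthant is interior to some box.
\<close>

lemma local_Lipschitz_continuous:
  fixes g :: "real^'n \<Rightarrow> real"
  assumes "\<And>l u. 0 < l \<Longrightarrow> \<exists>C. \<forall>\<beta>\<in>box_lu l u. \<forall>\<beta>'\<in>box_lu l u. \<bar>g \<beta> - g \<beta>'\<bar> \<le> C * norm (\<beta> - \<beta>')"
  shows "continuous_on pos_orthant g"
proof -
  have "isCont g x" if x: "x \<in> pos_orthant" for x
  proof -
    obtain l u where lu: "0 < l" "x \<in> box_lu l u" using singleton_box[OF x] by blast
    define r where "r = l / 2"
    have r: "0 < r" "0 < l - r" using lu by (auto simp: r_def)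
    obtain C where C: "\<And>\<beta> \<beta>'. \<beta> \<in> box_lu (l - r) (u + r) \<Longrightarrow> \<beta>' \<in> box_lu (l - r) (u + r) \<Longrightarrow>
        \<bar>g \<beta> - g \<beta>'\<bar> \<le> C * norm (\<beta> - \<beta>')" using assms[OF r(2)] by meson
    have near: "y \<in> box_lu (l - r) (u + r)" if "dist y x < r" for y
    proof -
      have "\<bar>y $ i - x $ i\<bar> < r" for i
        using that component_le_norm_cart[of "y - x" i] by (simp add: dist_norm)
      then show ?thesis using lu(2) unfolding box_lu_def
        by (smt (verit, best) mem_Collect_eq)
    qed
    have "\<forall>\<^sub>F y in at x. \<bar>g y - g x\<bar> \<le> C * norm (y - x)"
      unfolding eventually_at using r(1) near C[of _ x] by (intro exI[of _ r]) (auto simp: near)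
    moreover have "((\<lambda>y. C * norm (y - x)) \<longlongrightarrow> C * norm (x - x)) (at x)" by (intro tendsto_intros)
    ultimately have "((\<lambda>y. g y - g x) \<longlongrightarrow> 0) (at x)"
      by (intro Lim_null_comparison[of "\<lambda>y. g y - g x" "\<lambda>y. C * norm (y - x)"]) auto
    then show ?thesis unfolding isCont_def by (rule LIM_zero_cancel)
  qed
  then show ?thesis by (intro continuous_at_imp_continuous_on) auto
qed

lemma h_Lipschitz:
  assumes C: "\<forall>\<theta>\<in>space D. \<forall>\<beta>\<in>box_lu l u. norm (DF \<theta> \<beta>) \<le> C" and l: "0 < l"
    and \<beta>: "\<beta> \<in> box_lu l u" "\<beta>' \<in> box_lu l u"
  shows "\<bar>h \<beta> - h \<beta>'\<bar> \<le> C * norm (\<beta> - \<beta>')"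
proof -
  note pos = \<beta>[THEN box_lu_pos[OF l, THEN subsetD]]
  have "h \<beta> - h \<beta>' = (\<integral>\<theta>. f \<theta> \<beta> - f \<theta> \<beta>' \<partial>P)"
    unfolding h_def using f_integrable[OF pos(1)] f_integrable[OF pos(2)] by simp
  also have "\<bar>\<dots>\<bar> \<le> (\<integral>\<theta>. \<bar>f \<theta> \<beta> - f \<theta> \<beta>'\<bar> \<partial>P)" by (rule integral_abs_bound)
  also have "\<dots> \<le> (\<integral>\<theta>. C * norm (\<beta> - \<beta>') \<partial>P)"
    using f_integrable[OF pos(1)] f_integrable[OF pos(2)] f_Lipschitz[OF C l _ \<beta>]
    by (intro integral_mono) auto
  finally show ?thesis by (simp add: P.prob_space)
qed

lemma h_continuous: "continuous_on pos_orthant h"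
proof (rule local_Lipschitz_continuous)
  fix l u :: real assume l: "0 < l"
  then obtain C where "\<forall>\<theta>\<in>space D. \<forall>\<beta>\<in>box_lu l u. norm (DF \<theta> \<beta>) \<le> C" using DF_bounded_on_box by blast
  then show "\<exists>C. \<forall>\<beta>\<in>box_lu l u. \<forall>\<beta>'\<in>box_lu l u. \<bar>h \<beta> - h \<beta>'\<bar> \<le> C * norm (\<beta> - \<beta>')"
    using h_Lipschitz l by blast
qed

lemma feasible_1: "feasible (1 :: real^'n)"
  by (simp add: pos_orthant_def)

lemma beta_lim_minimizes: "feasible \<beta>s" "feasible \<beta> \<Longrightarrow> h \<beta>s \<le> h \<beta>"
proof -
  obtain \<beta>m where \<beta>m: "feasible \<beta>m" "\<And>\<beta>. feasible \<beta> \<Longrightarrow> h \<beta>m \<le> h \<beta>"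
    using barrier_attains_min[OF budgets h_continuous _ closed_UNIV, of 1] h_barrier feasible_1 by auto
  have "is_arg_min (H_lim D s v b) (\<lambda>\<beta>. \<beta> \<in> pos_orthant \<and> \<beta> \<le> 1) \<beta>m"
    unfolding is_arg_min_def using \<beta>m by (auto simp: H_lim_eq not_less)
  then have "is_arg_min (H_lim D s v b) (\<lambda>\<beta>. \<beta> \<in> pos_orthant \<and> \<beta> \<le> 1) \<beta>s"
    unfolding beta_lim_def arg_min_def by (rule someI)
  then have *: "feasible \<beta>s" "\<not> (\<exists>y. feasible y \<and> H_lim D s v b y < H_lim D s v b \<beta>s)"
    unfolding is_arg_min_def by auto
  show "feasible \<beta>s" by (rule *)
  show "feasible \<beta> \<Longrightarrow> h \<beta>s \<le> h \<beta>" using * by (auto simp: H_lim_eq not_less)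
qed

lemma \<beta>s_pos: "\<beta>s \<in> pos_orthant" using beta_lim_minimizes(1) by simp

lemma Hr_differentiable: "Hr differentiable at \<beta>s"
  using smooth unfolding twice_cont_diff_near_def by blast

lemma line_in_pos: "\<beta> \<in> pos_orthant \<Longrightarrow> \<forall>\<^sub>F r in at_right 0. \<beta> + r *\<^sub>R d \<in> (pos_orthant :: (real^'n) set)"
proof -
  assume \<beta>: "\<beta> \<in> pos_orthant"
  have "((\<lambda>r. \<beta> + r *\<^sub>R d) \<longlongrightarrow> \<beta> + 0 *\<^sub>R d) (at_right 0)" by (intro tendsto_intros)
  then show ?thesis by (rule topological_tendstoD) (use open_pos_orthant \<beta> in auto)
qed

lemma h_directional_derivative:
  "((\<lambda>r. (h (\<beta>s + r *\<^sub>R d) - h \<beta>s) / r) \<longlongrightarrow> - (\<delta>s \<bullet> d)) (at_right 0)"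
proof -
  have "((\<lambda>r. (Hr (\<beta>s + r *\<^sub>R d) - Hr \<beta>s) / r) \<longlongrightarrow> - (\<delta>s \<bullet> d)) (at_right 0)"
    using directional_derivative[OF Hr_differentiable, of d] by (simp add: delta_lim_def)
  moreover have "\<forall>\<^sub>F r in at_right 0. (Hr (\<beta>s + r *\<^sub>R d) - Hr \<beta>s) / r = (h (\<beta>s + r *\<^sub>R d) - h \<beta>s) / r"
    using line_in_pos[OF \<beta>s_pos, of d] by eventually_elim (simp add: Hr_eq \<beta>s_pos)
  ultimately show ?thesis by (rule Lim_transform_eventually)
qed

lemma derivative_lower_bound:
  assumes "\<forall>\<^sub>F r in at_right 0. c * r \<le> h (\<beta>s + r *\<^sub>R d) - h \<beta>s"
  shows "c \<le> - (\<delta>s \<bullet> d)"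
proof (rule tendsto_lowerbound[OF h_directional_derivative])
  show "\<forall>\<^sub>F r in at_right 0. c \<le> (h (\<beta>s + r *\<^sub>R d) - h \<beta>s) / r"
    using assms eventually_at_right_less[of 0] by eventually_elim (simp add: field_simps)
qed simp

text \<open>
  The mean of the selected subgradients is a subgradient of the mean objective \<open>h\<close>, and \<open>h\<close> is
  differentiable at \<open>\<beta>s\<close>: its only subgradient there is the gradient.
\<close>

lemma mean_DF: "(\<integral>\<theta>. DF \<theta> \<beta>s \<partial>P) = - \<delta>s"
proof -
  define m where "m = (\<integral>\<theta>. DF \<theta> \<beta>s \<partial>P)"
  have "m \<bullet> d \<le> - (\<delta>s \<bullet> d)" for d
  proof (rule derivative_lower_bound)
    show "\<forall>\<^sub>F r in at_right 0. m \<bullet> d * r \<le> h (\<beta>s + r *\<^sub>R d) - h \<beta>s"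
      using line_in_pos[OF \<beta>s_pos, of d]
    proof eventually_elim
      case (elim r)
      have "m \<bullet> d * r = (\<integral>\<theta>. DF \<theta> \<beta>s \<bullet> (r *\<^sub>R d) \<partial>P)"
        unfolding m_def using DF_integrable[OF \<beta>s_pos] by simp
      also have "\<dots> \<le> (\<integral>\<theta>. f \<theta> (\<beta>s + r *\<^sub>R d) - f \<theta> \<beta>s \<partial>P)"
        using subgradient[OF _ \<beta>s_pos elim] DF_integrable[OF \<beta>s_pos] f_integrable[OF \<beta>s_pos] f_integrable[OF elim]
        by (intro integral_mono) (auto simp: algebra_simps)
      also have "\<dots> = h (\<beta>s + r *\<^sub>R d) - h \<beta>s"
        unfolding h_def using f_integrable[OF \<beta>s_pos] f_integrable[OF elim] by simp
      finally show ?case .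
    qed
  qed
  then have "(m + \<delta>s) \<bullet> d \<le> 0" for d by (simp add: inner_add_left le_minus_iff add.commute[of "\<delta>s \<bullet> d"]) (metis add.commute le_diff_eq minus_diff_eq neg_le_0_iff_le add_0 diff_0)
  then have "(m + \<delta>s) \<bullet> (m + \<delta>s) \<le> 0" by blast
  then have "m + \<delta>s = 0" by (metis inner_eq_zero_iff inner_ge_zero order_antisym)
  then show ?thesis unfolding m_def by (simp add: eq_neg_iff_add_eq_0)
qed

text \<open>
  The first-order conditions for the minimizer over the box, read off from one-sided directional
  derivatives.  The upper bound matters only where \<open>\<beta>s $ i = 1\<close>: increasing a coordinate cannot
  decrease the maximum in \<open>F\<close>, so the slope of \<open>h\<close> is at least that of the barrier, \<open>- b $ i\<close>.
\<close>

lemma KKT: "0 \<le> \<delta>s" "\<delta>s \<le> b" "(1 - \<beta>s) \<bullet> \<delta>s = 0" "0 \<le> \<beta>s" "\<beta>s \<le> 1"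
proof -
  have pos: "0 < \<beta>s $ i" "\<beta>s $ i \<le> 1" for i
    using beta_lim_minimizes(1) by (auto simp: pos_orthant_def less_eq_vec_def)
  have nonneg: "0 \<le> \<delta>s $ i" for i
  proof -
    have "0 \<le> - (\<delta>s \<bullet> (- axis i 1))"
    proof (rule derivative_lower_bound)
      show "\<forall>\<^sub>F r in at_right 0. 0 * r \<le> h (\<beta>s + r *\<^sub>R (- axis i 1)) - h \<beta>s"
        using line_in_pos[OF \<beta>s_pos, of "- axis i 1"] eventually_at_right_less[of 0]
      proof eventually_elim
        case (elim r)
        have "(\<beta>s + r *\<^sub>R (- axis i 1)) $ j \<le> 1" for j
          using pos(2)[of j] elim(2) by (auto simp: axis_def)
        then have "feasible (\<beta>s + r *\<^sub>R (- axis i 1))" using elim(1) by (simp add: less_eq_vec_def)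
        then show ?case using beta_lim_minimizes(2) by fastforce
      qed
    qed
    then show ?thesis by (simp add: inner_axis)
  qed
  have slack: "\<delta>s $ i = 0" if "\<beta>s $ i < 1" for i
  proof -
    have "0 \<le> - (\<delta>s \<bullet> axis i 1)"
    proof (rule derivative_lower_bound)
      have "\<forall>\<^sub>F r in at_right 0. r < 1 - \<beta>s $ i"
        using that by (auto simp: eventually_at_right_field intro!: exI[of _ "1 - \<beta>s $ i"])
      then show "\<forall>\<^sub>F r in at_right 0. 0 * r \<le> h (\<beta>s + r *\<^sub>R axis i 1) - h \<beta>s"
        using line_in_pos[OF \<beta>s_pos, of "axis i 1"] eventually_at_right_less[of 0]
      proof eventually_elim
        case (elim r)
        have "(\<beta>s + r *\<^sub>R axis i 1) $ j \<le> 1" for j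
          using pos(2)[of j] elim(1) by (auto simp: axis_def)
        then have "feasible (\<beta>s + r *\<^sub>R axis i 1)" using elim(2) by (simp add: less_eq_vec_def)
        then show ?case using beta_lim_minimizes(2) by fastforce
      qed
    qed
    then show ?thesis using nonneg[of i] by (simp add: inner_axis)
  qed
  have upper: "\<delta>s $ i \<le> b $ i" for i
  proof (cases "\<beta>s $ i < 1")
    case True
    then show ?thesis using slack budgets[of i] by simp
  next
    case False
    then have one: "\<beta>s $ i = 1" using pos(2)[of i] by simp
    have "- b $ i \<le> - (\<delta>s \<bullet> axis i 1)"
    proof (rule derivative_lower_bound)
      show "\<forall>\<^sub>F r in at_right 0. - b $ i * r \<le> h (\<beta>s + r *\<^sub>R axis i 1) - h \<beta>s"
        using line_in_pos[OF \<beta>s_pos, of "axis i 1"] eventually_at_right_less[of 0]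
      proof eventually_elim
        case (elim r)
        let ?y = "\<beta>s + r *\<^sub>R axis i 1"
        have "f \<theta> \<beta>s - b $ i * r \<le> f \<theta> ?y" if \<theta>: "\<theta> \<in> space D" for \<theta>
        proof -
          have le: "\<beta>s $ j * v j \<theta> \<le> ?y $ j * v j \<theta>" for j
            using elim(2) valuations(2)[OF \<theta>, of j] by (intro mult_right_mono) (auto simp: axis_def)
          have "(MAX j. \<beta>s $ j * v j \<theta>) \<le> (MAX j. ?y $ j * v j \<theta>)"
          proof (rule Max.boundedI)
            fix a assume "a \<in> range (\<lambda>j. \<beta>s $ j * v j \<theta>)"
            then obtain j where "a = \<beta>s $ j * v j \<theta>" by auto
            then have "a \<le> ?y $ j * v j \<theta>" using le by simp
            also have "\<dots> \<le> (MAX j. ?y $ j * v j \<theta>)" by (rule Max_ge) auto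
            finally show "a \<le> (MAX j. ?y $ j * v j \<theta>)" .
          qed auto
          moreover have "(\<Sum>j\<in>UNIV. b $ j * ln (?y $ j)) - (\<Sum>j\<in>UNIV. b $ j * ln (\<beta>s $ j)) \<le> b $ i * r"
          proof -
            have "(\<Sum>j\<in>UNIV. b $ j * ln (?y $ j)) - (\<Sum>j\<in>UNIV. b $ j * ln (\<beta>s $ j)) =
              (\<Sum>j\<in>UNIV. if j = i then b $ i * ln (1 + r) else 0)"
              unfolding sum_subtractf[symmetric] by (rule sum.cong) (auto simp: axis_def one)
            also have "\<dots> = b $ i * ln (1 + r)" by simp
            also have "\<dots> \<le> b $ i * r"
              using budgets[of i] elim(2) by (intro mult_left_mono ln_add_one_self_le_self) auto
            finally show ?thesis .
          qed
          ultimately show ?thesis unfolding f_def F_fin_def by linarith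
        qed
        then have "(\<integral>\<theta>. f \<theta> \<beta>s - b $ i * r \<partial>P) \<le> (\<integral>\<theta>. f \<theta> ?y \<partial>P)"
          using f_integrable[OF \<beta>s_pos] f_integrable[OF elim(1)] by (intro integral_mono) auto
        then show ?case unfolding h_def using f_integrable[OF \<beta>s_pos] by (simp add: P.prob_space)
      qed
    qed
    then show ?thesis by (simp add: inner_axis)
  qed
  show "0 \<le> \<delta>s" "\<delta>s \<le> b" "0 \<le> \<beta>s" "\<beta>s \<le> 1"
    using nonneg upper pos by (auto simp: less_eq_vec_def intro: less_imp_le)
  have "(1 - \<beta>s $ i) * \<delta>s $ i = 0" for i using slack[of i] pos(2)[of i] by fastforce
  then show "(1 - \<beta>s) \<bullet> \<delta>s = 0"
    unfolding inner_vec_def by (intro sum.neutral ballI) simp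
qed

lemma h_second_order:
  "((\<lambda>r. (h (\<beta>s + r *\<^sub>R d) - h \<beta>s + r * (\<delta>s \<bullet> d)) / r\<^sup>2) \<longlongrightarrow> qform Hess d) (at_right 0)"
proof -
  obtain U where U: "open U" "\<beta>s \<in> U" "\<And>y. y \<in> U \<Longrightarrow> Hr differentiable at y"
     "gradient Hr differentiable at \<beta>s"
    using smooth unfolding twice_cont_diff_near_def by blast
  have "((\<lambda>r. (Hr (\<beta>s + r *\<^sub>R d) - Hr \<beta>s - r * (gradient Hr \<beta>s \<bullet> d)) / r\<^sup>2) \<longlongrightarrow> qform Hess d) (at_right 0)"
    unfolding hess_lim_def by (rule second_order_expansion[OF U])
  moreover have "\<forall>\<^sub>F r in at_right 0. (Hr (\<beta>s + r *\<^sub>R d) - Hr \<beta>s - r * (gradient Hr \<beta>s \<bullet> d)) / r\<^sup>2 =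
     (h (\<beta>s + r *\<^sub>R d) - h \<beta>s + r * (\<delta>s \<bullet> d)) / r\<^sup>2"
    using line_in_pos[OF \<beta>s_pos, of d] by eventually_elim (simp add: Hr_eq \<beta>s_pos delta_lim_def)
  ultimately show ?thesis by (rule Lim_transform_eventually)
qed

end

section \<open>Measurability\<close>

text \<open>
  By continuity the infimum may be taken over a countable dense subset of \<open>S\<close>.
\<close>

lemma INF_dense_measurable:
  fixes g :: "'w \<Rightarrow> 'b::euclidean_space \<Rightarrow> real"
  assumes meas: "\<And>\<beta>. \<beta> \<in> S \<Longrightarrow> (\<lambda>\<omega>. g \<omega> \<beta>) \<in> borel_measurable M"
    and cont: "\<And>\<omega>. \<omega> \<in> space M \<Longrightarrow> continuous_on S (g \<omega>)"
  shows "(\<lambda>\<omega>. INF \<beta>\<in>S. ereal (g \<omega> \<beta>)) \<in> borel_measurable M"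
proof -
  obtain T where T: "countable T" "T \<subseteq> S" "S \<subseteq> closure T" using separable by blast
  have eq: "(INF \<beta>\<in>S. ereal (g \<omega> \<beta>)) = (INF \<beta>\<in>T. ereal (g \<omega> \<beta>))" if \<omega>: "\<omega> \<in> space M" for \<omega>
  proof (rule antisym)
    show "(INF \<beta>\<in>S. ereal (g \<omega> \<beta>)) \<le> (INF \<beta>\<in>T. ereal (g \<omega> \<beta>))"
      by (rule INF_superset_mono[OF T(2)]) simp
    show "(INF \<beta>\<in>T. ereal (g \<omega> \<beta>)) \<le> (INF \<beta>\<in>S. ereal (g \<omega> \<beta>))"
    proof (rule INF_greatest)
      fix \<beta> assume \<beta>: "\<beta> \<in> S"
      then have "\<beta> \<in> closure T" using T(3) by blast
      then obtain y where y: "\<And>n. y n \<in> T" "y \<longlonglongrightarrow> \<beta>" unfolding closure_sequential by blast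
      have "(\<lambda>n. g \<omega> (y n)) \<longlonglongrightarrow> g \<omega> \<beta>"
        using y(1) T(2) by (intro continuous_on_tendsto_compose[OF cont[OF \<omega>] y(2) \<beta>] always_eventually) auto
      then have "(\<lambda>n. ereal (g \<omega> (y n))) \<longlonglongrightarrow> ereal (g \<omega> \<beta>)" by simp
      then show "(INF \<beta>\<in>T. ereal (g \<omega> \<beta>)) \<le> ereal (g \<omega> \<beta>)"
        by (rule LIMSEQ_le_const) (use y(1) in \<open>auto intro: INF_lower\<close>)
    qed
  qed
  have "(\<lambda>\<omega>. INF \<beta>\<in>T. ereal (g \<omega> \<beta>)) \<in> borel_measurable M"
    using T meas by (intro borel_measurable_INF) auto
  then show ?thesis using eq by (simp cong: measurable_cong)
qed

lemma vec_measurable: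
  fixes f :: "'w \<Rightarrow> real^'n"
  assumes "\<And>i. (\<lambda>x. f x $ i) \<in> borel_measurable M"
  shows "f \<in> borel_measurable M"
proof (rule borel_measurable_euclidean_space[THEN iffD2], rule)
  fix e :: "real^'n" assume "e \<in> Basis"
  then obtain i where e: "e = axis i 1" unfolding Basis_vec_def by (auto simp: Basis_real_def)
  have "(\<lambda>x. f x \<bullet> e) = (\<lambda>x. f x $ i)" unfolding e inner_axis by simp
  then show "(\<lambda>x. f x \<bullet> e) \<in> borel_measurable M" by (simp only: assms)
qed

lemma mat_measurable:
  fixes f :: "'w \<Rightarrow> real^'n^'m"
  assumes "\<And>i j. (\<lambda>x. f x $ i $ j) \<in> borel_measurable M"
  shows "f \<in> borel_measurable M"
proof (rule borel_measurable_euclidean_space[THEN iffD2], rule)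
  fix e :: "real^'n^'m" assume "e \<in> Basis"
  then obtain i u where e: "e = axis i u" "u \<in> Basis" unfolding Basis_vec_def by blast
  then obtain j where u: "u = axis j 1" unfolding Basis_vec_def by (auto simp: Basis_real_def)
  have "(\<lambda>x. f x \<bullet> e) = (\<lambda>x. f x $ i $ j)" unfolding e u inner_axis by simp
  then show "(\<lambda>x. f x \<bullet> e) \<in> borel_measurable M" by (simp only: assms)
qed

lemma ln_midpoint:
  assumes "0 < x" "0 < (y :: real)"
  shows "(ln x + ln y) / 2 \<le> ln ((x + y) / 2)" "x \<noteq> y \<Longrightarrow> (ln x + ln y) / 2 < ln ((x + y) / 2)"
proof -
  have sq: "((x + y) / 2)\<^sup>2 = x * y + ((x - y) / 2)\<^sup>2" by (simp add: power2_eq_square field_simps)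
  have l: "ln (x * y) = ln x + ln y" using assms by (simp add: ln_mult)
  have r: "ln (((x + y) / 2)\<^sup>2) = 2 * ln ((x + y) / 2)" using assms by (subst ln_realpow) auto
  have "x * y \<le> ((x + y) / 2)\<^sup>2" unfolding sq by simp
  then have "ln (x * y) \<le> ln (((x + y) / 2)\<^sup>2)" using assms by (subst ln_le_cancel_iff) auto
  then show "(ln x + ln y) / 2 \<le> ln ((x + y) / 2)" using l r by simp
  assume "x \<noteq> y"
  then have "x * y < ((x + y) / 2)\<^sup>2" unfolding sq by simp
  then have "ln (x * y) < ln (((x + y) / 2)\<^sup>2)" using assms by (subst ln_less_cancel_iff) auto
  then show "(ln x + ln y) / 2 < ln ((x + y) / 2)" using l r by simp
qed

text \<open>
  By monotonicity in \<open>c\<close> it suffices to look at rational levels.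
\<close>

lemma (in prob_space) borel_measurable_quantile:
  fixes \<phi> :: "'a \<Rightarrow> real \<Rightarrow> real"
  assumes meas: "\<And>c. (\<lambda>\<omega>. \<phi> \<omega> c) \<in> borel_measurable M"
    and mono: "\<And>\<omega> c c'. c \<le> c' \<Longrightarrow> \<phi> \<omega> c \<le> \<phi> \<omega> c'"
  shows "(\<lambda>\<omega>. Inf {ereal c | c. p \<le> \<phi> \<omega> c}) \<in> borel_measurable M"
proof -
  have eq: "Inf {ereal c | c. p \<le> \<phi> \<omega> c} = (INF q\<in>\<rat>. if p \<le> \<phi> \<omega> q then ereal q else \<infinity>)" for \<omega>
  proof (rule antisym)
    show "Inf {ereal c | c. p \<le> \<phi> \<omega> c} \<le> (INF q\<in>\<rat>. if p \<le> \<phi> \<omega> q then ereal q else \<infinity>)"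
      by (rule INF_greatest) (auto intro: Inf_lower)
    show "(INF q\<in>\<rat>. if p \<le> \<phi> \<omega> q then ereal q else \<infinity>) \<le> Inf {ereal c | c. p \<le> \<phi> \<omega> c}"
    proof (rule Inf_greatest)
      fix x assume "x \<in> {ereal c | c. p \<le> \<phi> \<omega> c}"
      then obtain c where c: "x = ereal c" "p \<le> \<phi> \<omega> c" by auto
      show "(INF q\<in>\<rat>. if p \<le> \<phi> \<omega> q then ereal q else \<infinity>) \<le> x"
      proof (rule dense_ge)
        fix z assume "x < z"
        then obtain r where r: "ereal c < ereal r" "ereal r < z" unfolding c(1) using ereal_dense2 by blast
        then obtain q where q: "q \<in> \<rat>" "c < q" "q < r" using Rats_dense_in_real[of c r] by auto
        have "p \<le> \<phi> \<omega> q" using c(2) mono[of c q \<omega>] q(2) by linarith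
        then have "(INF q\<in>\<rat>. if p \<le> \<phi> \<omega> q then ereal q else \<infinity>) \<le> ereal q"
          using INF_lower[OF q(1), of "\<lambda>q. if p \<le> \<phi> \<omega> q then ereal q else \<infinity>"] by simp
        also have "\<dots> \<le> z" using q(3) r(2) by (meson ereal_less_eq(3) less_imp_le order_trans)
        finally show "(INF q\<in>\<rat>. if p \<le> \<phi> \<omega> q then ereal q else \<infinity>) \<le> z" .
      qed
    qed
  qed
  have "(\<lambda>\<omega>. INF q\<in>\<rat>. if p \<le> \<phi> \<omega> q then ereal q else \<infinity>) \<in> borel_measurable M"
    using meas by (intro borel_measurable_INF countable_rat measurable_If) auto
  then show ?thesis unfolding eq .
qed

lemma emp_mean_real: "emp_mean t x g = (\<Sum>\<tau><t. g (x \<tau>)) / real t" for g :: "'a \<Rightarrow> real"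
  by (simp add: emp_mean_def)

lemma emp_mean_mono:
  fixes g g' :: "'a \<Rightarrow> real"
  assumes "\<And>\<tau>. g (x \<tau>) \<le> g' (x \<tau>)"
  shows "emp_mean t x g \<le> emp_mean t x g'"
  unfolding emp_mean_real using assms by (intro divide_right_mono sum_mono) auto

lemma emp_mean_add: "emp_mean t x (\<lambda>\<theta>. g \<theta> + g' \<theta>) = emp_mean t x g + emp_mean t x g'"
  by (simp add: emp_mean_def sum.distrib scaleR_add_right)

lemma emp_mean_diff: "emp_mean t x (\<lambda>\<theta>. g \<theta> - g' \<theta>) = emp_mean t x g - emp_mean t x g'"
  by (simp add: emp_mean_def sum_subtractf scaleR_diff_right)

lemma emp_mean_const: "0 < t \<Longrightarrow> emp_mean t x (\<lambda>\<theta>. c) = c" for c :: real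
  by (simp add: emp_mean_real)

lemma emp_mean_cmult: "emp_mean t x (\<lambda>\<theta>. c * g \<theta>) = c * emp_mean t x g" for c :: real
  by (simp add: emp_mean_real sum_distrib_left)

lemma emp_mean_inner: "emp_mean t x (\<lambda>\<theta>. g \<theta> \<bullet> d) = emp_mean t x g \<bullet> d"
  by (simp add: emp_mean_def inner_sum_left)

lemma emp_mean_abs: "\<bar>emp_mean t x g\<bar> \<le> emp_mean t x (\<lambda>\<theta>. \<bar>g \<theta>\<bar>)" for g :: "'a \<Rightarrow> real"
  unfolding emp_mean_real abs_divide by (auto intro!: divide_right_mono sum_abs)

context fppe begin

definition hobs :: "nat \<Rightarrow> 'w \<Rightarrow> real^'n \<Rightarrow> real" where
  "hobs t \<omega> \<beta> = emp_mean t (sample \<omega>) (\<lambda>\<theta>. f \<theta> \<beta>)"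

abbreviation bobs :: "nat \<Rightarrow> 'w \<Rightarrow> real^'n" where
  "bobs t \<omega> \<equiv> beta_obs v b t (sample \<omega>)"

abbreviation Tobs :: "ereal \<Rightarrow> nat \<Rightarrow> 'w \<Rightarrow> ereal" where
  "Tobs k t \<omega> \<equiv> T_obs k v b t (sample \<omega>) \<beta>s \<delta>s"

abbreviation hessobs :: "real \<Rightarrow> nat \<Rightarrow> 'w \<Rightarrow> real^'n^'n" where
  "hessobs e t \<omega> \<equiv> hess_obs v b e t (sample \<omega>)"

abbreviation Gboot :: "nat \<Rightarrow> 'w \<Rightarrow> (nat \<Rightarrow> nat) \<Rightarrow> real^'n" where
  "Gboot t \<omega> \<equiv> G_boot v b DF t (sample \<omega>)"

abbreviation Tboot :: "real \<Rightarrow> real \<Rightarrow> nat \<Rightarrow> 'w \<Rightarrow> (nat \<Rightarrow> nat) \<Rightarrow> ereal" where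
  "Tboot e1 e2 t \<omega> \<equiv> T_boot v b DF e1 e2 t (sample \<omega>)"

abbreviation cboot :: "real \<Rightarrow> real \<Rightarrow> real \<Rightarrow> nat \<Rightarrow> 'w \<Rightarrow> ereal" where
  "cboot e1 e2 a t \<omega> \<equiv> c_boot v b DF e1 e2 a t (sample \<omega>)"

abbreviation boot_prob :: "nat \<Rightarrow> (nat \<Rightarrow> nat) set \<Rightarrow> real" where
  "boot_prob t \<equiv> measure_pmf.prob (multinomial_unif_pmf t)"

lemma X_D: "\<omega> \<in> space M \<Longrightarrow> X \<tau> \<omega> \<in> space D"
  using X_in_space[of \<omega> \<tau>] by simp

lemma X_meas_D [measurable]: "X \<tau> \<in> M \<rightarrow>\<^sub>M D"
  using X_measurable[of \<tau>] by (simp cong: measurable_cong_sets)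

lemma H_obs_eq: "\<beta> \<in> pos_orthant \<Longrightarrow> H_obs v b t (sample \<omega>) \<beta> = ereal (hobs t \<omega> \<beta>)"
  by (simp add: H_obs_def hobs_def f_def)

lemma H_obs_outside: "\<beta> \<notin> pos_orthant \<Longrightarrow> H_obs v b t (sample \<omega>) \<beta> = \<infinity>"
  by (simp add: H_obs_def infty_outside_def)

lemma hobs_measurable [measurable (raw)]:
  "g \<in> borel_measurable M \<Longrightarrow> (\<lambda>\<omega>. hobs t \<omega> (g \<omega>)) \<in> borel_measurable M"
  unfolding hobs_def emp_mean_def
  by (intro borel_measurable_scaleR borel_measurable_sum f_measurable) auto

text \<open>
  The amount by which the barrier is strictly convex at the midpoint of \<open>\<beta>\<close> and \<open>\<beta>'\<close>.  It does not
  depend on the item, so the same gap appears in \<open>h\<close> and in the sample objectives.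
\<close>

definition strict_gap :: "real^'n \<Rightarrow> real^'n \<Rightarrow> real" where
  "strict_gap \<beta> \<beta>' = (\<Sum>i\<in>UNIV. b $ i * (ln ((\<beta> $ i + \<beta>' $ i) / 2) - (ln (\<beta> $ i) + ln (\<beta>' $ i)) / 2))"

lemma strict_gap_pos:
  assumes "\<beta> \<in> pos_orthant" "\<beta>' \<in> pos_orthant" "\<beta> \<noteq> \<beta>'"
  shows "0 < strict_gap \<beta> \<beta>'"
proof -
  obtain i where i: "\<beta> $ i \<noteq> \<beta>' $ i" using assms(3) by (auto simp: vec_eq_iff)
  show ?thesis
    unfolding strict_gap_def
  proof (rule sum_pos2[of _ i])
    show "0 < b $ i * (ln ((\<beta> $ i + \<beta>' $ i) / 2) - (ln (\<beta> $ i) + ln (\<beta>' $ i)) / 2)"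
      using ln_midpoint(2)[of "\<beta> $ i" "\<beta>' $ i"] i assms budgets[of i] by (auto simp: pos_orthant_def)
    show "0 \<le> b $ j * (ln ((\<beta> $ j + \<beta>' $ j) / 2) - (ln (\<beta> $ j) + ln (\<beta>' $ j)) / 2)" for j
      using ln_midpoint(1)[of "\<beta> $ j" "\<beta>' $ j"] assms budgets[of j]
      by (intro mult_nonneg_nonneg) (auto simp: pos_orthant_def)
  qed auto
qed

lemma f_midpoint:
  "f \<theta> ((1/2) *\<^sub>R (\<beta> + \<beta>')) \<le> (f \<theta> \<beta> + f \<theta> \<beta>') / 2 - strict_gap \<beta> \<beta>'"
proof -
  let ?m = "(1/2) *\<^sub>R (\<beta> + \<beta>')"
  have "(MAX i. ?m $ i * v i \<theta>) \<le> ((MAX i. \<beta> $ i * v i \<theta>) + (MAX i. \<beta>' $ i * v i \<theta>)) / 2"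
  proof (rule Max.boundedI)
    fix a assume "a \<in> range (\<lambda>i. ?m $ i * v i \<theta>)"
    then obtain i where a: "a = (\<beta> $ i * v i \<theta> + \<beta>' $ i * v i \<theta>) / 2" by (auto simp: algebra_simps)
    have "\<beta> $ i * v i \<theta> \<le> (MAX i. \<beta> $ i * v i \<theta>)" "\<beta>' $ i * v i \<theta> \<le> (MAX i. \<beta>' $ i * v i \<theta>)"
      by (rule Max_ge; simp)+
    then show "a \<le> ((MAX i. \<beta> $ i * v i \<theta>) + (MAX i. \<beta>' $ i * v i \<theta>)) / 2"
      unfolding a by (intro divide_right_mono add_mono) auto
  qed auto
  moreover have gap: "strict_gap \<beta> \<beta>' = (\<Sum>i\<in>UNIV. b $ i * ln (m $ i)) -
     ((\<Sum>i\<in>UNIV. b $ i * ln (\<beta> $ i)) + (\<Sum>i\<in>UNIV. b $ i * ln (\<beta>' $ i))) / 2"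
    if "\<And>i. m $ i = (\<beta> $ i + \<beta>' $ i) / 2" for m
    unfolding strict_gap_def
    by (simp add: that sum.distrib[symmetric] sum_subtractf[symmetric] sum_divide_distrib algebra_simps)
  moreover have "strict_gap \<beta> \<beta>' = (\<Sum>i\<in>UNIV. b $ i * ln (?m $ i)) -
     ((\<Sum>i\<in>UNIV. b $ i * ln (\<beta> $ i)) + (\<Sum>i\<in>UNIV. b $ i * ln (\<beta>' $ i))) / 2"
    by (rule gap) simp
  ultimately show ?thesis unfolding f_def F_fin_def by argo
qed

lemma hobs_midpoint:
  assumes "0 < t"
  shows "hobs t \<omega> ((1/2) *\<^sub>R (\<beta> + \<beta>')) \<le> (hobs t \<omega> \<beta> + hobs t \<omega> \<beta>') / 2 - strict_gap \<beta> \<beta>'"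
proof -
  have "hobs t \<omega> ((1/2) *\<^sub>R (\<beta> + \<beta>')) \<le> emp_mean t (sample \<omega>) (\<lambda>\<theta>. ((1/2) * (f \<theta> \<beta> + f \<theta> \<beta>')) - strict_gap \<beta> \<beta>')"
    unfolding hobs_def by (rule emp_mean_mono) (use f_midpoint in simp)
  also have "\<dots> = (hobs t \<omega> \<beta> + hobs t \<omega> \<beta>') / 2 - strict_gap \<beta> \<beta>'"
    unfolding emp_mean_diff emp_mean_cmult emp_mean_add emp_mean_const[OF assms] hobs_def by simp
  finally show ?thesis .
qed

lemma h_midpoint:
  assumes \<beta>: "\<beta> \<in> pos_orthant" "\<beta>' \<in> pos_orthant" "(1/2) *\<^sub>R (\<beta> + \<beta>') \<in> pos_orthant"
  shows "h ((1/2) *\<^sub>R (\<beta> + \<beta>')) \<le> (h \<beta> + h \<beta>') / 2 - strict_gap \<beta> \<beta>'"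
proof -
  have "h ((1/2) *\<^sub>R (\<beta> + \<beta>')) \<le> (\<integral>\<theta>. (f \<theta> \<beta> + f \<theta> \<beta>') / 2 - strict_gap \<beta> \<beta>' \<partial>P)"
    unfolding h_def using f_integrable[OF \<beta>(1)] f_integrable[OF \<beta>(2)] f_integrable[OF \<beta>(3)] f_midpoint
    by (intro integral_mono) auto
  also have "\<dots> = (h \<beta> + h \<beta>') / 2 - strict_gap \<beta> \<beta>'"
    unfolding h_def using f_integrable[OF \<beta>(1)] f_integrable[OF \<beta>(2)] by simp
  finally show ?thesis .
qed

lemma feasible_midpoint:
  assumes "feasible \<beta>" "feasible \<beta>'"
  shows "feasible ((1/2) *\<^sub>R (\<beta> + \<beta>') :: real^'n)"
  using assms unfolding pos_orthant_def less_eq_vec_def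
  by (auto intro!: add_pos_pos) (smt (verit))

lemma hobs_Lipschitz:
  assumes C: "\<forall>\<theta>\<in>space D. \<forall>\<beta>\<in>box_lu l u. norm (DF \<theta> \<beta>) \<le> C" and l: "0 < l"
    and \<beta>: "\<beta> \<in> box_lu l u" "\<beta>' \<in> box_lu l u" and \<omega>: "\<omega> \<in> space M" and t: "0 < t"
  shows "\<bar>hobs t \<omega> \<beta> - hobs t \<omega> \<beta>'\<bar> \<le> C * norm (\<beta> - \<beta>')"
proof -
  have "\<bar>hobs t \<omega> \<beta> - hobs t \<omega> \<beta>'\<bar> \<le> emp_mean t (sample \<omega>) (\<lambda>\<theta>. \<bar>f \<theta> \<beta> - f \<theta> \<beta>'\<bar>)"
    unfolding hobs_def emp_mean_diff[symmetric] by (rule emp_mean_abs)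
  also have "\<dots> \<le> emp_mean t (sample \<omega>) (\<lambda>\<theta>. C * norm (\<beta> - \<beta>'))"
    by (rule emp_mean_mono) (rule f_Lipschitz[OF C l X_D[OF \<omega>] \<beta>])
  finally show ?thesis using t by (simp add: emp_mean_const)
qed

lemma hobs_continuous:
  assumes \<omega>: "\<omega> \<in> space M" and t: "0 < t"
  shows "continuous_on pos_orthant (hobs t \<omega>)"
proof (rule local_Lipschitz_continuous)
  fix l u :: real assume l: "0 < l"
  then obtain C where "\<forall>\<theta>\<in>space D. \<forall>\<beta>\<in>box_lu l u. norm (DF \<theta> \<beta>) \<le> C" using DF_bounded_on_box by blast
  then show "\<exists>C. \<forall>\<beta>\<in>box_lu l u. \<forall>\<beta>'\<in>box_lu l u. \<bar>hobs t \<omega> \<beta> - hobs t \<omega> \<beta>'\<bar> \<le> C * norm (\<beta> - \<beta>')"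
    using hobs_Lipschitz l \<omega> t by blast
qed

lemma hobs_barrier:
  assumes \<omega>: "\<omega> \<in> space M" and t: "0 < t" and \<beta>: "\<beta> \<in> pos_orthant"
  shows "- (\<Sum>i\<in>UNIV. b $ i * ln (\<beta> $ i)) \<le> hobs t \<omega> \<beta>"
proof -
  have "emp_mean t (sample \<omega>) (\<lambda>\<theta>. - (\<Sum>i\<in>UNIV. b $ i * ln (\<beta> $ i))) \<le> hobs t \<omega> \<beta>"
    unfolding hobs_def by (rule emp_mean_mono) (rule f_barrier[OF X_D[OF \<omega>] \<beta>])
  then show ?thesis unfolding emp_mean_const[OF t] .
qed

lemma bobs_minimizes:
  assumes \<omega>: "\<omega> \<in> space M" and t: "0 < t"
  shows "feasible (bobs t \<omega>)" "feasible \<beta> \<Longrightarrow> hobs t \<omega> (bobs t \<omega>) \<le> hobs t \<omega> \<beta>"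
proof -
  obtain \<beta>m where \<beta>m: "feasible \<beta>m" "\<And>\<beta>. feasible \<beta> \<Longrightarrow> hobs t \<omega> \<beta>m \<le> hobs t \<omega> \<beta>"
    using barrier_attains_min[OF budgets hobs_continuous[OF \<omega> t] _ closed_UNIV, of 1]
      hobs_barrier[OF \<omega> t] feasible_1 by auto
  have "is_arg_min (H_obs v b t (sample \<omega>)) (\<lambda>\<beta>. \<beta> \<in> pos_orthant \<and> \<beta> \<le> 1) \<beta>m"
    unfolding is_arg_min_def using \<beta>m by (auto simp: H_obs_eq not_less)
  then have "is_arg_min (H_obs v b t (sample \<omega>)) (\<lambda>\<beta>. \<beta> \<in> pos_orthant \<and> \<beta> \<le> 1) (bobs t \<omega>)"
    unfolding beta_obs_def arg_min_def by (rule someI)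
  then have *: "feasible (bobs t \<omega>)"
    "\<not> (\<exists>y. feasible y \<and> H_obs v b t (sample \<omega>) y < H_obs v b t (sample \<omega>) (bobs t \<omega>))"
    unfolding is_arg_min_def by auto
  show "feasible (bobs t \<omega>)" by (rule *)
  show "feasible \<beta> \<Longrightarrow> hobs t \<omega> (bobs t \<omega>) \<le> hobs t \<omega> \<beta>" using * by (auto simp: H_obs_eq not_less)
qed

lemma bobs_unique:
  assumes \<omega>: "\<omega> \<in> space M" and t: "0 < t" and \<beta>: "feasible \<beta>" "hobs t \<omega> \<beta> \<le> hobs t \<omega> (bobs t \<omega>)"
  shows "\<beta> = bobs t \<omega>"
proof (rule ccontr)
  assume ne: "\<beta> \<noteq> bobs t \<omega>"
  note bm = bobs_minimizes[OF \<omega> t]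
  have "0 < strict_gap \<beta> (bobs t \<omega>)" using strict_gap_pos[OF _ _ ne] \<beta>(1) bm(1) by blast
  moreover have "hobs t \<omega> (bobs t \<omega>) \<le> hobs t \<omega> ((1/2) *\<^sub>R (\<beta> + bobs t \<omega>))"
    by (rule bm(2)[OF feasible_midpoint[OF \<beta>(1) bm(1)]])
  ultimately show False using hobs_midpoint[OF t, of \<omega> \<beta> "bobs t \<omega>"] \<beta>(2) by argo
qed

text \<open>
  The minimizer satisfies \<open>bobs t \<omega> $ i \<le> a\<close> if and only if the minimum over the points with this
  property equals the minimum over all feasible points.  Uniqueness of the minimizer makes this
  sufficient, and infima are measurable.
\<close>

lemma bobs_measurable:
  assumes t: "0 < t"
  shows "bobs t \<in> borel_measurable M"
proof (rule vec_measurable)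
  fix i
  show "(\<lambda>\<omega>. bobs t \<omega> $ i) \<in> borel_measurable M"
    unfolding borel_measurable_iff_le
  proof
    fix a :: real
    define K where "K = {\<beta> :: real^'n. feasible \<beta> \<and> \<beta> $ i \<le> a}"
    define A where "A = {\<beta> :: real^'n. feasible \<beta>}"
    show "{\<omega> \<in> space M. bobs t \<omega> $ i \<le> a} \<in> events"
    proof (cases "0 < a")
      case False
      have "{\<omega> \<in> space M. bobs t \<omega> $ i \<le> a} = {}"
      proof -
        have "a < bobs t \<omega> $ i" if \<omega>: "\<omega> \<in> space M" for \<omega>
        proof -
          have "0 < bobs t \<omega> $ i" using bobs_minimizes(1)[OF \<omega> t] by (simp add: pos_orthant_def)
          then show ?thesis using False by linarith
        qed
        then show ?thesis by (auto simp: not_le)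
      qed
      then show ?thesis by (simp only: sets.empty_sets)
    next
      case True
      have meas: "(\<lambda>\<omega>. INF \<beta>\<in>S. ereal (hobs t \<omega> \<beta>)) \<in> borel_measurable M" if "S \<subseteq> pos_orthant" for S
        by (rule INF_dense_measurable) (use hobs_continuous[OF _ t] continuous_on_subset that in auto)
      have [measurable]: "(\<lambda>\<omega>. INF \<beta>\<in>K. ereal (hobs t \<omega> \<beta>)) \<in> borel_measurable M"
        "(\<lambda>\<omega>. INF \<beta>\<in>A. ereal (hobs t \<omega> \<beta>)) \<in> borel_measurable M"
        by (rule meas; auto simp: K_def A_def)+
      have "bobs t \<omega> $ i \<le> a \<longleftrightarrow> (INF \<beta>\<in>K. ereal (hobs t \<omega> \<beta>)) \<le> (INF \<beta>\<in>A. ereal (hobs t \<omega> \<beta>))"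
        if \<omega>: "\<omega> \<in> space M" for \<omega>
      proof
        assume "bobs t \<omega> $ i \<le> a"
        then have "bobs t \<omega> \<in> K" using bobs_minimizes(1)[OF \<omega> t] by (simp add: K_def)
        then have "(INF \<beta>\<in>K. ereal (hobs t \<omega> \<beta>)) \<le> ereal (hobs t \<omega> (bobs t \<omega>))" by (rule INF_lower)
        also have "\<dots> \<le> (INF \<beta>\<in>A. ereal (hobs t \<omega> \<beta>))"
          using bobs_minimizes(2)[OF \<omega> t] by (intro INF_greatest) (auto simp: A_def)
        finally show "(INF \<beta>\<in>K. ereal (hobs t \<omega> \<beta>)) \<le> (INF \<beta>\<in>A. ereal (hobs t \<omega> \<beta>))" .
      next
        assume le: "(INF \<beta>\<in>K. ereal (hobs t \<omega> \<beta>)) \<le> (INF \<beta>\<in>A. ereal (hobs t \<omega> \<beta>))"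
        define \<beta>0 :: "real^'n" where "\<beta>0 = (\<chi> j. min 1 a)"
        have "\<exists>\<beta>\<in>{\<beta>. \<beta> $ i \<le> a}. feasible \<beta> \<and> (\<forall>\<beta>'\<in>{\<beta>. \<beta> $ i \<le> a}. feasible \<beta>' \<longrightarrow> hobs t \<omega> \<beta> \<le> hobs t \<omega> \<beta>')"
        proof (rule barrier_attains_min[OF budgets hobs_continuous[OF \<omega> t]])
          show "closed {\<beta> :: real^'n. \<beta> $ i \<le> a}" by (intro closed_Collect_le continuous_intros)
          show "\<beta>0 \<in> {\<beta>. \<beta> $ i \<le> a}" "feasible \<beta>0"
            using True by (auto simp: \<beta>0_def pos_orthant_def less_eq_vec_def)
        qed (use hobs_barrier[OF \<omega> t] in auto)
        then obtain \<beta> where \<beta>: "\<beta> $ i \<le> a" "feasible \<beta>"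
          "\<And>\<beta>'. \<beta>' $ i \<le> a \<Longrightarrow> feasible \<beta>' \<Longrightarrow> hobs t \<omega> \<beta> \<le> hobs t \<omega> \<beta>'" by auto
        have "ereal (hobs t \<omega> \<beta>) \<le> (INF \<beta>\<in>K. ereal (hobs t \<omega> \<beta>))"
          by (rule INF_greatest) (auto simp: K_def intro: \<beta>(3))
        also note le
        also have "(INF \<beta>\<in>A. ereal (hobs t \<omega> \<beta>)) \<le> ereal (hobs t \<omega> (bobs t \<omega>))"
          by (rule INF_lower) (use bobs_minimizes(1)[OF \<omega> t] in \<open>simp add: A_def\<close>)
        finally have "\<beta> = bobs t \<omega>" using bobs_unique[OF \<omega> t \<beta>(2)] by simp
        then show "bobs t \<omega> $ i \<le> a" using \<beta>(1) by simp
      qed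
      then have "{\<omega> \<in> space M. bobs t \<omega> $ i \<le> a} =
        {\<omega> \<in> space M. (INF \<beta>\<in>K. ereal (hobs t \<omega> \<beta>)) \<le> (INF \<beta>\<in>A. ereal (hobs t \<omega> \<beta>))}"
        by blast
      also have "\<dots> \<in> events" by measurable
      finally show ?thesis .
    qed
  qed
qed

lemma H_obs_measurable:
  assumes [measurable]: "g \<in> borel_measurable M"
  shows "(\<lambda>\<omega>. H_obs v b t (sample \<omega>) (g \<omega>)) \<in> borel_measurable M"
proof -
  have [measurable]: "pos_orthant \<in> sets (borel :: (real^'n) measure)" by (rule borel_open[OF open_pos_orthant])
  have "(\<lambda>\<omega>. H_obs v b t (sample \<omega>) (g \<omega>)) =
      (\<lambda>\<omega>. if g \<omega> \<in> pos_orthant then ereal (hobs t \<omega> (g \<omega>)) else \<infinity>)"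
    by (auto simp: H_obs_eq H_obs_outside)
  also have "\<dots> \<in> borel_measurable M" by measurable
  finally show ?thesis .
qed

lemma hess_obs_measurable:
  assumes t: "0 < t"
  shows "(\<lambda>\<omega>. hessobs e t \<omega>) \<in> borel_measurable M"
proof (rule mat_measurable)
  fix k l
  have [measurable]: "(\<lambda>\<omega>. bobs t \<omega>) \<in> borel_measurable M"
    by (rule bobs_measurable[OF t])
  show "(\<lambda>\<omega>. hessobs e t \<omega> $ k $ l) \<in> borel_measurable M"
    unfolding hess_obs_def num_hessian_def vec_lambda_beta
    by (intro borel_measurable_real_of_ereal borel_measurable_ereal_divide borel_measurable_ereal_add
      borel_measurable_ereal_diff H_obs_measurable borel_measurable_const) measurable
qed

lemma G_boot_measurable:
  assumes t: "0 < t"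
  shows "(\<lambda>\<omega>. Gboot t \<omega> w) \<in> borel_measurable M"
proof -
  have [measurable]: "(\<lambda>\<omega>. DF (X \<tau> \<omega>) (bobs t \<omega>)) \<in> borel_measurable M" for \<tau>
    using DF_measurable[OF X_meas_D bobs_measurable[OF t]] bobs_minimizes(1)[OF _ t] by auto
  show ?thesis unfolding G_boot_def boot_mean_def emp_mean_def by measurable
qed

lemma T_boot_measurable:
  assumes t: "0 < t"
  shows "(\<lambda>\<omega>. Tboot e1 e2 t \<omega> w) \<in> borel_measurable M"
proof -
  have [measurable]: "(\<lambda>\<omega>. bobs t \<omega>) \<in> borel_measurable M"
    by (rule bobs_measurable[OF t])
  note [measurable] = G_boot_measurable[OF t] hess_obs_measurable[OF t]
  have Hij [measurable]: "(\<lambda>\<omega>. hessobs e t \<omega> $ i $ j) \<in> borel_measurable M" for e i j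
    by (rule borel_measurable_continuous_on[where f="\<lambda>A. A $ i $ j"]) (auto intro!: continuous_intros)
  have "(\<lambda>\<omega>. INF \<beta>\<in>{\<beta>. 0 \<le> \<beta>}. ereal
          ((e1 * (Gboot t \<omega> w \<bullet> (\<beta> - bobs t \<omega>))
            + 1 / 2 * ((bobs t \<omega> - \<beta>) \<bullet> (hessobs e2 t \<omega> *v (bobs t \<omega> - \<beta>))))
           / e1\<^sup>2)) \<in> borel_measurable M"
  proof (rule INF_dense_measurable)
    fix \<beta> :: "real^'n"
    show "(\<lambda>\<omega>. (e1 * (Gboot t \<omega> w \<bullet> (\<beta> - bobs t \<omega>))
            + 1 / 2 * ((bobs t \<omega> - \<beta>) \<bullet> (hessobs e2 t \<omega> *v (bobs t \<omega> - \<beta>))))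
           / e1\<^sup>2) \<in> borel_measurable M"
      unfolding inner_vec_def[of "beta_obs v b t x - y" for x y] matrix_vector_mult_def vec_lambda_beta inner_real_def
        vector_minus_component
      by measurable
  next
    fix \<omega>
    show "continuous_on {\<beta>. 0 \<le> \<beta>} (\<lambda>\<beta>. (e1 * (Gboot t \<omega> w \<bullet> (\<beta> - bobs t \<omega>))
            + 1 / 2 * ((bobs t \<omega> - \<beta>) \<bullet> (hessobs e2 t \<omega> *v (bobs t \<omega> - \<beta>))))
           / e1\<^sup>2)"
      unfolding divide_inverse
      by (intro continuous_intros matrix_vector_mult_linear_continuous_on[THEN continuous_on_compose2]) auto
  qed
  then show ?thesis unfolding T_boot_def by (rule borel_measurable_uminus_ereal)
qed

lemma finite_set_multinomial: "0 < t \<Longrightarrow> finite (set_pmf (multinomial_unif_pmf t))"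
  unfolding multinomial_unif_pmf_def set_map_pmf
  by (intro finite_imageI finite_set_replicate_pmf) (simp add: set_pmf_of_set lessThan_empty_iff)

lemma c_boot_measurable:
  assumes t: "0 < t"
  shows "(\<lambda>\<omega>. cboot e1 e2 a t \<omega>) \<in> borel_measurable M"
proof -
  define \<phi> where "\<phi> \<omega> c = boot_prob t
      {w. Tboot e1 e2 t \<omega> w \<le> ereal c}" for \<omega> c
  have "(\<lambda>\<omega>. Inf {ereal c | c. 1 - a \<le> \<phi> \<omega> c}) \<in> borel_measurable M"
  proof (rule borel_measurable_quantile)
    fix c
    have "\<phi> \<omega> c = (\<Sum>w\<in>set_pmf (multinomial_unif_pmf t). pmf (multinomial_unif_pmf t) w *
       (if Tboot e1 e2 t \<omega> w \<le> ereal c then 1 else 0))" for \<omega>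
    proof -
      let ?I = "{w. Tboot e1 e2 t \<omega> w \<le> ereal c}"
      have "\<phi> \<omega> c = measure_pmf.expectation (multinomial_unif_pmf t) (indicator ?I)"
        unfolding \<phi>_def by simp
      also have "\<dots> = (\<Sum>w\<in>set_pmf (multinomial_unif_pmf t). pmf (multinomial_unif_pmf t) w * indicator ?I w)"
        by (rule expectation_finite_pmf[OF finite_set_multinomial[OF t]])
      finally show ?thesis by (simp add: indicator_def of_bool_def)
    qed
    moreover have "(\<lambda>\<omega>. \<Sum>w\<in>set_pmf (multinomial_unif_pmf t). pmf (multinomial_unif_pmf t) w *
       (if Tboot e1 e2 t \<omega> w \<le> ereal c then 1 else 0)) \<in> borel_measurable M"
      using T_boot_measurable[OF t] by measurable
    ultimately show "(\<lambda>\<omega>. \<phi> \<omega> c) \<in> borel_measurable M" by presburger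
  next
    fix \<omega> and c c' :: real assume "c \<le> c'"
    then show "\<phi> \<omega> c \<le> \<phi> \<omega> c'"
      unfolding \<phi>_def by (intro measure_pmf.finite_measure_mono) (auto intro: order_trans)
  qed
  then show ?thesis unfolding c_boot_def \<phi>_def .
qed

text \<open>
  Points outside the orthant contribute \<open>\<infinity>\<close> to the infimum, and inside it everything is real.
\<close>

lemma T_obs_eq:
  assumes t: "0 < t" and k: "0 < k"
  shows "Tobs k t \<omega> =
    - (INF \<beta>\<in>{\<beta>s + (1 / sqrt (real t)) *\<^sub>R y | y. ereal (norm y) \<le> k} \<inter> pos_orthant.
        ereal (real t * (hobs t \<omega> \<beta> - hobs t \<omega> \<beta>s + \<delta>s \<bullet> (\<beta> - \<beta>s))))"
proof -
  let ?S = "{\<beta>s + (1 / sqrt (real t)) *\<^sub>R y | y. ereal (norm y) \<le> k}"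
  let ?g = "\<lambda>\<beta>'. ereal (real t) * (L_obs v b t (sample \<omega>) \<beta>' \<delta>s - L_obs v b t (sample \<omega>) \<beta>s \<delta>s)"
  have g1: "?g \<beta> = ereal (real t * (hobs t \<omega> \<beta> - hobs t \<omega> \<beta>s + \<delta>s \<bullet> (\<beta> - \<beta>s)))" if "\<beta> \<in> pos_orthant" for \<beta>
    using that \<beta>s_pos by (simp add: L_obs_def H_obs_eq inner_diff_right algebra_simps)
  have g2: "?g \<beta> = \<infinity>" if "\<beta> \<notin> pos_orthant" for \<beta>
    using that \<beta>s_pos t by (simp add: L_obs_def H_obs_eq H_obs_outside)
  have "(INF \<beta>'\<in>?S. ?g \<beta>') = (INF \<beta>'\<in>?S \<inter> pos_orthant. ?g \<beta>')"
  proof (rule antisym)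
    show "(INF \<beta>'\<in>?S. ?g \<beta>') \<le> (INF \<beta>'\<in>?S \<inter> pos_orthant. ?g \<beta>')"
      by (rule INF_superset_mono) auto
    show "(INF \<beta>'\<in>?S \<inter> pos_orthant. ?g \<beta>') \<le> (INF \<beta>'\<in>?S. ?g \<beta>')"
    proof (rule INF_greatest)
      fix \<beta>' assume \<beta>': "\<beta>' \<in> ?S"
      show "(INF \<beta>'\<in>?S \<inter> pos_orthant. ?g \<beta>') \<le> ?g \<beta>'"
      proof (cases "\<beta>' \<in> pos_orthant")
        case True
        then show ?thesis using \<beta>' by (intro INF_lower) auto
      next
        case False
        show ?thesis unfolding g2[OF False] by simp
      qed
    qed
  qed
  also have "\<dots> = (INF \<beta>\<in>?S \<inter> pos_orthant.
        ereal (real t * (hobs t \<omega> \<beta> - hobs t \<omega> \<beta>s + \<delta>s \<bullet> (\<beta> - \<beta>s))))"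
    by (rule INF_cong) (auto simp: g1)
  finally show ?thesis unfolding T_obs_def by simp
qed

lemma T_obs_measurable:
  assumes t: "0 < t" and k: "0 < k"
  shows "(\<lambda>\<omega>. Tobs k t \<omega>) \<in> borel_measurable M"
  unfolding T_obs_eq[OF assms]
proof (intro borel_measurable_uminus_ereal INF_dense_measurable)
  fix \<omega> assume "\<omega> \<in> space M"
  then have "continuous_on pos_orthant (hobs t \<omega>)" using hobs_continuous t by blast
  then show "continuous_on ({\<beta>s + (1 / sqrt (real t)) *\<^sub>R y | y. ereal (norm y) \<le> k} \<inter> pos_orthant)
     (\<lambda>\<beta>. real t * (hobs t \<omega> \<beta> - hobs t \<omega> \<beta>s + \<delta>s \<bullet> (\<beta> - \<beta>s)))"
    by (intro continuous_intros) (auto intro: continuous_on_subset)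
qed measurable

end

section \<open>Expansion of the objective around the equilibrium\<close>

lemma positive_definite_inverse:
  fixes H :: "real^'n^'n"
  assumes pd: "positive_definite H"
  shows "\<exists>A. psd A \<and> (\<forall>g. H *v (A *v g) = g)"
proof -
  have tr: "transpose H = H" and pos: "\<And>x. x \<noteq> 0 \<Longrightarrow> 0 < x \<bullet> (H *v x)"
    using pd by (auto simp: positive_definite_def)
  have "\<forall>x. H *v x = 0 \<longrightarrow> x = 0" using pos by fastforce
  then obtain A where A: "A ** H = mat 1" using matrix_left_invertible_ker by blast
  then have HA: "H ** A = mat 1" using matrix_left_right_inverse by blast
  have inv: "H *v (A *v g) = g" for g by (simp add: matrix_vector_mul_assoc HA)
  have "transpose A ** H = mat 1" using arg_cong[OF HA, of transpose] by (simp add: matrix_transpose_mul tr)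
  then have "transpose A = A" by (metis HA matrix_mul_assoc matrix_mul_lid matrix_mul_rid)
  moreover have "0 \<le> x \<bullet> (A *v x)" for x
  proof -
    have "x \<bullet> (A *v x) = (A *v x) \<bullet> (H *v (A *v x))" by (simp add: inv inner_commute)
    then show ?thesis using pos[of "A *v x"] by (cases "A *v x = 0") auto
  qed
  ultimately show ?thesis using inv unfolding psd_def by blast
qed

lemma inverse_sqrt_at_right: "filterlim (\<lambda>t. 1 / sqrt (real t)) (at_right 0) sequentially"
  unfolding filterlim_at using inverse_sqrt_tendsto_0 eventually_gt_at_top[of 0]
  by (auto elim!: eventually_mono)

context fppe begin

lemma near_box:
  assumes "\<beta> \<in> pos_orthant"
  shows "\<exists>l u r C. 0 < l \<and> 0 < r \<and> 0 \<le> C \<and> (\<forall>y. norm (y - \<beta>) \<le> r \<longrightarrow> y \<in> box_lu l u) \<and>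
    (\<forall>\<theta>\<in>space D. \<forall>\<beta>\<in>box_lu l u. norm (DF \<theta> \<beta>) \<le> C)"
proof -
  obtain l u where lu: "0 < l" "\<beta> \<in> box_lu l u" using singleton_box[OF assms] by blast
  define r where "r = l / 2"
  have r: "0 < r" "0 < l - r" using lu by (auto simp: r_def)
  obtain C where C: "\<forall>\<theta>\<in>space D. \<forall>\<beta>\<in>box_lu (l - r) (u + r). norm (DF \<theta> \<beta>) \<le> C"
    using DF_bounded_on_box[OF r(2)] by blast
  have near: "y \<in> box_lu (l - r) (u + r)" if "norm (y - \<beta>) \<le> r" for y
  proof -
    have "\<bar>y $ i - \<beta> $ i\<bar> \<le> r" for i
      using that component_le_norm_cart[of "y - \<beta>" i] by simp
    then show ?thesis using lu(2) unfolding box_lu_def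
      by (smt (verit, best) mem_Collect_eq)
  qed
  show ?thesis
  proof (intro exI conjI)
    show "\<forall>y. norm (y - \<beta>) \<le> r \<longrightarrow> y \<in> box_lu (l - r) (u + r)" using near by blast
    show "\<forall>\<theta>\<in>space D. \<forall>\<beta>\<in>box_lu (l - r) (u + r). norm (DF \<theta> \<beta>) \<le> max 0 C"
      using C by (simp add: le_max_iff_disj)
  qed (use r in auto)
qed

text \<open>
  The subgradient at \<open>\<beta>s\<close>, centred by its mean \<open>- \<delta>s\<close>.
\<close>

definition score :: "'a \<Rightarrow> real^'n" where "score \<theta> = DF \<theta> \<beta>s + \<delta>s"

abbreviation score_sum :: "nat \<Rightarrow> 'w \<Rightarrow> real^'n" where
  "score_sum \<equiv> normalized_sum score"

text \<open>
  The difference \<open>t * (L \<beta> - L \<beta>s)\<close> of the Lagrangian at \<open>\<delta>s\<close>, in the coordinate \<open>y\<close> with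
  \<open>\<beta> = \<beta>s + y / \<surd>t\<close>.
\<close>

definition local_obj :: "nat \<Rightarrow> 'w \<Rightarrow> real^'n \<Rightarrow> real" where
  "local_obj t \<omega> y = real t * (hobs t \<omega> (\<beta>s + (1 / sqrt (real t)) *\<^sub>R y) - hobs t \<omega> \<beta>s) + sqrt (real t) * (\<delta>s \<bullet> y)"

lemma score_measurable: "score \<in> borel_measurable P"
  unfolding score_def[abs_def] using DF_measurable_P[OF \<beta>s_pos] by measurable

lemma score_mean: "integral\<^sup>L P score = 0"
  unfolding score_def[abs_def] using DF_integrable[OF \<beta>s_pos] by (simp add: mean_DF)

lemma remainder_sum:
  assumes t: "0 < t"
  shows "(\<Sum>\<tau><t. f (X \<tau> \<omega>) (\<beta>s + (1 / sqrt (real t)) *\<^sub>R y) - f (X \<tau> \<omega>) \<beta>s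
      - DF (X \<tau> \<omega>) \<beta>s \<bullet> ((1 / sqrt (real t)) *\<^sub>R y)) = local_obj t \<omega> y - score_sum t \<omega> \<bullet> y"
proof -
  have s: "sqrt (real t) * sqrt (real t) = real t" "sqrt (real t) \<noteq> 0" using t by auto
  have "score_sum t \<omega> \<bullet> y = (1 / sqrt (real t)) * (\<Sum>\<tau><t. DF (X \<tau> \<omega>) \<beta>s \<bullet> y) + (real t / sqrt (real t)) * (\<delta>s \<bullet> y)"
    unfolding normalized_sum_def score_def by (simp add: inner_sum_left inner_add_left sum.distrib add_divide_distrib sum_constant_scaleR del: sum_constant)
  also have "real t / sqrt (real t) = sqrt (real t)" using s by (simp add: field_simps)
  finally show ?thesis
    unfolding local_obj_def hobs_def emp_mean_real using t
    by (simp add: sum_subtractf sum_divide_distrib[symmetric] diff_divide_distrib[symmetric])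
qed

text \<open>
  The difference of \<open>local_obj\<close> and its linear part is a sum of \<open>t\<close> independent remainders of the
  subgradient inequality.  The sum of their means converges to \<open>qform Hess y\<close>, by the second-order
  expansion of \<open>h\<close>.  Each remainder lies between \<open>0\<close> and a bound of order \<open>1 / \<surd>t\<close>, so its second
  moment is at most this bound times its mean, which is of order \<open>1 / t\<close>; hence the variance of the
  sum vanishes.
\<close>

lemma local_obj_expansion:
  assumes e: "0 < e"
  shows "whp M (\<lambda>t \<omega>. \<bar>local_obj t \<omega> y - (score_sum t \<omega> \<bullet> y + qform Hess y)\<bar> \<le> e)"
proof -
  obtain l u r C where box: "0 < l" "0 < r" "0 \<le> C" "\<And>y. norm (y - \<beta>s) \<le> r \<Longrightarrow> y \<in> box_lu l u"
    and C: "\<forall>\<theta>\<in>space D. \<forall>\<beta>\<in>box_lu l u. norm (DF \<theta> \<beta>) \<le> C"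
    using near_box[OF \<beta>s_pos] by blast
  have \<beta>s_box: "\<beta>s \<in> box_lu l u" using box(2) by (intro box(4)) simp
  define \<beta>t where "\<beta>t t = \<beta>s + (1 / sqrt (real t)) *\<^sub>R y" for t :: nat
  define \<rho> where "\<rho> t \<theta> = f \<theta> (\<beta>t t) - f \<theta> \<beta>s - DF \<theta> \<beta>s \<bullet> ((1 / sqrt (real t)) *\<^sub>R y)" for t \<theta>
  define K where "K t = 2 * (C * (norm y * (1 / sqrt (real t))))" for t :: nat
  define \<mu> where "\<mu> t = h (\<beta>t t) - h \<beta>s + (1 / sqrt (real t)) * (\<delta>s \<bullet> y)" for t
  have K0: "K \<longlonglongrightarrow> 0"
  proof -
    have "(\<lambda>t. 2 * (C * (norm y * (1 / sqrt (real t))))) \<longlonglongrightarrow> 2 * (C * (norm y * 0))"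
      by (intro tendsto_mult tendsto_const inverse_sqrt_tendsto_0)
    then show ?thesis unfolding K_def by simp
  qed
  have t\<mu>: "(\<lambda>t. real t * \<mu> t) \<longlonglongrightarrow> qform Hess y"
  proof -
    have lim: "(\<lambda>t. (h (\<beta>s + (1 / sqrt (real t)) *\<^sub>R y) - h \<beta>s + (1 / sqrt (real t)) * (\<delta>s \<bullet> y)) / (1 / sqrt (real t))\<^sup>2)
        \<longlonglongrightarrow> qform Hess y"
      by (rule filterlim_compose[OF h_second_order inverse_sqrt_at_right])
    moreover have "\<forall>\<^sub>F t in sequentially. (h (\<beta>s + (1 / sqrt (real t)) *\<^sub>R y) - h \<beta>s + (1 / sqrt (real t)) * (\<delta>s \<bullet> y)) / (1 / sqrt (real t))\<^sup>2
        = real t * \<mu> t"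
      using eventually_gt_at_top[of 0] by eventually_elim (simp add: \<mu>_def \<beta>t_def power_divide mult.commute)
    ultimately show ?thesis by (rule Lim_transform_eventually)
  qed
  have ev: "\<forall>\<^sub>F t in sequentially. norm y * (1 / sqrt (real t)) < r"
  proof -
    have "(\<lambda>t. norm y * (1 / sqrt (real t))) \<longlonglongrightarrow> norm y * 0"
      by (intro tendsto_mult tendsto_const inverse_sqrt_tendsto_0)
    then show ?thesis using box(2) by (intro order_tendstoD(2)) auto
  qed
  have facts: "\<rho> t \<in> borel_measurable P" "integral\<^sup>L P (\<rho> t) = \<mu> t" "\<And>\<theta>. \<theta> \<in> space P \<Longrightarrow> 0 \<le> \<rho> t \<theta> \<and> \<rho> t \<theta> \<le> K t"
    if t: "norm y * (1 / sqrt (real t)) < r" for t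
  proof -
    have \<beta>t_box: "\<beta>t t \<in> box_lu l u" using t by (intro box(4)) (simp add: \<beta>t_def)
    then have \<beta>t_pos: "\<beta>t t \<in> pos_orthant" using box_lu_pos[OF box(1)] by blast
    show "\<rho> t \<in> borel_measurable P"
      unfolding \<rho>_def[abs_def] using DF_measurable_P[OF \<beta>s_pos] by measurable
    show "integral\<^sup>L P (\<rho> t) = \<mu> t"
      unfolding \<rho>_def[abs_def] \<mu>_def h_def
      using f_integrable[OF \<beta>t_pos] f_integrable[OF \<beta>s_pos] DF_integrable[OF \<beta>s_pos]
      by (simp add: mean_DF)
    fix \<theta> assume "\<theta> \<in> space P"
    then have \<theta>: "\<theta> \<in> space D" by simp
    have n: "norm (\<beta>t t - \<beta>s) = norm y * (1 / sqrt (real t))" by (simp add: \<beta>t_def)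
    have "0 \<le> \<rho> t \<theta>" using subgradient[OF \<theta> \<beta>s_pos \<beta>t_pos] unfolding \<rho>_def by (simp add: \<beta>t_def)
    moreover have "\<bar>f \<theta> (\<beta>t t) - f \<theta> \<beta>s\<bar> \<le> C * (norm y * (1 / sqrt (real t)))"
      using f_Lipschitz[OF C box(1) \<theta> \<beta>t_box \<beta>s_box] unfolding n .
    moreover have "\<bar>DF \<theta> \<beta>s \<bullet> ((1 / sqrt (real t)) *\<^sub>R y)\<bar> \<le> C * (norm y * (1 / sqrt (real t)))"
    proof -
      have "\<bar>DF \<theta> \<beta>s \<bullet> ((1 / sqrt (real t)) *\<^sub>R y)\<bar> \<le> norm (DF \<theta> \<beta>s) * norm ((1 / sqrt (real t)) *\<^sub>R y)"
        by (rule Cauchy_Schwarz_ineq2)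
      also have "\<dots> \<le> C * norm ((1 / sqrt (real t)) *\<^sub>R y)" using C \<theta> \<beta>s_box by (intro mult_right_mono) auto
      finally show ?thesis by simp
    qed
    ultimately show "0 \<le> \<rho> t \<theta> \<and> \<rho> t \<theta> \<le> K t" unfolding K_def \<rho>_def by linarith
  qed
  let ?B = "\<lambda>t. {\<omega> \<in> space M. e / 2 \<le> \<bar>(\<Sum>\<tau><t. \<rho> t (X \<tau> \<omega>)) - real t * integral\<^sup>L P (\<rho> t)\<bar>}"
  show ?thesis
  proof (rule whp_by_bound)
    show "\<forall>\<^sub>F t in sequentially. ?B t \<in> events \<and> prob (?B t) \<le> K t * (real t * \<mu> t) / (e / 2)\<^sup>2"
      using ev
    proof eventually_elim
      case (elim t)
      note F = facts[OF elim]
      have [measurable]: "\<rho> t \<in> borel_measurable P" by (rule F)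
      have bd: "\<bar>\<rho> t \<theta>\<bar> \<le> K t" if "\<theta> \<in> space P" for \<theta> using F(3)[OF that] by simp
      have "prob (?B t) \<le> real t * (\<integral>\<theta>. (\<rho> t \<theta>)\<^sup>2 \<partial>P) / (e / 2)\<^sup>2"
        by (rule sum_deviation[OF F(1) bd]) (use e in auto)
      also have "(\<integral>\<theta>. (\<rho> t \<theta>)\<^sup>2 \<partial>P) \<le> (\<integral>\<theta>. K t * \<rho> t \<theta> \<partial>P)"
      proof (rule integral_mono)
        show "integrable P (\<lambda>\<theta>. (\<rho> t \<theta>)\<^sup>2)"
          by (rule P.integrable_const_bound[of _ "(K t)\<^sup>2"]) (use bd norm_square_le in \<open>auto intro!: AE_I2\<close>)
        show "integrable P (\<lambda>\<theta>. K t * \<rho> t \<theta>)"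
          using bounded_integrable[OF F(1) bd] by simp
        show "(\<rho> t \<theta>)\<^sup>2 \<le> K t * \<rho> t \<theta>" if "\<theta> \<in> space P" for \<theta>
          using F(3)[OF that] unfolding power2_eq_square by (intro mult_right_mono) auto
      qed
      also have "\<dots> = K t * \<mu> t" using F(2) by simp
      finally have "prob (?B t) \<le> real t * (K t * \<mu> t) / (e / 2)\<^sup>2"
        by (simp add: divide_right_mono mult_left_mono)
      then show ?case by (simp add: mult_ac)
    qed
    have "(\<lambda>t. K t * (real t * \<mu> t) / (e / 2)\<^sup>2) \<longlonglongrightarrow> 0 * qform Hess y / (e / 2)\<^sup>2"
      using e by (intro tendsto_divide tendsto_mult K0 t\<mu> tendsto_const) auto
    then show "(\<lambda>t. K t * (real t * \<mu> t) / (e / 2)\<^sup>2) \<longlonglongrightarrow> 0" by simp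
    have "\<forall>\<^sub>F t in sequentially. dist (real t * \<mu> t) (qform Hess y) < e / 2"
      using t\<mu> e by (intro tendstoD) auto
    then show "\<forall>\<^sub>F t in sequentially. \<forall>\<omega>\<in>space M - ?B t.
        \<bar>local_obj t \<omega> y - (score_sum t \<omega> \<bullet> y + qform Hess y)\<bar> \<le> e"
      using ev eventually_gt_at_top[of 0]
    proof eventually_elim
      case (elim t)
      show ?case
      proof
        fix \<omega> assume "\<omega> \<in> space M - ?B t"
        then have "\<bar>(\<Sum>\<tau><t. \<rho> t (X \<tau> \<omega>)) - real t * \<mu> t\<bar> < e / 2"
          using facts(2)[OF elim(2)] by auto
        moreover have "(\<Sum>\<tau><t. \<rho> t (X \<tau> \<omega>)) = local_obj t \<omega> y - score_sum t \<omega> \<bullet> y"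
          unfolding \<rho>_def \<beta>t_def by (rule remainder_sum[OF elim(3)])
        moreover have "\<bar>real t * \<mu> t - qform Hess y\<bar> < e / 2" using elim(1) by (simp add: dist_real_def)
        ultimately show "\<bar>local_obj t \<omega> y - (score_sum t \<omega> \<bullet> y + qform Hess y)\<bar> \<le> e" by linarith
      qed
    qed
  qed
qed

lemma hobs_subgradient:
  assumes \<omega>: "\<omega> \<in> space M" and \<beta>: "\<beta> \<in> pos_orthant" "\<beta>' \<in> pos_orthant"
  shows "hobs t \<omega> \<beta> + emp_mean t (sample \<omega>) (\<lambda>\<theta>. DF \<theta> \<beta>) \<bullet> (\<beta>' - \<beta>) \<le> hobs t \<omega> \<beta>'"
  unfolding hobs_def emp_mean_inner[symmetric] emp_mean_add[symmetric]
  by (rule emp_mean_mono) (rule subgradient[OF X_D[OF \<omega>] \<beta>])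

lemma local_obj_subgradient:
  assumes \<omega>: "\<omega> \<in> space M" and t: "0 < t"
    and y: "\<beta>s + (1 / sqrt (real t)) *\<^sub>R y \<in> pos_orthant"
  shows "\<exists>g. \<forall>y'. \<beta>s + (1 / sqrt (real t)) *\<^sub>R y' \<in> pos_orthant \<longrightarrow>
     local_obj t \<omega> y + g \<bullet> (y' - y) \<le> local_obj t \<omega> y'"
proof (intro exI allI impI)
  define g where "g = emp_mean t (sample \<omega>) (\<lambda>\<theta>. DF \<theta> (\<beta>s + (1 / sqrt (real t)) *\<^sub>R y))"
  fix y' assume y': "\<beta>s + (1 / sqrt (real t)) *\<^sub>R y' \<in> pos_orthant"
  have "hobs t \<omega> (\<beta>s + (1 / sqrt (real t)) *\<^sub>R y) + g \<bullet> ((\<beta>s + (1 / sqrt (real t)) *\<^sub>R y') - (\<beta>s + (1 / sqrt (real t)) *\<^sub>R y))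
     \<le> hobs t \<omega> (\<beta>s + (1 / sqrt (real t)) *\<^sub>R y')"
    unfolding g_def by (rule hobs_subgradient[OF \<omega> y y'])
  moreover have "g \<bullet> ((\<beta>s + (1 / sqrt (real t)) *\<^sub>R y') - (\<beta>s + (1 / sqrt (real t)) *\<^sub>R y)) = (1 / sqrt (real t)) * (g \<bullet> (y' - y))"
    by (simp add: inner_diff_right diff_divide_distrib)
  ultimately have "real t * (hobs t \<omega> (\<beta>s + (1 / sqrt (real t)) *\<^sub>R y) + (1 / sqrt (real t)) * (g \<bullet> (y' - y)))
     \<le> real t * hobs t \<omega> (\<beta>s + (1 / sqrt (real t)) *\<^sub>R y')"
    by (intro mult_left_mono) auto
  moreover have "real t * ((1 / sqrt (real t)) * (g \<bullet> (y' - y))) = sqrt (real t) * (g \<bullet> (y' - y))"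
    using t by (simp add: real_div_sqrt flip: times_divide_eq_left)
  ultimately show "local_obj t \<omega> y + (sqrt (real t) *\<^sub>R (g + \<delta>s)) \<bullet> (y' - y) \<le> local_obj t \<omega> y'"
    unfolding local_obj_def by (simp add: algebra_simps inner_diff_right inner_add_left)
qed

text \<open>
  On the event \<open>qform A (score_sum t \<omega>) < m\<close> the minimizer \<open>- A *v score_sum t \<omega>\<close> of the approximating
  quadratic lies in a fixed ball, so that one finite net serves all such outcomes.
\<close>

lemma T_obs_upper_bound:
  assumes A: "psd A" "\<And>g. Hess *v (A *v g) = g" and e: "0 < e" and k: "0 < k"
  shows "whp M (\<lambda>t \<omega>. qform A (score_sum t \<omega>) < m \<longrightarrow> Tobs k t \<omega> \<le> ereal (m + e))"
proof -
  obtain l where l: "0 < l" "\<And>x. l * (norm x)\<^sup>2 \<le> qform Hess x"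
    using positive_definite_coercive[OF pos_def] by auto
  define R where "R = sqrt (max 0 m / l)"
  have R0: "0 \<le> R" using l(1) by (simp add: R_def)
  obtain N e' R' where N: "finite N" "0 < e'"
    and main: "\<And>S hs (Q :: real^'n \<Rightarrow> real) Dom h. Hess *v hs = - S \<Longrightarrow> norm hs \<le> R \<Longrightarrow> cball 0 R' \<subseteq> Dom \<Longrightarrow>
      (\<forall>h\<in>Dom. \<exists>g. \<forall>h'\<in>Dom. Q h + g \<bullet> (h' - h) \<le> Q h') \<Longrightarrow>
      (\<forall>k\<in>N. \<bar>Q k - (S \<bullet> k + qform Hess k)\<bar> \<le> e') \<Longrightarrow> h \<in> Dom \<Longrightarrow> - qform Hess hs - e \<le> Q h"
    by (rule convex_near_quadratic[OF pos_def e R0]) (rule that; assumption)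
  obtain a u r where box: "0 < a" "0 < r" "\<And>y. norm (y - \<beta>s) \<le> r \<Longrightarrow> y \<in> box_lu a u"
    using near_box[OF \<beta>s_pos] by blast
  have ev: "\<forall>\<^sub>F t in sequentially. \<bar>R'\<bar> * (1 / sqrt (real t)) < r"
  proof -
    have "(\<lambda>t. \<bar>R'\<bar> * (1 / sqrt (real t))) \<longlonglongrightarrow> \<bar>R'\<bar> * 0"
      by (intro tendsto_mult tendsto_const inverse_sqrt_tendsto_0)
    then show ?thesis using box(2) by (intro order_tendstoD(2)) auto
  qed
  have near: "whp M (\<lambda>t \<omega>. \<forall>y\<in>N. \<bar>local_obj t \<omega> y - (score_sum t \<omega> \<bullet> y + qform Hess y)\<bar> \<le> e')"
    by (rule whp_ball_finite[OF N(1) local_obj_expansion[OF N(2)]])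
  show ?thesis
  proof (rule whp_mono_eventually[OF near ev], rule impI)
    fix t \<omega> assume tr: "\<bar>R'\<bar> * (1 / sqrt (real t)) < r" and t: "0 < t" and \<omega>: "\<omega> \<in> space M"
      and close: "\<forall>y\<in>N. \<bar>local_obj t \<omega> y - (score_sum t \<omega> \<bullet> y + qform Hess y)\<bar> \<le> e'"
      and qm: "qform A (score_sum t \<omega>) < m"
      define Dom where "Dom = {y. \<beta>s + (1 / sqrt (real t)) *\<^sub>R y \<in> pos_orthant}"
      define hs where "hs = - (A *v score_sum t \<omega>)"
      have Hhs: "Hess *v hs = - score_sum t \<omega>" unfolding hs_def linear_neg[OF matrix_vector_mul_linear] by (simp add: A(2))
      have qhs: "qform Hess hs = qform A (score_sum t \<omega>)"
        unfolding qform_def Hhs unfolding hs_def by (simp add: inner_commute)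
      have "norm hs \<le> R"
      proof -
        have "l * (norm hs)\<^sup>2 \<le> m" using l(2)[of hs] qhs qm by linarith
        then have "(norm hs)\<^sup>2 \<le> max 0 m / l" using l(1) by (simp add: field_simps)
        then show ?thesis unfolding R_def by (rule real_le_rsqrt)
      qed
      moreover have "cball 0 R' \<subseteq> Dom"
      proof
        fix y :: "real^'n" assume "y \<in> cball 0 R'"
        then have "norm y \<le> \<bar>R'\<bar>" by simp
        then have "norm y * (1 / sqrt (real t)) \<le> \<bar>R'\<bar> * (1 / sqrt (real t))" by (intro mult_right_mono) auto
        then have "\<beta>s + (1 / sqrt (real t)) *\<^sub>R y \<in> box_lu a u" using tr by (intro box(3)) simp
        then show "y \<in> Dom" using box_lu_pos[OF box(1)] unfolding Dom_def by blast
      qed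
      moreover have "\<forall>y\<in>Dom. \<exists>g. \<forall>y'\<in>Dom. local_obj t \<omega> y + g \<bullet> (y' - y) \<le> local_obj t \<omega> y'"
        using local_obj_subgradient[OF \<omega> t] unfolding Dom_def by simp
      ultimately have low: "- qform Hess hs - e \<le> local_obj t \<omega> y" if "y \<in> Dom" for y
        using main[of hs "score_sum t \<omega>" Dom "local_obj t \<omega>" y] Hhs close that by blast
      show "Tobs k t \<omega> \<le> ereal (m + e)"
        unfolding T_obs_eq[OF t k]
      proof (subst ereal_uminus_le_reorder, rule INF_greatest)
        fix \<beta> assume "\<beta> \<in> {\<beta>s + (1 / sqrt (real t)) *\<^sub>R y |y. ereal (norm y) \<le> k} \<inter> pos_orthant"
        then obtain y where y: "\<beta> = \<beta>s + (1 / sqrt (real t)) *\<^sub>R y" "y \<in> Dom" unfolding Dom_def by auto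
        have s: "real t * ((1 / sqrt (real t)) * x) = sqrt (real t) * x" for x
          by (simp add: real_div_sqrt flip: times_divide_eq_left)
        have "\<delta>s \<bullet> (\<beta> - \<beta>s) = (1 / sqrt (real t)) * (\<delta>s \<bullet> y)" by (simp add: y(1))
        then have "real t * (hobs t \<omega> \<beta> - hobs t \<omega> \<beta>s + \<delta>s \<bullet> (\<beta> - \<beta>s)) = local_obj t \<omega> y"
          by (simp only: local_obj_def y(1)[symmetric] distrib_left s)
        then show "- ereal (m + e) \<le> ereal (real t * (hobs t \<omega> \<beta> - hobs t \<omega> \<beta>s + \<delta>s \<bullet> (\<beta> - \<beta>s)))"
          using low[OF y(2)] qhs qm by simp
      qed
  qed
qed

end

section \<open>Consistency of the observed multiplier and of the bootstrap covariance\<close>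

context fppe begin

text \<open>
  The part of the sphere below \<open>1\<close> is compact, so \<open>h\<close> attains a minimum on it, and by strict convexity
  a feasible point other than \<open>\<beta>s\<close> is not a minimizer.
\<close>

lemma h_gap_on_sphere:
  assumes r: "0 < r" "\<And>y. norm (y - \<beta>s) \<le> r \<Longrightarrow> y \<in> pos_orthant"
  shows "\<exists>g>0. \<forall>\<beta>. \<beta> \<le> 1 \<longrightarrow> norm (\<beta> - \<beta>s) = r \<longrightarrow> h \<beta>s + g \<le> h \<beta>"
proof (cases "{\<beta>. \<beta> \<le> 1} \<inter> sphere \<beta>s r = {}")
  case True
  then show ?thesis by (intro exI[of _ 1]) (auto simp: dist_norm norm_minus_commute)
next
  case False
  have pos: "\<beta> \<in> pos_orthant" if "\<beta> \<in> sphere \<beta>s r" for \<beta>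
    using that by (intro r(2)) (simp add: dist_norm norm_minus_commute)
  have "closed {\<beta> :: real^'n. \<beta> \<le> 1}"
    unfolding less_eq_vec_def by (intro closed_Collect_all closed_Collect_le continuous_intros)
  then have "compact ({\<beta>. \<beta> \<le> 1} \<inter> sphere \<beta>s r)" by (intro closed_Int_compact compact_sphere)
  moreover have "continuous_on ({\<beta>. \<beta> \<le> 1} \<inter> sphere \<beta>s r) h"
    by (rule continuous_on_subset[OF h_continuous]) (use pos in auto)
  ultimately obtain z where z: "z \<le> 1" "z \<in> sphere \<beta>s r"
    "\<And>\<beta>. \<beta> \<le> 1 \<Longrightarrow> \<beta> \<in> sphere \<beta>s r \<Longrightarrow> h z \<le> h \<beta>"
    using continuous_attains_inf[OF _ False, of h] by auto
  have zf: "feasible z" using z pos by simp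
  have ne: "z \<noteq> \<beta>s" using z(2) r(1) by auto
  have mid: "feasible ((1/2) *\<^sub>R (z + \<beta>s))" by (rule feasible_midpoint[OF zf beta_lim_minimizes(1)])
  have "h \<beta>s < h z"
  proof -
    have "0 < strict_gap z \<beta>s" using strict_gap_pos[OF _ \<beta>s_pos ne] zf by simp
    moreover have "h \<beta>s \<le> h ((1/2) *\<^sub>R (z + \<beta>s))" by (rule beta_lim_minimizes(2)[OF mid])
    moreover have "h ((1/2) *\<^sub>R (z + \<beta>s)) \<le> (h z + h \<beta>s) / 2 - strict_gap z \<beta>s"
      by (rule h_midpoint) (use zf \<beta>s_pos mid in simp_all)
    ultimately show ?thesis by argo
  qed
  then show ?thesis using z(3)
    by (intro exI[of _ "h z - h \<beta>s"]) (auto simp: dist_norm norm_minus_commute)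
qed

text \<open>
  On a small sphere around \<open>\<beta>s\<close> the limit objective exceeds its minimum by a fixed gap.  The law of
  large numbers at finitely many points and a common Lipschitz constant carry the gap over to the
  sample objective, and by convexity its minimizer cannot lie beyond the sphere.
\<close>

lemma bobs_consistent:
  assumes r0: "0 < r0"
  shows "whp M (\<lambda>t \<omega>. norm (bobs t \<omega> - \<beta>s) \<le> r0)"
proof -
  obtain a u r C where box: "0 < a" "0 < r" "0 \<le> C" "\<And>y. norm (y - \<beta>s) \<le> r \<Longrightarrow> y \<in> box_lu a u"
    and C: "\<forall>\<theta>\<in>space D. \<forall>\<beta>\<in>box_lu a u. norm (DF \<theta> \<beta>) \<le> C"
    using near_box[OF \<beta>s_pos] by blast
  define r1 where "r1 = min r0 r"
  have r1: "0 < r1" "r1 \<le> r0" "r1 \<le> r" using r0 box by (auto simp: r1_def)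
  have in_box: "y \<in> box_lu a u" if "norm (y - \<beta>s) \<le> r1" for y using that r1 by (intro box(4)) simp
  have in_pos: "y \<in> pos_orthant" if "norm (y - \<beta>s) \<le> r1" for y
    using in_box[OF that] box_lu_pos[OF box(1)] by blast
  obtain g where g: "0 < g" "\<And>\<beta>. \<beta> \<le> 1 \<Longrightarrow> norm (\<beta> - \<beta>s) = r1 \<Longrightarrow> h \<beta>s + g \<le> h \<beta>"
    using h_gap_on_sphere[OF r1(1) in_pos] by blast
  \<comment> \<open>Both objectives have Lipschitz constant \<open>C\<close>, so a net of this mesh costs at most \<open>g / 8\<close>.\<close>
  define \<rho> where "\<rho> = (g / 16) / (C + 1)"
  have \<rho>: "0 < \<rho>" using g box by (simp add: \<rho>_def)
  have C\<rho>: "C * \<rho> \<le> g / 16"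
  proof -
    have "C * \<rho> \<le> (C + 1) * \<rho>" using \<rho> by (intro mult_right_mono) auto
    also have "\<dots> = g / 16"
    proof -
      have "C + 1 \<noteq> 0" using box(3) by simp
      moreover have "c * (g / 16 / c) = g / 16" if "c \<noteq> 0" for c using that by simp
      ultimately show ?thesis unfolding \<rho>_def by blast
    qed
    finally show ?thesis .
  qed
  obtain N where N: "finite N" "N \<subseteq> cball \<beta>s r1" "cball \<beta>s r1 \<subseteq> (\<Union>k\<in>N. ball k \<rho>)"
    using seq_compact_imp_totally_bounded[of "cball \<beta>s r1"] compact_imp_seq_compact[OF compact_cball] \<rho> by blast
  have "whp M (\<lambda>t \<omega>. \<forall>k\<in>N. \<bar>hobs t \<omega> k - h k\<bar> < g / 8)"
  proof (rule whp_ball_finite[OF N(1)])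
    fix k assume "k \<in> N"
    then have k: "k \<in> box_lu a u" using N(2) by (intro in_box) (auto simp: dist_norm norm_minus_commute)
    obtain B where "\<forall>\<theta>\<in>space D. \<forall>\<beta>\<in>box_lu a u. \<bar>f \<theta> \<beta>\<bar> \<le> B" using f_bounded_on_box[OF box(1)] by blast
    then have "\<bar>f \<theta> k\<bar> \<le> B" if "\<theta> \<in> space P" for \<theta> using that k by simp
    then show "whp M (\<lambda>t \<omega>. \<bar>hobs t \<omega> k - h k\<bar> < g / 8)"
      unfolding hobs_def h_def using g(1) by (intro law_of_large_numbers[of _ B]) auto
  qed
  then show ?thesis
  proof (rule whp_mono_eventually[where R="\<lambda>_. True"])
    fix t \<omega> assume t: "0 < t" and \<omega>: "\<omega> \<in> space M" and close: "\<forall>k\<in>N. \<bar>hobs t \<omega> k - h k\<bar> < g / 8"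
    have unif: "\<bar>hobs t \<omega> \<beta> - h \<beta>\<bar> < g / 2" if \<beta>: "norm (\<beta> - \<beta>s) \<le> r1" for \<beta>
    proof -
      have "\<beta> \<in> cball \<beta>s r1" using \<beta> by (simp add: dist_norm norm_minus_commute)
      then obtain k where k: "k \<in> N" "dist k \<beta> < \<rho>" using N(3) by auto
      have kb: "k \<in> box_lu a u" using k(1) N(2) by (intro in_box) (auto simp: dist_norm norm_minus_commute)
      have n: "C * norm (\<beta> - k) \<le> g / 16"
      proof -
        have "C * norm (\<beta> - k) \<le> C * \<rho>" using k(2) box(3) by (intro mult_left_mono) (auto simp: dist_norm norm_minus_commute)
        then show ?thesis using C\<rho> by linarith
      qed
      have "\<bar>hobs t \<omega> \<beta> - hobs t \<omega> k\<bar> \<le> C * norm (\<beta> - k)"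
        by (rule hobs_Lipschitz[OF C box(1) in_box[OF \<beta>] kb \<omega> t])
      moreover have "\<bar>h \<beta> - h k\<bar> \<le> C * norm (\<beta> - k)"
        by (rule h_Lipschitz[OF C box(1) in_box[OF \<beta>] kb])
      moreover have "\<bar>hobs t \<omega> k - h k\<bar> < g / 8" using close k(1) by blast
      ultimately show ?thesis using n by linarith
    qed
    show "norm (bobs t \<omega> - \<beta>s) \<le> r0"
    proof (rule ccontr)
      assume "\<not> norm (bobs t \<omega> - \<beta>s) \<le> r0"
      define R where "R = norm (bobs t \<omega> - \<beta>s)"
      have R: "r1 < R" using \<open>\<not> norm (bobs t \<omega> - \<beta>s) \<le> r0\<close> r1 by (simp add: R_def)
      note bm = bobs_minimizes[OF \<omega> t]
      define c where "c = r1 / R"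
      have c: "0 < c" "c < 1" using R r1 by (auto simp: c_def)
      define z where "z = \<beta>s + c *\<^sub>R (bobs t \<omega> - \<beta>s)"
      have nz: "norm (z - \<beta>s) = r1" using R r1 by (simp add: z_def c_def R_def[symmetric])
      have "z $ i \<le> 1" for i
      proof -
        have "z $ i = (1 - c) * \<beta>s $ i + c * bobs t \<omega> $ i" by (simp add: z_def algebra_simps)
        also have "\<dots> \<le> (1 - c) * 1 + c * 1"
          using c bm(1) beta_lim_minimizes(1) by (intro add_mono mult_left_mono) (auto simp: less_eq_vec_def)
        finally show ?thesis by simp
      qed
      then have z1: "z \<le> 1" by (simp add: less_eq_vec_def)
      have zpos: "z \<in> pos_orthant" using in_pos[of z] nz by simp
      have zs: "hobs t \<omega> \<beta>s < hobs t \<omega> z"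
      proof -
        have "\<bar>hobs t \<omega> z - h z\<bar> < g / 2" by (rule unif) (use nz in simp)
        moreover have "\<bar>hobs t \<omega> \<beta>s - h \<beta>s\<bar> < g / 2" by (rule unif) (use r1(1) in simp)
        ultimately show ?thesis using g(2)[OF z1 nz] by linarith
      qed
      define G where "G = emp_mean t (sample \<omega>) (\<lambda>\<theta>. DF \<theta> z)"
      have "hobs t \<omega> z + G \<bullet> (\<beta>s - z) \<le> hobs t \<omega> \<beta>s"
        unfolding G_def by (rule hobs_subgradient[OF \<omega> zpos \<beta>s_pos])
      moreover have "\<beta>s - z = - (c *\<^sub>R (bobs t \<omega> - \<beta>s))" by (simp add: z_def)
      ultimately have "0 < c * (G \<bullet> (bobs t \<omega> - \<beta>s))" using zs by simp
      then have Gp: "0 < G \<bullet> (bobs t \<omega> - \<beta>s)" using c(1) by (simp add: zero_less_mult_iff)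
      have "hobs t \<omega> z + G \<bullet> (bobs t \<omega> - z) \<le> hobs t \<omega> (bobs t \<omega>)"
        unfolding G_def by (rule hobs_subgradient[OF \<omega> zpos]) (use bm(1) in simp)
      moreover have "bobs t \<omega> - z = (1 - c) *\<^sub>R (bobs t \<omega> - \<beta>s)" by (simp add: z_def algebra_simps)
      ultimately have "hobs t \<omega> z + (1 - c) * (G \<bullet> (bobs t \<omega> - \<beta>s)) \<le> hobs t \<omega> (bobs t \<omega>)" by simp
      moreover have "0 < (1 - c) * (G \<bullet> (bobs t \<omega> - \<beta>s))" using c Gp by simp
      moreover have "hobs t \<omega> (bobs t \<omega>) \<le> hobs t \<omega> \<beta>s" by (rule bm(2)[OF beta_lim_minimizes(1)])
      ultimately show False using zs by linarith
    qed
  qed simp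
qed

text \<open>
  The second difference quotient of \<open>F\<close> in direction \<open>i\<close> at \<open>\<beta>s\<close>: it bounds the jump of the
  subgradient there.
\<close>

definition kink :: "real \<Rightarrow> 'n \<Rightarrow> 'a \<Rightarrow> real" where
  "kink r i \<theta> = (f \<theta> (\<beta>s + r *\<^sub>R axis i 1) - f \<theta> \<beta>s) / r + (f \<theta> (\<beta>s - r *\<^sub>R axis i 1) - f \<theta> \<beta>s) / r"

text \<open>
  This is where differentiability of the mean objective at \<open>\<beta>s\<close> is used: its two one-sided
  derivatives cancel.
\<close>

lemma kink_mean_small:
  assumes e: "0 < e" and r0: "0 < r0"
  shows "\<exists>r. 0 < r \<and> r < r0 \<and> (\<forall>i. integral\<^sup>L P (kink r i) < e)"
proof -
  have "\<forall>\<^sub>F r in at_right 0. integral\<^sup>L P (kink r i) < e" for i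
  proof -
    have lim: "((\<lambda>r. (h (\<beta>s + r *\<^sub>R axis i 1) - h \<beta>s) / r + (h (\<beta>s + r *\<^sub>R (- axis i 1)) - h \<beta>s) / r) \<longlongrightarrow>
       - (\<delta>s \<bullet> axis i 1) + - (\<delta>s \<bullet> (- axis i 1))) (at_right 0)"
      by (intro tendsto_add h_directional_derivative)
    then have "\<forall>\<^sub>F r in at_right 0. (h (\<beta>s + r *\<^sub>R axis i 1) - h \<beta>s) / r + (h (\<beta>s + r *\<^sub>R (- axis i 1)) - h \<beta>s) / r < e"
      using e by (intro order_tendstoD(2)[OF lim]) auto
    then show ?thesis using line_in_pos[OF \<beta>s_pos, of "axis i 1"] line_in_pos[OF \<beta>s_pos, of "- axis i 1"]
    proof eventually_elim
      case (elim r)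
      have "integral\<^sup>L P (kink r i) = (h (\<beta>s + r *\<^sub>R axis i 1) - h \<beta>s) / r + (h (\<beta>s + r *\<^sub>R (- axis i 1)) - h \<beta>s) / r"
        unfolding kink_def[abs_def] h_def
        using f_integrable[OF elim(2)] f_integrable[OF elim(3)] f_integrable[OF \<beta>s_pos] by simp
      then show ?case using elim(1) by simp
    qed
  qed
  then have "\<forall>\<^sub>F r in at_right 0. \<forall>i. integral\<^sup>L P (kink r i) < e" by (intro eventually_all_finite)
  moreover have "\<forall>\<^sub>F r in at_right 0. r < r0"
    using r0 by (auto simp: eventually_at_right_field intro!: exI[of _ r0])
  ultimately have "\<forall>\<^sub>F r in at_right 0. 0 < r \<and> r < r0 \<and> (\<forall>i. integral\<^sup>L P (kink r i) < e)"
    using eventually_at_right_less[of 0] by eventually_elim auto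
  then show ?thesis using eventually_happens'[OF trivial_limit_at_right_real] by blast
qed

text \<open>
  Both subgradients are enclosed by difference quotients with step \<open>r\<close>, and moving the base point of
  these quotients from \<open>\<beta>s\<close> to \<open>\<beta>\<close> costs the Lipschitz constant.  In this form the dependence on the
  random point \<open>\<beta>\<close> is separated from that on the item.
\<close>

lemma DF_increment:
  assumes C: "\<forall>\<theta>\<in>space D. \<forall>\<beta>\<in>box_lu a u. norm (DF \<theta> \<beta>) \<le> C"
    and a: "0 < a" and box: "\<And>y. norm (y - \<beta>s) \<le> 2 * r \<Longrightarrow> y \<in> box_lu a u"
    and r: "0 < r" and \<beta>: "norm (\<beta> - \<beta>s) \<le> r" and \<theta>: "\<theta> \<in> space D"
  shows "\<bar>DF \<theta> \<beta> $ i - DF \<theta> \<beta>s $ i\<bar> \<le> kink r i \<theta> + 2 * C * norm (\<beta> - \<beta>s) / r"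
proof -
  let ?e = "r *\<^sub>R axis i (1 :: real)"
  have ne: "norm ?e = r" using r by (simp add: norm_axis_1)
  have in_box: "\<beta>s \<in> box_lu a u" "\<beta>s + ?e \<in> box_lu a u" "\<beta>s - ?e \<in> box_lu a u"
    "\<beta> \<in> box_lu a u" "\<beta> + ?e \<in> box_lu a u" "\<beta> - ?e \<in> box_lu a u"
  proof -
    have "norm (\<beta> + ?e - \<beta>s) \<le> 2 * r" using norm_triangle_ineq[of "\<beta> - \<beta>s" ?e] ne \<beta> by (simp add: algebra_simps)
    then show "\<beta> + ?e \<in> box_lu a u" by (rule box)
    have "norm (\<beta> - ?e - \<beta>s) \<le> 2 * r" using norm_triangle_ineq4[of "\<beta> - \<beta>s" ?e] ne \<beta> by (simp add: algebra_simps)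
    then show "\<beta> - ?e \<in> box_lu a u" by (rule box)
  qed (use ne r \<beta> in \<open>auto intro!: box\<close>)
  note in_pos = in_box[THEN box_lu_pos[OF a, THEN subsetD]]
  have L: "\<bar>f \<theta> x - f \<theta> y\<bar> \<le> C * norm (x - y)" if "x \<in> box_lu a u" "y \<in> box_lu a u" for x y
    by (rule f_Lipschitz[OF C a \<theta> that])
  have L1: "\<bar>f \<theta> \<beta> - f \<theta> \<beta>s\<bar> \<le> C * norm (\<beta> - \<beta>s)" by (rule L[OF in_box(4,1)])
  have L2: "\<bar>f \<theta> (\<beta> + ?e) - f \<theta> (\<beta>s + ?e)\<bar> \<le> C * norm (\<beta> - \<beta>s)" using L[OF in_box(5,2)] by simp
  have L3: "\<bar>f \<theta> (\<beta> - ?e) - f \<theta> (\<beta>s - ?e)\<bar> \<le> C * norm (\<beta> - \<beta>s)" using L[OF in_box(6,3)] by simp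
  have g: "f \<theta> \<beta> + r * DF \<theta> \<beta> $ i \<le> f \<theta> (\<beta> + ?e)" "f \<theta> \<beta> - r * DF \<theta> \<beta> $ i \<le> f \<theta> (\<beta> - ?e)"
    using subgradient[OF \<theta> in_pos(4,5)] subgradient[OF \<theta> in_pos(4,6)] by (simp_all add: inner_axis)
  have gs: "f \<theta> \<beta>s + r * DF \<theta> \<beta>s $ i \<le> f \<theta> (\<beta>s + ?e)" "f \<theta> \<beta>s - r * DF \<theta> \<beta>s $ i \<le> f \<theta> (\<beta>s - ?e)"
    using subgradient[OF \<theta> in_pos(1,2)] subgradient[OF \<theta> in_pos(1,3)] by (simp_all add: inner_axis)
  have "\<bar>r * DF \<theta> \<beta> $ i - r * DF \<theta> \<beta>s $ i\<bar> \<le>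
    (f \<theta> (\<beta>s + ?e) - f \<theta> \<beta>s) + (f \<theta> (\<beta>s - ?e) - f \<theta> \<beta>s) + 2 * (C * norm (\<beta> - \<beta>s))"
    using L1 L2 L3 g gs by linarith
  also have "\<dots> = r * (kink r i \<theta> + 2 * C * norm (\<beta> - \<beta>s) / r)"
    using r unfolding kink_def by (simp add: field_simps)
  finally have "r * \<bar>DF \<theta> \<beta> $ i - DF \<theta> \<beta>s $ i\<bar> \<le> r * (kink r i \<theta> + 2 * C * norm (\<beta> - \<beta>s) / r)"
    using r by (simp add: right_diff_distrib[symmetric] abs_mult)
  then show ?thesis using r by simp
qed

lemma emp_mean_sum: "emp_mean t x (\<lambda>\<theta>. \<Sum>i\<in>I. g i \<theta>) = (\<Sum>i\<in>I. emp_mean t x (g i))"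
  unfolding emp_mean_def by (subst sum.swap) (simp add: scaleR_sum_right)

text \<open>
  The increment of the subgradient is bounded by the kinks, whose averages obey the law of large
  numbers and have small means for a small step \<open>r\<close>, and by the distance of \<open>bobs t \<omega>\<close> from \<open>\<beta>s\<close>, which
  may be made small once \<open>r\<close> is chosen.
\<close>

lemma DF_bobs_close:
  assumes e: "0 < e"
  shows "whp M (\<lambda>t \<omega>. emp_mean t (sample \<omega>) (\<lambda>\<theta>. norm (DF \<theta> (bobs t \<omega>) - DF \<theta> \<beta>s)) \<le> e)"
proof -
  obtain a u r0 C where box: "0 < a" "0 < r0" "0 \<le> C" "\<And>y. norm (y - \<beta>s) \<le> r0 \<Longrightarrow> y \<in> box_lu a u"
    and C: "\<forall>\<theta>\<in>space D. \<forall>\<beta>\<in>box_lu a u. norm (DF \<theta> \<beta>) \<le> C"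
    using near_box[OF \<beta>s_pos] by blast
  define n where "n = real CARD('n)"
  have n: "0 < n" by (simp add: n_def)
  obtain r where r: "0 < r" "r < r0 / 2" "\<And>i. integral\<^sup>L P (kink r i) < e / (4 * n)"
    using kink_mean_small[of "e / (4 * n)" "r0 / 2"] e n box(2) by auto
  have box2: "y \<in> box_lu a u" if "norm (y - \<beta>s) \<le> 2 * r" for y using that r(2) by (intro box(4)) simp
  \<comment> \<open>The step \<open>r\<close> is fixed first; the distance of the two points is small compared with it.\<close>
  define q where "q = min r (e * r / (4 * n * (C + 1)))"
  have q: "0 < q" "q \<le> r" "q \<le> e * r / (4 * n * (C + 1))" using r e n box(3) by (auto simp: q_def)
  have w1: "whp M (\<lambda>t \<omega>. norm (bobs t \<omega> - \<beta>s) \<le> q)" by (rule bobs_consistent[OF q(1)])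
  have w2: "whp M (\<lambda>t \<omega>. \<forall>i\<in>UNIV. \<bar>emp_mean t (sample \<omega>) (kink r i) - integral\<^sup>L P (kink r i)\<bar> < e / (4 * n))"
  proof (rule whp_ball_finite)
    fix i
    have pts: "\<beta>s + r *\<^sub>R axis i 1 \<in> box_lu a u" "\<beta>s - r *\<^sub>R axis i 1 \<in> box_lu a u" "\<beta>s \<in> box_lu a u"
      using r by (auto intro!: box2 simp: norm_axis_1)
    have [measurable]: "kink r i \<in> borel_measurable P" unfolding kink_def[abs_def] by measurable
    have bd: "\<bar>kink r i \<theta>\<bar> \<le> C + C" if "\<theta> \<in> space P" for \<theta>
    proof -
      have \<theta>: "\<theta> \<in> space D" using that by simp
      have "\<bar>f \<theta> (\<beta>s + r *\<^sub>R axis i 1) - f \<theta> \<beta>s\<bar> \<le> C * r" "\<bar>f \<theta> (\<beta>s - r *\<^sub>R axis i 1) - f \<theta> \<beta>s\<bar> \<le> C * r"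
        using f_Lipschitz[OF C box(1) \<theta> pts(1,3)] f_Lipschitz[OF C box(1) \<theta> pts(2,3)] r(1) by (simp_all add: norm_axis_1)
      then have "\<bar>(f \<theta> (\<beta>s + r *\<^sub>R axis i 1) - f \<theta> \<beta>s) / r\<bar> \<le> C" "\<bar>(f \<theta> (\<beta>s - r *\<^sub>R axis i 1) - f \<theta> \<beta>s) / r\<bar> \<le> C"
        using r(1) by (simp_all add: divide_le_eq)
      then show ?thesis unfolding kink_def by linarith
    qed
    show "whp M (\<lambda>t \<omega>. \<bar>emp_mean t (sample \<omega>) (kink r i) - integral\<^sup>L P (kink r i)\<bar> < e / (4 * n))"
      by (rule law_of_large_numbers[OF _ bd]) (use e n in auto)
  qed simp
  have C2: "n * (2 * C * q / r) \<le> e / 2"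
  proof -
    have "q / r \<le> e / (4 * n * (C + 1))" using q(3) r(1) by (simp add: field_simps)
    then have "n * (2 * C) * (q / r) \<le> n * (2 * (C + 1)) * (e / (4 * n * (C + 1)))"
      using n box(3) q r by (intro mult_mono) auto
    also have "\<dots> = e / 2"
    proof -
      have cancel: "n * (2 * c) * (e / (4 * n * c)) = e / 2" if "c \<noteq> 0" for c
        using that n by (simp add: field_simps)
      show ?thesis by (rule cancel) (use box(3) in simp)
    qed
    finally show ?thesis by simp
  qed
  show ?thesis
  proof (rule whp_mono_eventually[OF whp_conj[OF w1 w2], where R="\<lambda>_. True"], simp, elim conjE)
    fix t \<omega> assume t: "0 < t" and \<omega>: "\<omega> \<in> space M" and bq: "norm (bobs t \<omega> - \<beta>s) \<le> q"
      and close: "\<forall>i\<in>UNIV. \<bar>emp_mean t (sample \<omega>) (kink r i) - integral\<^sup>L P (kink r i)\<bar> < e / (4 * n)"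
    let ?E = "emp_mean t (sample \<omega>)"
    have "?E (\<lambda>\<theta>. norm (DF \<theta> (bobs t \<omega>) - DF \<theta> \<beta>s)) \<le> ?E (\<lambda>\<theta>. (\<Sum>i\<in>UNIV. kink r i \<theta>) + n * (2 * C * q / r))"
    proof (rule emp_mean_mono)
      fix \<tau>
      have "norm (DF (X \<tau> \<omega>) (bobs t \<omega>) - DF (X \<tau> \<omega>) \<beta>s) \<le> (\<Sum>i\<in>UNIV. \<bar>(DF (X \<tau> \<omega>) (bobs t \<omega>) - DF (X \<tau> \<omega>) \<beta>s) $ i\<bar>)"
        by (rule norm_le_l1_cart)
      also have "\<dots> \<le> (\<Sum>i\<in>UNIV. kink r i (X \<tau> \<omega>) + 2 * C * q / r)"
      proof (rule sum_mono)
        fix i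
        have "\<bar>(DF (X \<tau> \<omega>) (bobs t \<omega>) - DF (X \<tau> \<omega>) \<beta>s) $ i\<bar> \<le> kink r i (X \<tau> \<omega>) + 2 * C * norm (bobs t \<omega> - \<beta>s) / r"
          using DF_increment[OF C box(1) box2 r(1) _ X_D[OF \<omega>], of "bobs t \<omega>"] bq q(2) by simp
        also have "2 * C * norm (bobs t \<omega> - \<beta>s) / r \<le> 2 * C * q / r"
          using bq r(1) box(3) by (intro divide_right_mono mult_left_mono) auto
        finally show "\<bar>(DF (X \<tau> \<omega>) (bobs t \<omega>) - DF (X \<tau> \<omega>) \<beta>s) $ i\<bar> \<le> kink r i (X \<tau> \<omega>) + 2 * C * q / r" by simp
      qed
      also have "\<dots> = (\<Sum>i\<in>UNIV. kink r i (X \<tau> \<omega>)) + n * (2 * C * q / r)"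
        by (simp add: sum.distrib n_def)
      finally show "norm (DF (X \<tau> \<omega>) (bobs t \<omega>) - DF (X \<tau> \<omega>) \<beta>s) \<le> (\<Sum>i\<in>UNIV. kink r i (X \<tau> \<omega>)) + n * (2 * C * q / r)" .
    qed
    also have "\<dots> = (\<Sum>i\<in>UNIV. ?E (kink r i)) + n * (2 * C * q / r)"
      unfolding emp_mean_add emp_mean_const[OF t] emp_mean_sum ..
    also have "(\<Sum>i\<in>UNIV. ?E (kink r i)) \<le> (\<Sum>i\<in>(UNIV :: 'n set). e / (2 * n))"
    proof (rule sum_mono)
      fix i :: 'n
      have "e / (4 * n) + e / (4 * n) = e / (2 * n)" by simp
      then show "?E (kink r i) \<le> e / (2 * n)" using close r(3)[of i] by (smt (verit) UNIV_I)
    qed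
    also have "\<dots> = e / 2" using n by (simp add: n_def[symmetric])
    finally show "?E (\<lambda>\<theta>. norm (DF \<theta> (bobs t \<omega>) - DF \<theta> \<beta>s)) \<le> e" using C2 by linarith
  qed
qed

definition boot_score :: "nat \<Rightarrow> 'w \<Rightarrow> nat \<Rightarrow> real^'n" where
  "boot_score t \<omega> l = DF (X l \<omega>) (bobs t \<omega>) - emp_mean t (sample \<omega>) (\<lambda>\<theta>. DF \<theta> (bobs t \<omega>))"

lemma expectation_uniform:
  fixes g :: "nat \<Rightarrow> real"
  assumes "0 < t"
  shows "measure_pmf.expectation (pmf_of_set {..<t}) g = (\<Sum>l<t. g l) / real t"
  using integral_pmf_of_set[of "{..<t}" g] assms by (simp add: lessThan_empty_iff)

text \<open>
  The empirical second moments of the subgradients at the observed multiplier are close to those at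
  \<open>\<beta>s\<close> by \<open>DF_bobs_close\<close>, and the latter obey the law of large numbers.
\<close>

lemma boot_covariance:
  assumes d: "0 < d"
  shows "whp M (\<lambda>t \<omega>. \<forall>i j. \<bar>(\<integral>\<theta>. score \<theta> $ i * score \<theta> $ j \<partial>P) -
     measure_pmf.expectation (pmf_of_set {..<t}) (\<lambda>l. boot_score t \<omega> l $ i * boot_score t \<omega> l $ j)\<bar> \<le> d)"
proof -
  obtain a u r0 C where box: "0 < a" "0 < r0" "0 \<le> C" "\<And>y. norm (y - \<beta>s) \<le> r0 \<Longrightarrow> y \<in> box_lu a u"
    and C: "\<forall>\<theta>\<in>space D. \<forall>\<beta>\<in>box_lu a u. norm (DF \<theta> \<beta>) \<le> C"
    using near_box[OF \<beta>s_pos] by blast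
  \<comment> \<open>The errors add up to \<open>2 * C * \<eta> + \<eta> + 4 * C * \<eta>\<close>.\<close>
  define \<eta> where "\<eta> = d / (6 * C + 1)"
  have \<eta>: "0 < \<eta>" "(6 * C + 1) * \<eta> = d" using d box(3) by (auto simp: \<eta>_def)
  define c where "c \<theta> = DF \<theta> \<beta>s" for \<theta>
  have \<beta>s_box: "\<beta>s \<in> box_lu a u" using box(2) by (intro box(4)) simp
  have [measurable]: "c \<in> borel_measurable P" unfolding c_def[abs_def] by (rule DF_measurable_P[OF \<beta>s_pos])
  have ci: "\<bar>c \<theta> $ i\<bar> \<le> C" if "\<theta> \<in> space P" for \<theta> i
    using C that \<beta>s_box component_le_norm_cart[of "c \<theta>" i] unfolding c_def by force
  have cij: "\<bar>c \<theta> $ i * c \<theta> $ j\<bar> \<le> C * C" if "\<theta> \<in> space P" for \<theta> i j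
    using ci[OF that, of i] ci[OF that, of j] box(3) unfolding abs_mult by (intro mult_mono) auto
  have int_ci: "integrable P (\<lambda>\<theta>. c \<theta> $ i)" for i by (rule bounded_integrable[OF _ ci]) auto
  have int_cij: "integrable P (\<lambda>\<theta>. c \<theta> $ i * c \<theta> $ j)" for i j by (rule bounded_integrable[OF _ cij]) auto
  have Eci: "(\<integral>\<theta>. c \<theta> $ i \<partial>P) = - \<delta>s $ i" for i
  proof -
    have "(\<integral>\<theta>. c \<theta> \<bullet> axis i 1 \<partial>P) = integral\<^sup>L P c \<bullet> axis i 1"
      using DF_integrable[OF \<beta>s_pos] unfolding c_def[abs_def] by (rule integral_inner_left)
    then show ?thesis using mean_DF unfolding c_def[abs_def] by (simp add: inner_axis)
  qed
  have cov: "(\<integral>\<theta>. score \<theta> $ i * score \<theta> $ j \<partial>P) = (\<integral>\<theta>. c \<theta> $ i * c \<theta> $ j \<partial>P) - (- \<delta>s $ i) * (- \<delta>s $ j)" for i j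
  proof -
    have "(\<integral>\<theta>. score \<theta> $ i * score \<theta> $ j \<partial>P) =
      (\<integral>\<theta>. c \<theta> $ i * c \<theta> $ j + c \<theta> $ i * \<delta>s $ j + c \<theta> $ j * \<delta>s $ i + \<delta>s $ i * \<delta>s $ j \<partial>P)"
      unfolding score_def c_def by (rule Bochner_Integration.integral_cong) (simp_all add: algebra_simps)
    also have "\<dots> = (\<integral>\<theta>. c \<theta> $ i * c \<theta> $ j \<partial>P) + (\<integral>\<theta>. c \<theta> $ i \<partial>P) * \<delta>s $ j + (\<integral>\<theta>. c \<theta> $ j \<partial>P) * \<delta>s $ i + \<delta>s $ i * \<delta>s $ j"
      using int_cij[of i j] int_ci[of i] int_ci[of j] by simp
    finally show ?thesis unfolding Eci by simp
  qed
  have w1: "whp M (\<lambda>t \<omega>. norm (bobs t \<omega> - \<beta>s) \<le> r0)" by (rule bobs_consistent[OF box(2)])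
  have w2: "whp M (\<lambda>t \<omega>. emp_mean t (sample \<omega>) (\<lambda>\<theta>. norm (DF \<theta> (bobs t \<omega>) - DF \<theta> \<beta>s)) \<le> \<eta>)"
    by (rule DF_bobs_close[OF \<eta>(1)])
  have w3: "whp M (\<lambda>t \<omega>. \<forall>i\<in>UNIV. \<bar>emp_mean t (sample \<omega>) (\<lambda>\<theta>. c \<theta> $ i) - (\<integral>\<theta>. c \<theta> $ i \<partial>P)\<bar> < \<eta>)"
    by (rule whp_ball_finite) (auto intro!: law_of_large_numbers[OF _ ci] \<eta>(1))
  have w4: "whp M (\<lambda>t \<omega>. \<forall>(i, j)\<in>UNIV. \<bar>emp_mean t (sample \<omega>) (\<lambda>\<theta>. c \<theta> $ i * c \<theta> $ j) - (\<integral>\<theta>. c \<theta> $ i * c \<theta> $ j \<partial>P)\<bar> < \<eta>)"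
    unfolding split_beta by (rule whp_ball_finite) (auto intro!: law_of_large_numbers[OF _ cij] \<eta>(1))
  show ?thesis
  proof (rule whp_mono_eventually[OF whp_conj[OF whp_conj[OF w1 w2] whp_conj[OF w3 w4]], where R="\<lambda>_. True"],
      simp, intro allI, elim conjE)
    fix t :: nat and \<omega> and i j :: 'n
    assume t: "0 < t" and \<omega>: "\<omega> \<in> space M" and b1: "norm (bobs t \<omega> - \<beta>s) \<le> r0"
      and close: "emp_mean t (sample \<omega>) (\<lambda>\<theta>. norm (DF \<theta> (bobs t \<omega>) - DF \<theta> \<beta>s)) \<le> \<eta>"
      and lln1: "\<forall>i\<in>UNIV. \<bar>emp_mean t (sample \<omega>) (\<lambda>\<theta>. c \<theta> $ i) - (\<integral>\<theta>. c \<theta> $ i \<partial>P)\<bar> < \<eta>"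
      and lln2: "\<forall>(i, j)\<in>UNIV. \<bar>emp_mean t (sample \<omega>) (\<lambda>\<theta>. c \<theta> $ i * c \<theta> $ j) - (\<integral>\<theta>. c \<theta> $ i * c \<theta> $ j \<partial>P)\<bar> < \<eta>"
    let ?E = "emp_mean t (sample \<omega>) :: ('a \<Rightarrow> real) \<Rightarrow> real"
    define g where "g \<theta> = DF \<theta> (bobs t \<omega>)" for \<theta>
    define m where "m = emp_mean t (sample \<omega>) g"
    have XP: "X \<tau> \<omega> \<in> space P" for \<tau> using X_D[OF \<omega>] by simp
    have gi: "\<bar>g (X \<tau> \<omega>) $ i\<bar> \<le> C" for \<tau> i
      using C X_D[OF \<omega>, of \<tau>] box(4)[OF b1] component_le_norm_cart[of "g (X \<tau> \<omega>)" i] unfolding g_def by force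
    have m_i: "m $ i = ?E (\<lambda>\<theta>. g \<theta> $ i)" for i by (simp add: m_def emp_mean_def)
    have avg: "measure_pmf.expectation (pmf_of_set {..<t}) (\<lambda>l. boot_score t \<omega> l $ i * boot_score t \<omega> l $ j)
        = ?E (\<lambda>\<theta>. g \<theta> $ i * g \<theta> $ j) - m $ i * m $ j"
    proof -
      have "measure_pmf.expectation (pmf_of_set {..<t}) (\<lambda>l. boot_score t \<omega> l $ i * boot_score t \<omega> l $ j) =
        ?E (\<lambda>\<theta>. (g \<theta> $ i - m $ i) * (g \<theta> $ j - m $ j))"
        unfolding expectation_uniform[OF t] emp_mean_real boot_score_def m_def g_def by simp
      also have "(\<lambda>\<theta>. (g \<theta> $ i - m $ i) * (g \<theta> $ j - m $ j)) =
        (\<lambda>\<theta>. g \<theta> $ i * g \<theta> $ j + (- m $ j) * g \<theta> $ i + (- m $ i) * g \<theta> $ j + m $ i * m $ j)"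
        by (simp add: fun_eq_iff algebra_simps)
      also have "?E \<dots> = ?E (\<lambda>\<theta>. g \<theta> $ i * g \<theta> $ j) + (- m $ j) * m $ i + (- m $ i) * m $ j + m $ i * m $ j"
        unfolding emp_mean_add emp_mean_cmult emp_mean_const[OF t] m_i ..
      finally show ?thesis by simp
    qed
    have p1: "\<bar>?E (\<lambda>\<theta>. g \<theta> $ i * g \<theta> $ j) - ?E (\<lambda>\<theta>. c \<theta> $ i * c \<theta> $ j)\<bar> \<le> 2 * C * \<eta>"
    proof -
      have "\<bar>?E (\<lambda>\<theta>. g \<theta> $ i * g \<theta> $ j) - ?E (\<lambda>\<theta>. c \<theta> $ i * c \<theta> $ j)\<bar> \<le> ?E (\<lambda>\<theta>. \<bar>g \<theta> $ i * g \<theta> $ j - c \<theta> $ i * c \<theta> $ j\<bar>)"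
        unfolding emp_mean_diff[symmetric] by (rule emp_mean_abs)
      also have "\<dots> \<le> ?E (\<lambda>\<theta>. (2 * C) * norm (g \<theta> - c \<theta>))"
      proof (rule emp_mean_mono)
        fix \<tau> let ?x = "X \<tau> \<omega>"
        have "g ?x $ i * g ?x $ j - c ?x $ i * c ?x $ j = (g ?x - c ?x) $ i * g ?x $ j + c ?x $ i * (g ?x - c ?x) $ j"
          by (simp add: algebra_simps)
        also have "\<bar>\<dots>\<bar> \<le> \<bar>(g ?x - c ?x) $ i\<bar> * \<bar>g ?x $ j\<bar> + \<bar>c ?x $ i\<bar> * \<bar>(g ?x - c ?x) $ j\<bar>"
          unfolding abs_mult[symmetric] by (rule abs_triangle_ineq)
        also have "\<dots> \<le> norm (g ?x - c ?x) * C + C * norm (g ?x - c ?x)"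
          using gi ci[OF XP] box(3) by (intro add_mono mult_mono component_le_norm_cart) auto
        finally show "\<bar>g ?x $ i * g ?x $ j - c ?x $ i * c ?x $ j\<bar> \<le> (2 * C) * norm (g ?x - c ?x)" by simp
      qed
      also have "\<dots> = 2 * C * ?E (\<lambda>\<theta>. norm (g \<theta> - c \<theta>))" by (rule emp_mean_cmult)
      also have "\<dots> \<le> 2 * C * \<eta>" using close box(3) unfolding g_def c_def by (intro mult_left_mono) auto
      finally show ?thesis .
    qed
    have p2: "\<bar>m $ i + \<delta>s $ i\<bar> \<le> 2 * \<eta>" for i
    proof -
      have "\<bar>m $ i - ?E (\<lambda>\<theta>. c \<theta> $ i)\<bar> \<le> ?E (\<lambda>\<theta>. \<bar>g \<theta> $ i - c \<theta> $ i\<bar>)"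
        unfolding m_i emp_mean_diff[symmetric] by (rule emp_mean_abs)
      also have "\<dots> \<le> ?E (\<lambda>\<theta>. norm (g \<theta> - c \<theta>))"
        by (rule emp_mean_mono) (metis component_le_norm_cart vector_minus_component)
      also have "\<dots> \<le> \<eta>" using close unfolding g_def c_def .
      finally have "\<bar>m $ i - ?E (\<lambda>\<theta>. c \<theta> $ i)\<bar> \<le> \<eta>" .
      moreover have "\<bar>?E (\<lambda>\<theta>. c \<theta> $ i) - (\<integral>\<theta>. c \<theta> $ i \<partial>P)\<bar> < \<eta>" using lln1 by blast
      then have "\<bar>?E (\<lambda>\<theta>. c \<theta> $ i) + \<delta>s $ i\<bar> < \<eta>" unfolding Eci by simp
      ultimately show ?thesis by linarith
    qed
    have mC: "\<bar>m $ i\<bar> \<le> C" for i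
    proof -
      have "\<bar>m $ i\<bar> \<le> ?E (\<lambda>\<theta>. \<bar>g \<theta> $ i\<bar>)" unfolding m_i by (rule emp_mean_abs)
      also have "\<dots> \<le> ?E (\<lambda>\<theta>. C)" by (rule emp_mean_mono) (rule gi)
      finally show ?thesis unfolding emp_mean_const[OF t] .
    qed
    have \<delta>C: "\<bar>\<delta>s $ i\<bar> \<le> C" for i
    proof -
      have "\<bar>\<integral>\<theta>. c \<theta> $ i \<partial>P\<bar> \<le> (\<integral>\<theta>. \<bar>c \<theta> $ i\<bar> \<partial>P)" by (rule integral_abs_bound)
      also have "\<dots> \<le> (\<integral>\<theta>. C \<partial>P)" using int_ci[of i] ci by (intro integral_mono) auto
      finally show ?thesis unfolding Eci by simp
    qed
    have p3: "\<bar>m $ i * m $ j - \<delta>s $ i * \<delta>s $ j\<bar> \<le> 4 * C * \<eta>"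
    proof -
      have "m $ i * m $ j - \<delta>s $ i * \<delta>s $ j = (m $ i + \<delta>s $ i) * m $ j - \<delta>s $ i * (m $ j + \<delta>s $ j)"
        by (simp add: algebra_simps)
      also have "\<bar>\<dots>\<bar> \<le> \<bar>m $ i + \<delta>s $ i\<bar> * \<bar>m $ j\<bar> + \<bar>\<delta>s $ i\<bar> * \<bar>m $ j + \<delta>s $ j\<bar>"
        unfolding abs_mult[symmetric] by (rule abs_triangle_ineq4)
      also have "\<dots> \<le> (2 * \<eta>) * C + C * (2 * \<eta>)"
        using p2 mC \<delta>C box(3) \<eta>(1) by (intro add_mono mult_mono) auto
      finally show ?thesis by simp
    qed
    have "\<bar>?E (\<lambda>\<theta>. c \<theta> $ i * c \<theta> $ j) - (\<integral>\<theta>. c \<theta> $ i * c \<theta> $ j \<partial>P)\<bar> < \<eta>" using lln2 by auto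
    then have "\<bar>(\<integral>\<theta>. score \<theta> $ i * score \<theta> $ j \<partial>P) -
       measure_pmf.expectation (pmf_of_set {..<t}) (\<lambda>l. boot_score t \<omega> l $ i * boot_score t \<omega> l $ j)\<bar> \<le> 2 * C * \<eta> + \<eta> + 4 * C * \<eta>"
      unfolding avg cov using p1 p3 by (simp only: minus_mult_minus)
    also have "\<dots> = d" unfolding \<eta>(2)[symmetric] by (simp add: algebra_simps)
    finally show "\<bar>(\<integral>\<theta>. score \<theta> $ i * score \<theta> $ j \<partial>P) -
       measure_pmf.expectation (pmf_of_set {..<t}) (\<lambda>l. boot_score t \<omega> l $ i * boot_score t \<omega> l $ j)\<bar> \<le> d" .
  qed
qed

end

section \<open>The bootstrap statistic\<close>

lemma sum_list_eq_sum_count: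
  fixes a :: "'b \<Rightarrow> 'c::real_vector"
  assumes "finite A" "set l \<subseteq> A"
  shows "sum_list (map a l) = (\<Sum>x\<in>A. real (count_list l x) *\<^sub>R a x)"
  using assms(2)
proof (induction l)
  case (Cons y l)
  have "(\<Sum>x\<in>A. real (count_list (y # l) x) *\<^sub>R a x) =
    (\<Sum>x\<in>A. real (count_list l x) *\<^sub>R a x + (if x = y then a y else 0))"
    by (rule sum.cong) (auto simp: scaleR_add_left)
  also have "\<dots> = (\<Sum>x\<in>A. real (count_list l x) *\<^sub>R a x) + a y"
    using assms(1) Cons.prems by (simp add: sum.distrib)
  finally show ?case using Cons by (simp add: add.commute)
qed simp

context fppe begin

text \<open>
  Resampling with multinomial weights amounts to drawing \<open>t\<close> indices independently: given the data,
  the bootstrap sum is a normalized sum of independent draws from the centred subgradients.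
\<close>

lemma G_boot_eq:
  assumes t: "0 < t" and l: "l \<in> set_pmf (replicate_pmf t (pmf_of_set {..<t}))"
  shows "Gboot t \<omega> (count_list l) = normalized_list_sum (boot_score t \<omega>) t l"
proof -
  have sl: "set l \<subseteq> {..<t}" "length l = t"
    using l t by (auto simp: set_replicate_pmf lists_eq_set set_pmf_of_set lessThan_empty_iff)
  define a where "a \<tau> = DF (X \<tau> \<omega>) (bobs t \<omega>)" for \<tau>
  define m where "m = emp_mean t (sample \<omega>) (\<lambda>\<theta>. DF \<theta> (bobs t \<omega>))"
  have "sum_list (map (boot_score t \<omega>) l) = sum_list (map a l) - real (length l) *\<^sub>R m"
    unfolding boot_score_def a_def m_def by (induction l) (auto simp: algebra_simps)
  also have "sum_list (map a l) = (\<Sum>\<tau><t. real (count_list l \<tau>) *\<^sub>R a \<tau>)"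
    by (rule sum_list_eq_sum_count) (use sl in auto)
  finally have 1: "sum_list (map (boot_score t \<omega>) l) = (\<Sum>\<tau><t. real (count_list l \<tau>) *\<^sub>R a \<tau>) - real t *\<^sub>R m"
    using sl by simp
  have s: "sqrt (real t) * (1 / real t) = 1 / sqrt (real t)" "(1 / sqrt (real t)) * real t = sqrt (real t)"
    using t by (simp_all add: real_div_sqrt field_simps)
  have "Gboot t \<omega> (count_list l) =
    (sqrt (real t) * (1 / real t)) *\<^sub>R (\<Sum>\<tau><t. real (count_list l \<tau>) *\<^sub>R a \<tau>) - sqrt (real t) *\<^sub>R m"
    unfolding G_boot_def boot_mean_def a_def m_def by (simp only: scaleR_diff_right scaleR_scaleR)
  also have "\<dots> = (1 / sqrt (real t)) *\<^sub>R ((\<Sum>\<tau><t. real (count_list l \<tau>) *\<^sub>R a \<tau>) - real t *\<^sub>R m)"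
    unfolding scaleR_diff_right scaleR_scaleR s ..
  finally show ?thesis unfolding normalized_list_sum_def 1 .
qed

lemma boot_score_mean:
  assumes t: "0 < t"
  shows "measure_pmf.expectation (pmf_of_set {..<t}) (boot_score t \<omega>) = 0"
proof -
  have "measure_pmf.expectation (pmf_of_set {..<t}) (boot_score t \<omega>) =
    (\<Sum>l<t. pmf (pmf_of_set {..<t}) l *\<^sub>R boot_score t \<omega> l)"
    using t by (intro integral_measure_pmf) (auto simp: set_pmf_of_set lessThan_empty_iff)
  also have "\<dots> = (\<Sum>l<t. (1 / real t) *\<^sub>R boot_score t \<omega> l)"
    using t by (intro sum.cong) (auto simp: pmf_of_set lessThan_empty_iff)
  also have "\<dots> = (1 / real t) *\<^sub>R (\<Sum>l<t. boot_score t \<omega> l)" by (simp add: scaleR_sum_right)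
  also have "(\<Sum>l<t. boot_score t \<omega> l) = 0"
    using t unfolding boot_score_def emp_mean_def
    by (simp add: sum_subtractf sum_constant_scaleR del: sum_constant)
  finally show ?thesis by simp
qed

lemma T_boot_ge:
  assumes \<beta>: "0 \<le> \<beta>"
  shows "ereal (- ((e * (G_boot v b DF t x w \<bullet> (\<beta> - beta_obs v b t x))
            + 1 / 2 * ((beta_obs v b t x - \<beta>) \<bullet> (hess_obs v b e2 t x *v (beta_obs v b t x - \<beta>)))) / e\<^sup>2))
    \<le> T_boot v b DF e e2 t x w"
  unfolding T_boot_def
  by (subst ereal_minus_le_minus[symmetric], simp only: ereal_uminus_uminus uminus_ereal.simps minus_minus)
    (rule INF_lower, use \<beta> in simp)

text \<open>
  Evaluate the infimum at \<open>\<beta> = beta_obs v b t x + e *\<^sub>R y\<close> with \<open>y = - c *\<^sub>R (A *v g)\<close>.  The choice \<open>c = 1\<close>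
  would be optimal for the limit Hessian; the factor \<open>c = sqrt (m / u)\<close>, where \<open>u\<close> is the value of the
  form, keeps \<open>y\<close> in a ball that depends on \<open>m\<close> only, at the price of replacing \<open>u\<close> by the smaller
  bound \<open>m\<close>.
\<close>

lemma T_boot_lower_bound:
  assumes A: "psd A" "\<And>g. Hess *v (A *v g) = g"
    and l: "0 < l" "\<And>x. l * (norm x)\<^sup>2 \<le> qform Hess x"
    and m: "0 < m" "m \<le> qform A (G_boot v b DF t x w)"
    and e: "0 < e" "e * sqrt (m / l) \<le> a" and \<beta>: "\<And>i. a \<le> beta_obs v b t x $ i"
    and z: "norm (hess_obs v b e2 t x - Hess) \<le> z"
  shows "ereal (m - (real CARD('n))\<^sup>2 * z * (m / l)) \<le> T_boot v b DF e e2 t x w"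
proof -
  define g where "g = G_boot v b DF t x w"
  define H' where "H' = hess_obs v b e2 t x"
  define u where "u = qform A g"
  have u: "m \<le> u" "0 < u" using m by (auto simp: u_def g_def)
  define c where "c = sqrt (m / u)"
  have c: "0 \<le> c" "c \<le> 1" "c\<^sup>2 * u = m" using u m by (auto simp: c_def)
  define y where "y = (- c) *\<^sub>R (A *v g)"
  have qA: "qform Hess (A *v g) = u" by (simp add: qform_def A(2) u_def inner_commute)
  have qy: "qform Hess y = m" unfolding y_def qform_scaleR qA using c(3) by simp
  have ny2: "(norm y)\<^sup>2 \<le> m / l" using l(2)[of y] l(1) unfolding qy by (simp add: field_simps)
  then have ny: "norm y \<le> sqrt (m / l)" by (rule real_le_rsqrt)
  have gy: "g \<bullet> y = - (2 * c * u)" by (simp add: y_def u_def qform_def)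
  define \<beta>' where "\<beta>' = beta_obs v b t x + e *\<^sub>R y"
  have "0 \<le> \<beta>' $ i" for i
  proof -
    have "\<bar>e * y $ i\<bar> \<le> e * sqrt (m / l)"
      using component_le_norm_cart[of y i] ny e(1) by (simp add: abs_mult)
    then show ?thesis using e(2) \<beta>[of i] by (simp add: \<beta>'_def abs_le_iff)
  qed
  then have pos: "0 \<le> \<beta>'" by (simp add: less_eq_vec_def)
  have val: "(e * (g \<bullet> (\<beta>' - beta_obs v b t x)) + 1 / 2 * ((beta_obs v b t x - \<beta>') \<bullet> (H' *v (beta_obs v b t x - \<beta>')))) / e\<^sup>2
    = g \<bullet> y + qform H' y"
  proof -
    have d: "beta_obs v b t x - \<beta>' = (- e) *\<^sub>R y" "\<beta>' - beta_obs v b t x = e *\<^sub>R y" by (simp_all add: \<beta>'_def)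
    have "1 / 2 * ((beta_obs v b t x - \<beta>') \<bullet> (H' *v (beta_obs v b t x - \<beta>'))) = qform H' ((- e) *\<^sub>R y)"
      unfolding d qform_def by simp
    also have "\<dots> = e\<^sup>2 * qform H' y" unfolding qform_scaleR by simp
    finally show ?thesis unfolding d using e(1) by (simp add: field_simps power2_eq_square)
  qed
  have "qform H' y = qform Hess y + qform (H' - Hess) y"
    by (simp add: qform_def matrix_vector_mult_diff_rdistrib inner_diff_right diff_divide_distrib)
  also have "qform (H' - Hess) y \<le> (real CARD('n))\<^sup>2 * norm (H' - Hess) * (norm y)\<^sup>2"
    using qform_abs_le[of "H' - Hess" y] by linarith
  also have "\<dots> \<le> (real CARD('n))\<^sup>2 * z * (m / l)"
    using z ny2 unfolding H'_def by (intro mult_mono mult_nonneg_nonneg order_trans[OF norm_ge_zero z]) auto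
  finally have "qform H' y \<le> m + (real CARD('n))\<^sup>2 * z * (m / l)" unfolding qy by simp
  moreover have "2 * m \<le> 2 * c * u"
  proof -
    have "c * c \<le> c" using mult_left_mono[OF c(2) c(1)] by simp
    then have "c\<^sup>2 * u \<le> c * u" unfolding power2_eq_square using u by (intro mult_right_mono) auto
    then show ?thesis using c(3) by simp
  qed
  ultimately have "m - (real CARD('n))\<^sup>2 * z * (m / l) \<le> - (g \<bullet> y + qform H' y)" using gy by linarith
  then have "ereal (m - (real CARD('n))\<^sup>2 * z * (m / l)) \<le> ereal (- (g \<bullet> y + qform H' y))" by simp
  also have "\<dots> \<le> T_boot v b DF e e2 t x w"
    using T_boot_ge[OF pos, of e t x w e2] unfolding val[unfolded g_def H'_def] g_def H'_def .
  finally show ?thesis .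
qed

lemma hess_close:
  assumes "converges_in_prob M (\<lambda>t \<omega>. hessobs (\<eta> t) t \<omega>) Hess" and z: "0 < z"
  shows "whp M (\<lambda>t \<omega>. norm (hessobs (\<eta> t) t \<omega> - Hess) \<le> z)"
proof (rule whp_by_bound)
  let ?B = "\<lambda>t. {\<omega> \<in> space M. dist (hessobs (\<eta> t) t \<omega>) Hess > z}"
  show "(\<lambda>t. prob (?B t)) \<longlonglongrightarrow> 0" using assms unfolding converges_in_prob_def by simp
  show "\<forall>\<^sub>F t in sequentially. ?B t \<in> events \<and> prob (?B t) \<le> prob (?B t)"
    using eventually_gt_at_top[of 0]
  proof eventually_elim
    case (elim t)
    note [measurable] = hess_obs_measurable[OF elim]
    show ?case by measurable
  qed
  show "\<forall>\<^sub>F t in sequentially. \<forall>\<omega>\<in>space M - ?B t. norm (hessobs (\<eta> t) t \<omega> - Hess) \<le> z"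
    by (intro always_eventually) (auto simp: dist_norm)
qed

text \<open>
  If the bootstrap statistic is at most \<open>q0\<close>, the quadratic form of the bootstrap sum is at most \<open>m1\<close>,
  by \<open>T_boot_lower_bound\<close>; exchanging the summands then leads to the data.
\<close>

lemma boot_prob_bound:
  assumes A: "psd A" "\<And>g. Hess *v (A *v g) = g"
    and q: "q0 < m1" "m1 < m2" and e: "0 < e"
    and eps: "\<And>t. 0 < \<epsilon> t" "\<epsilon> \<longlonglongrightarrow> 0"
    and hess: "converges_in_prob M (\<lambda>t \<omega>. hessobs (\<eta> t) t \<omega>) Hess"
  shows "whp M (\<lambda>t \<omega>. boot_prob t
      {w. Tboot (\<epsilon> t) (\<eta> t) t \<omega> w \<le> ereal q0}
     \<le> prob {\<omega> \<in> space M. qform A (score_sum t \<omega>) < m2} + e)"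
proof -
  obtain l where l: "0 < l" "\<And>x. l * (norm x)\<^sup>2 \<le> qform Hess x"
    using positive_definite_coercive[OF pos_def] by auto
  obtain a u r0 C where box: "0 < a" "0 < r0" "0 \<le> C" "\<And>y. norm (y - \<beta>s) \<le> r0 \<Longrightarrow> y \<in> box_lu a u"
    and C: "\<forall>\<theta>\<in>space D. \<forall>\<beta>\<in>box_lu a u. norm (DF \<theta> \<beta>) \<le> C"
    using near_box[OF \<beta>s_pos] by blast
  have \<beta>s_box: "\<beta>s \<in> box_lu a u" using box(2) by (intro box(4)) simp
  have DFb: "norm (DF \<theta> \<beta>) \<le> C" if "\<theta> \<in> space D" "\<beta> \<in> box_lu a u" for \<theta> \<beta> using C that by blast
  have \<delta>C: "norm \<delta>s \<le> C"
  proof -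
    have "norm (\<integral>\<theta>. DF \<theta> \<beta>s \<partial>P) \<le> (\<integral>\<theta>. norm (DF \<theta> \<beta>s) \<partial>P)" by (rule integral_norm_bound)
    also have "\<dots> \<le> (\<integral>\<theta>. C \<partial>P)"
      using DF_integrable[OF \<beta>s_pos] DFb[OF _ \<beta>s_box] by (intro integral_mono) auto
    finally show ?thesis by (simp add: mean_DF)
  qed
  have score_bd: "norm (score \<theta>) \<le> 2 * C" if "\<theta> \<in> space P" for \<theta>
    using norm_triangle_ineq[of "DF \<theta> \<beta>s" \<delta>s] DFb[of \<theta> \<beta>s] that \<beta>s_box \<delta>C unfolding score_def by simp
  obtain d where d: "0 < d" "\<forall>\<^sub>F t in sequentially. \<forall>(p :: nat pmf) z. matches score (2 * C) d p z \<longrightarrow>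
    measure_pmf.prob (replicate_pmf t p) {l. qform A (normalized_list_sum z t l) \<le> m1}
     \<le> prob {\<omega> \<in> space M. qform A (score_sum t \<omega>) < m2} + e"
    using quadratic_form_comparison[OF A(1) q(2) e score_measurable score_bd score_mean] by blast
  \<comment> \<open>So accurate a Hessian costs less than the gap between \<open>q0\<close> and \<open>m1\<close>.\<close>
  define z where "z = (m1 - q0) / 2 * l / ((real CARD('n))\<^sup>2 * (\<bar>m1\<bar> + 1))"
  have z: "0 < z" using q(1) l(1) by (simp add: z_def)
  have zb: "(real CARD('n))\<^sup>2 * z * (m1 / l) < m1 - q0" if "0 < m1"
  proof -
    have "(real CARD('n))\<^sup>2 * z * (m1 / l) = (m1 - q0) / 2 * (m1 / (\<bar>m1\<bar> + 1))"
      using l(1) by (simp add: z_def)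
    also have "\<dots> \<le> (m1 - q0) / 2 * 1"
      using that q(1) by (intro mult_left_mono) auto
    also have "\<dots> < m1 - q0" using q(1) by simp
    finally show ?thesis .
  qed
  have ev_eps: "\<forall>\<^sub>F t in sequentially. \<epsilon> t * sqrt (m1 / l) < a"
  proof -
    have "(\<lambda>t. \<epsilon> t * sqrt (m1 / l)) \<longlonglongrightarrow> 0 * sqrt (m1 / l)" by (intro tendsto_mult eps(2) tendsto_const)
    then show ?thesis using box(1) by (intro order_tendstoD(2)) auto
  qed
  have w1: "whp M (\<lambda>t \<omega>. norm (bobs t \<omega> - \<beta>s) \<le> r0)" by (rule bobs_consistent[OF box(2)])
  note w2 = hess_close[OF hess z]
  note w3 = boot_covariance[OF d(1)]
  show ?thesis
  proof (rule whp_mono_eventually[OF whp_conj[OF w1 whp_conj[OF w2 w3]] eventually_conj[OF d(2) ev_eps]], elim conjE)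
    fix t \<omega>
    assume comp: "\<forall>(p :: nat pmf) z. matches score (2 * C) d p z \<longrightarrow>
        measure_pmf.prob (replicate_pmf t p) {l. qform A (normalized_list_sum z t l) \<le> m1}
         \<le> prob {\<omega> \<in> space M. qform A (score_sum t \<omega>) < m2} + e"
      and ee: "\<epsilon> t * sqrt (m1 / l) < a" and t: "0 < t" and \<omega>: "\<omega> \<in> space M"
      and b1: "norm (bobs t \<omega> - \<beta>s) \<le> r0"
      and hz: "norm (hessobs (\<eta> t) t \<omega> - Hess) \<le> z"
      and cov: "\<forall>i j. \<bar>(\<integral>\<theta>. score \<theta> $ i * score \<theta> $ j \<partial>P) -
         measure_pmf.expectation (pmf_of_set {..<t}) (\<lambda>l. boot_score t \<omega> l $ i * boot_score t \<omega> l $ j)\<bar> \<le> d"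
    let ?p = "replicate_pmf t (pmf_of_set {..<t})"
    let ?x = "\<lambda>\<tau>. X \<tau> \<omega>"
    note bb = box(4)[OF b1]
    have bs: "norm (boot_score t \<omega> j) \<le> 2 * C" for j
    proof -
      have "norm (emp_mean t ?x (\<lambda>\<theta>. DF \<theta> (bobs t \<omega>))) \<le> emp_mean t ?x (\<lambda>\<theta>. norm (DF \<theta> (bobs t \<omega>)))"
        unfolding emp_mean_def by (auto intro!: divide_right_mono norm_sum)
      also have "\<dots> \<le> emp_mean t ?x (\<lambda>\<theta>. C)"
        by (rule emp_mean_mono) (rule DFb[OF X_D[OF \<omega>] bb])
      finally have "norm (emp_mean t ?x (\<lambda>\<theta>. DF \<theta> (bobs t \<omega>))) \<le> C" unfolding emp_mean_const[OF t] .
      then show ?thesis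
        using norm_triangle_ineq4[of "DF (X j \<omega>) (bobs t \<omega>)" "emp_mean t ?x (\<lambda>\<theta>. DF \<theta> (bobs t \<omega>))"]
          DFb[OF X_D[OF \<omega>] bb, of j] unfolding boot_score_def by linarith
    qed
    have "boot_prob t {w. T_boot v b DF (\<epsilon> t) (\<eta> t) t ?x w \<le> ereal q0}
      = measure_pmf.prob ?p {l. T_boot v b DF (\<epsilon> t) (\<eta> t) t ?x (count_list l) \<le> ereal q0}"
      unfolding multinomial_unif_pmf_def measure_map_pmf by (simp add: vimage_def)
    also have "\<dots> \<le> measure_pmf.prob ?p {l. qform A (normalized_list_sum (boot_score t \<omega>) t l) \<le> m1}"
    proof (rule measure_pmf.finite_measure_mono_AE)
      show "AE l in measure_pmf ?p. l \<in> {l. T_boot v b DF (\<epsilon> t) (\<eta> t) t ?x (count_list l) \<le> ereal q0} \<longrightarrow>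
         l \<in> {l. qform A (normalized_list_sum (boot_score t \<omega>) t l) \<le> m1}"
      proof (rule AE_pmfI, rule impI, rule ccontr)
        fix l' assume l': "l' \<in> set_pmf ?p"
          and T: "l' \<in> {l. T_boot v b DF (\<epsilon> t) (\<eta> t) t ?x (count_list l) \<le> ereal q0}"
          and n: "l' \<notin> {l. qform A (normalized_list_sum (boot_score t \<omega>) t l) \<le> m1}"
        have b0: "0 \<le> beta_obs v b t ?x"
          using bb box(1)
          by (auto simp: box_lu_def less_eq_vec_def intro: order_trans[OF less_imp_le, of 0 a])
        have "0 \<le> T_boot v b DF (\<epsilon> t) (\<eta> t) t ?x (count_list l')"
          using T_boot_ge[OF b0, of "\<epsilon> t" t ?x "count_list l'" "\<eta> t"] by (simp add: zero_ereal_def)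
        also have "\<dots> \<le> ereal q0" using T by simp
        finally have m1: "0 < m1" using q(1) by simp
        have "m1 \<le> qform A (G_boot v b DF t ?x (count_list l'))"
          using n unfolding G_boot_eq[OF t l'] by simp
        then have "ereal (m1 - (real CARD('n))\<^sup>2 * z * (m1 / l)) \<le> T_boot v b DF (\<epsilon> t) (\<eta> t) t ?x (count_list l')"
        proof (rule T_boot_lower_bound[OF A l m1 _ eps(1)])
          show "\<epsilon> t * sqrt (m1 / l) \<le> a" using ee by simp
          show "a \<le> beta_obs v b t ?x $ i" for i using bb unfolding box_lu_def by simp
        qed (rule hz)
        also have "\<dots> \<le> ereal q0" using T by simp
        finally show False using zb[OF m1] by simp
      qed
    qed simp
    also have "\<dots> \<le> prob {\<omega> \<in> space M. qform A (score_sum t \<omega>) < m2} + e"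
    proof (rule comp[rule_format])
      show "matches score (2 * C) d (pmf_of_set {..<t}) (boot_score t \<omega>)"
        using t bs boot_score_mean[OF t] cov
        by (simp add: matches_def set_pmf_of_set lessThan_empty_iff)
    qed
    finally show "boot_prob t
      {w. T_boot v b DF (\<epsilon> t) (\<eta> t) t ?x w \<le> ereal q0}
      \<le> prob {\<omega> \<in> space M. qform A (score_sum t \<omega>) < m2} + e" .
  qed
qed

section \<open>Coverage\<close>

text \<open>
  A monotone function has at most countably many discontinuities.
\<close>

lemma mono_continuity_point:
  fixes F :: "real \<Rightarrow> real"
  assumes "mono F" "a < b'"
  shows "\<exists>x. a < x \<and> x < b' \<and> isCont F x"
proof -
  have "uncountable ({a<..<b'} - {x. \<not> isCont F x})"
    using mono_ctble_discont[OF assms(1)] assms(2) by (intro uncountable_minus_countable) (auto simp: uncountable_open_interval)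
  then have "{a<..<b'} - {x. \<not> isCont F x} \<noteq> {}" by (metis countable_empty)
  then show ?thesis by auto
qed

text \<open>
  Continuity at the quantile shows that the infimum that defines it is attained.
\<close>

lemma quantile_properties:
  assumes N: "real_distribution N" and p: "0 < p" "p < 1" and cont: "isCont (cdf N) (quantile N p)"
  shows "p \<le> cdf N (quantile N p)" "x < quantile N p \<Longrightarrow> cdf N x < p"
proof -
  interpret N: real_distribution N by (rule N)
  define S where "S = {x. p \<le> cdf N x}"
  define q where "q = quantile N p"
  have q: "q = Inf S" by (simp add: q_def quantile_def S_def)
  have "\<forall>\<^sub>F x in at_top. p < cdf N x" using N.cdf_lim_at_top_prob p by (intro order_tendstoD(1)) auto
  then obtain x1 where "p < cdf N x1" by (auto dest!: eventually_happens)
  then have x1: "x1 \<in> S" by (simp add: S_def)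
  have "\<forall>\<^sub>F x in at_bot. cdf N x < p" using N.cdf_lim_at_bot p by (intro order_tendstoD(2)) auto
  then obtain x0 where x0: "cdf N x0 < p" by (auto dest!: eventually_happens)
  have lb: "x0 \<le> x" if "x \<in> S" for x
  proof (rule ccontr)
    assume "\<not> x0 \<le> x"
    then have "cdf N x \<le> cdf N x0" by (intro N.cdf_nondecreasing) auto
    then show False using x0 that by (simp add: S_def)
  qed
  have below: "cdf N x < p" if "x < q" for x
  proof (rule ccontr)
    assume "\<not> cdf N x < p"
    then have "q \<le> x" unfolding q using lb by (intro cInf_lower bdd_belowI[of _ x0]) (auto simp: S_def)
    then show False using that by simp
  qed
  then show "x < quantile N p \<Longrightarrow> cdf N x < p" by (simp add: q_def)
  show "p \<le> cdf N (quantile N p)"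
  proof (rule ccontr)
    assume "\<not> p \<le> cdf N (quantile N p)"
    then have "cdf N q < p" by (simp add: q_def)
    then have "\<forall>\<^sub>F x in at q. cdf N x < p"
      using cont unfolding isCont_def q_def[symmetric] by (intro order_tendstoD(2))
    then have "\<forall>\<^sub>F x in at_right q. cdf N x < p" using filter_leD[OF at_le[of "{q<..}" UNIV q]] by simp
    then obtain y where y: "q < y" "\<And>x. q < x \<Longrightarrow> x < y \<Longrightarrow> cdf N x < p"
      unfolding eventually_at_right_field by auto
    have "y \<le> x" if "x \<in> S" for x
    proof (rule ccontr)
      assume "\<not> y \<le> x"
      then have xy: "x < y" by simp
      obtain w where w: "max q x < w" "w < y" using dense[of "max q x" y] y(1) xy by auto
      have "cdf N x \<le> cdf N w" by (rule N.cdf_nondecreasing) (use w in auto)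
      then show False using y(2)[of w] w that by (simp add: S_def)
    qed
    then have "y \<le> q" unfolding q using x1 by (intro cInf_greatest) auto
    then show False using y(1) by simp
  qed
qed

text \<open>
  The levels \<open>q0 < m1 < m2 < x1\<close> leave room for the three comparisons in turn: the bootstrap statistic
  with its quadratic form, the two quadratic forms, and the quadratic form with the observed
  statistic.
\<close>

lemma c_boot_lower_bound:
  assumes eps: "\<And>t. 0 < \<epsilon> t" "\<epsilon> \<longlonglongrightarrow> 0"
    and hess: "converges_in_prob M (\<lambda>t \<omega>. hessobs (\<eta> t) t \<omega>) Hess"
    and k: "0 < k" and N: "real_distribution N"
    and conv: "converges_in_distr M (\<lambda>t \<omega>. Tobs k t \<omega>) N"
    and x1: "q0 < x1" "isCont (cdf N) x1" "cdf N x1 < 1 - \<alpha>"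
  shows "whp M (\<lambda>t \<omega>. ereal q0 \<le> cboot (\<epsilon> t) (\<eta> t) \<alpha> t \<omega>)"
proof -
  obtain A where A: "psd A" "\<And>g. Hess *v (A *v g) = g" using positive_definite_inverse[OF pos_def] by blast
  define m1 m2 where "m1 = (2 * q0 + x1) / 3" and "m2 = (q0 + 2 * x1) / 3"
  have m: "q0 < m1" "m1 < m2" "m2 < x1" using x1(1) by (auto simp: m1_def m2_def)
  define gp where "gp = 1 - \<alpha> - cdf N x1"
  have gp: "0 < gp" using x1(3) by (simp add: gp_def)
  let ?Q = "\<lambda>t. {\<omega> \<in> space M. qform A (score_sum t \<omega>) < m2}"
  let ?T = "\<lambda>t \<omega>. Tobs k t \<omega>"
  note [measurable] = T_obs_measurable[OF _ k] score_measurable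
  have [measurable]: "score_sum t \<in> borel_measurable M" for t unfolding normalized_sum_def[abs_def] by measurable
  have "whp M (\<lambda>t \<omega>. qform A (score_sum t \<omega>) < m2 \<longrightarrow> ?T t \<omega> \<le> ereal (m2 + (x1 - m2)))"
    by (rule T_obs_upper_bound[OF A _ k]) (use m in simp)
  then have w: "whp M (\<lambda>t \<omega>. qform A (score_sum t \<omega>) < m2 \<longrightarrow> ?T t \<omega> \<le> ereal x1)" by simp
  have van: "(\<lambda>t. prob {\<omega> \<in> space M. qform A (score_sum t \<omega>) < m2 \<and> \<not> ?T t \<omega> \<le> ereal x1}) \<longlonglongrightarrow> 0"
  proof (rule whp_prob_vanishes[OF w])
    show "\<forall>\<^sub>F t in sequentially. {\<omega> \<in> space M. qform A (score_sum t \<omega>) < m2 \<and> \<not> ?T t \<omega> \<le> ereal x1} \<in> events"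
      using eventually_gt_at_top[of 0]
    proof eventually_elim
      case (elim t)
      note [measurable] = T_obs_measurable[OF elim k]
      show ?case by measurable
    qed
  qed auto
  have "(\<lambda>t. prob {\<omega> \<in> space M. ?T t \<omega> \<le> ereal x1}) \<longlonglongrightarrow> cdf N x1"
    using conv x1(2) unfolding converges_in_distr_def weak_conv_def by simp
  from tendsto_add[OF this van] have lim: "(\<lambda>t. prob {\<omega> \<in> space M. ?T t \<omega> \<le> ereal x1} +
     prob {\<omega> \<in> space M. qform A (score_sum t \<omega>) < m2 \<and> \<not> ?T t \<omega> \<le> ereal x1}) \<longlonglongrightarrow> cdf N x1" by simp
  have "cdf N x1 < cdf N x1 + gp / 2" using gp by simp
  from order_tendstoD(2)[OF lim this]
  have evQ: "\<forall>\<^sub>F t in sequentially. prob (?Q t) < cdf N x1 + gp / 2"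
    using eventually_gt_at_top[of 0]
  proof eventually_elim
    case (elim t)
    note [measurable] = T_obs_measurable[OF elim(2) k]
    have "prob (?Q t) \<le> prob ({\<omega> \<in> space M. ?T t \<omega> \<le> ereal x1} \<union>
       {\<omega> \<in> space M. qform A (score_sum t \<omega>) < m2 \<and> \<not> ?T t \<omega> \<le> ereal x1})"
      by (rule finite_measure_mono) auto
    also have "\<dots> \<le> prob {\<omega> \<in> space M. ?T t \<omega> \<le> ereal x1} +
       prob {\<omega> \<in> space M. qform A (score_sum t \<omega>) < m2 \<and> \<not> ?T t \<omega> \<le> ereal x1}"
      by (rule measure_Un_le) measurable
    finally show ?case using elim(1) by linarith
  qed
  have wB: "whp M (\<lambda>t \<omega>. boot_prob t
      {w. Tboot (\<epsilon> t) (\<eta> t) t \<omega> w \<le> ereal q0} \<le> prob (?Q t) + gp / 4)"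
    by (rule boot_prob_bound[OF A m(1,2) _ eps hess]) (use gp in simp)
  show ?thesis
  proof (rule whp_mono_eventually[OF wB evQ])
    fix t \<omega>
    let ?W = "\<lambda>c. {w. Tboot (\<epsilon> t) (\<eta> t) t \<omega> w \<le> ereal c}"
    assume Q: "prob (?Q t) < cdf N x1 + gp / 2"
      and B: "boot_prob t (?W q0) \<le> prob (?Q t) + gp / 4"
    have small: "boot_prob t (?W q0) < 1 - \<alpha>"
      using Q B gp unfolding gp_def by argo
    show "ereal q0 \<le> cboot (\<epsilon> t) (\<eta> t) \<alpha> t \<omega>"
      unfolding c_boot_def
    proof (rule Inf_greatest)
      fix y assume "y \<in> {ereal c | c. 1 - \<alpha> \<le> boot_prob t (?W c)}"
      then obtain c where c: "y = ereal c" "1 - \<alpha> \<le> boot_prob t (?W c)" by blast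
      have "q0 \<le> c"
      proof (rule ccontr)
        assume "\<not> q0 \<le> c"
        then have "?W c \<subseteq> ?W q0" by (auto intro: order_trans)
        then have "boot_prob t (?W c) \<le> boot_prob t (?W q0)"
          by (intro measure_pmf.finite_measure_mono) auto
        then show False using c(2) small by linarith
      qed
      then show "ereal q0 \<le> y" by (simp add: c(1))
    qed
  qed
qed

lemma coverage_liminf:
  assumes eps: "\<And>t. 0 < \<epsilon> t" "\<epsilon> \<longlonglongrightarrow> 0"
    and hess: "converges_in_prob M (\<lambda>t \<omega>. hessobs (\<eta> t) t \<omega>) Hess"
    and k: "0 < k" and \<alpha>: "0 < \<alpha>" "\<alpha> < 1" and N: "real_distribution N"
    and conv: "converges_in_distr M (\<lambda>t \<omega>. Tobs k t \<omega>) N"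
    and cont: "isCont (cdf N) (quantile N (1 - \<alpha>))"
  shows "liminf (\<lambda>t. ereal (prob {\<omega> \<in> space M. (\<beta>s, \<delta>s)
             \<in> C_obs k v b t (sample \<omega>) (cboot (\<epsilon> t) (\<eta> t) \<alpha> t \<omega>)}))
         \<ge> ereal (1 - \<alpha>)"
  unfolding le_Liminf_iff
proof (intro allI impI)
  fix y assume y: "y < ereal (1 - \<alpha>)"
  obtain p where p: "y < ereal p" "ereal p < ereal (1 - \<alpha>)" using ereal_dense2[OF y] by blast
  interpret N: real_distribution N by (rule N)
  define q where "q = quantile N (1 - \<alpha>)"
  have qp: "1 - \<alpha> \<le> cdf N q" "\<And>x. x < q \<Longrightarrow> cdf N x < 1 - \<alpha>"
    using quantile_properties[OF N _ _ cont] \<alpha> unfolding q_def by auto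
  have monoF: "mono (cdf N)" by (intro monoI N.cdf_nondecreasing)
  let ?T = "\<lambda>t \<omega>. Tobs k t \<omega>"
  let ?c = "\<lambda>t \<omega>. cboot (\<epsilon> t) (\<eta> t) \<alpha> t \<omega>"
  have "p < cdf N q" using p(2) qp(1) by simp
  then have "\<forall>\<^sub>F x in at q. p < cdf N x"
    using cont unfolding isCont_def q_def[symmetric] by (intro order_tendstoD(1))
  then have "\<forall>\<^sub>F x in at_left q. p < cdf N x" using filter_leD[OF at_le[of "{..<q}" UNIV q]] by simp
  then obtain w where w: "w < q" "\<And>x. w < x \<Longrightarrow> x < q \<Longrightarrow> p < cdf N x"
    unfolding eventually_at_left_field by auto
  obtain q0 where q0: "w < q0" "q0 < q" "isCont (cdf N) q0" using mono_continuity_point[OF monoF w(1)] by blast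
  obtain x1 where x1: "q0 < x1" "x1 < q" "isCont (cdf N) x1" using mono_continuity_point[OF monoF q0(2)] by blast
  have wc: "whp M (\<lambda>t \<omega>. ereal q0 \<le> ?c t \<omega>)"
    by (rule c_boot_lower_bound[OF eps hess k N conv x1(1,3) qp(2)[OF x1(2)]])
  have van: "(\<lambda>t. prob {\<omega> \<in> space M. \<not> ereal q0 \<le> ?c t \<omega>}) \<longlonglongrightarrow> 0"
  proof (rule whp_prob_vanishes[OF wc])
    show "\<forall>\<^sub>F t in sequentially. {\<omega> \<in> space M. \<not> ereal q0 \<le> ?c t \<omega>} \<in> events"
      using eventually_gt_at_top[of 0]
    proof eventually_elim
      case (elim t)
      note [measurable] = c_boot_measurable[OF elim]
      show ?case by measurable
    qed
  qed auto
  have "(\<lambda>t. prob {\<omega> \<in> space M. ?T t \<omega> \<le> ereal q0}) \<longlonglongrightarrow> cdf N q0"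
    using conv q0(3) unfolding converges_in_distr_def weak_conv_def by simp
  from tendsto_diff[OF this van] have lim: "(\<lambda>t. prob {\<omega> \<in> space M. ?T t \<omega> \<le> ereal q0} -
     prob {\<omega> \<in> space M. \<not> ereal q0 \<le> ?c t \<omega>}) \<longlonglongrightarrow> cdf N q0" by simp
  have "p < cdf N q0" by (rule w(2)[OF q0(1,2)])
  from order_tendstoD(1)[OF lim this]
  show "\<forall>\<^sub>F t in sequentially. y < ereal (prob {\<omega> \<in> space M. (\<beta>s, \<delta>s) \<in> C_obs k v b t (sample \<omega>) (?c t \<omega>)})"
    using eventually_gt_at_top[of 0]
  proof eventually_elim
    case (elim t)
    note [measurable] = c_boot_measurable[OF elim(2)] T_obs_measurable[OF elim(2) k]
    have ev: "{\<omega> \<in> space M. (\<beta>s, \<delta>s) \<in> C_obs k v b t (sample \<omega>) (?c t \<omega>)} = {\<omega> \<in> space M. ?T t \<omega> \<le> ?c t \<omega>}"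
      using KKT by (auto simp: C_obs_def)
    have "prob {\<omega> \<in> space M. ?T t \<omega> \<le> ereal q0} \<le> prob ({\<omega> \<in> space M. ?T t \<omega> \<le> ?c t \<omega>} \<union> {\<omega> \<in> space M. \<not> ereal q0 \<le> ?c t \<omega>})"
      by (rule finite_measure_mono) auto
    also have "\<dots> \<le> prob {\<omega> \<in> space M. ?T t \<omega> \<le> ?c t \<omega>} + prob {\<omega> \<in> space M. \<not> ereal q0 \<le> ?c t \<omega>}"
      by (rule measure_Un_le) measurable
    finally have "p < prob {\<omega> \<in> space M. ?T t \<omega> \<le> ?c t \<omega>}" using elim(1) by linarith
    then have "ereal p < ereal (prob {\<omega> \<in> space M. (\<beta>s, \<delta>s) \<in> C_obs k v b t (sample \<omega>) (?c t \<omega>)})"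
      unfolding ev by simp
    then show ?case using p(1) by (rule less_trans[rotated])
  qed
qed

end

theorem theorem6:
  fixes D :: "'a measure" and s :: "'a \<Rightarrow> real" and v :: "'n::finite \<Rightarrow> 'a \<Rightarrow> real"
    and b :: "real^'n" and DF :: "'a \<Rightarrow> real^'n \<Rightarrow> real^'n"
    and M :: "'w measure" and X :: "nat \<Rightarrow> 'w \<Rightarrow> 'a"
    and \<epsilon> \<eta> :: "nat \<Rightarrow> real" and \<kappa> :: ereal and \<alpha> :: real and T_inf :: "real measure"
  assumes budgets: "\<And>i. 0 < b $ i"
    and valuations: "\<And>i. integrable D (v i)"
      "\<And>i \<theta>. \<theta> \<in> space D \<Longrightarrow> 0 \<le> v i \<theta>"
      "\<And>i. bdd_above (v i ` space D)"
    and supply_fun: "\<And>\<theta>. \<theta> \<in> space D \<Longrightarrow> 0 \<le> s \<theta>"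
      "bdd_above (s ` space D)"
      "has_bochner_integral D s 1"
    and data: "prob_space M"
      "prob_space.indep_vars M (\<lambda>_. D) X UNIV"
      "\<And>\<tau>. distributed M D (X \<tau>) (\<lambda>\<theta>. ennreal (s \<theta>))"
    and smooth: "twice_cont_diff_near (\<lambda>\<beta>. real_of_ereal (H_lim D s v b \<beta>)) (beta_lim D s v b)"
    and pos_def: "positive_definite (hess_lim D s v b)"
    and selection: "\<And>\<theta> \<beta>. \<theta> \<in> space D \<Longrightarrow> \<beta> \<in> pos_orthant \<Longrightarrow> DF \<theta> \<beta> \<in> subdifferential (F v b \<theta>) \<beta>"
      "(\<lambda>(\<theta>, \<beta>). DF \<theta> \<beta>) \<in> borel_measurable (D \<Otimes>\<^sub>M restrict_space borel pos_orthant)"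
    and eps: "\<And>t. 0 < \<epsilon> t" "\<epsilon> \<longlonglongrightarrow> 0" "filterlim (\<lambda>t. \<epsilon> t * sqrt (real t)) at_top sequentially"
    and eta: "\<And>t. 0 < \<eta> t"
    and hess_consistent:
      "converges_in_prob M (\<lambda>t \<omega>. hess_obs v b (\<eta> t) t (\<lambda>\<tau>. X \<tau> \<omega>)) (hess_lim D s v b)"
    and kappa: "0 < \<kappa>"
    and alpha: "0 < \<alpha>" "\<alpha> < 1"
    and T_inf: "real_distribution T_inf"
      "converges_in_distr M
         (\<lambda>t \<omega>. T_obs \<kappa> v b t (\<lambda>\<tau>. X \<tau> \<omega>) (beta_lim D s v b) (delta_lim D s v b)) T_inf"
    and cdf_cont: "isCont (cdf T_inf) (quantile T_inf (1 - \<alpha>))"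
  shows "liminf (\<lambda>t. ereal (measure M {\<omega> \<in> space M.
           (beta_lim D s v b, delta_lim D s v b)
             \<in> C_obs \<kappa> v b t (\<lambda>\<tau>. X \<tau> \<omega>) (c_boot v b DF (\<epsilon> t) (\<eta> t) \<alpha> t (\<lambda>\<tau>. X \<tau> \<omega>))}))
         \<ge> ereal (1 - \<alpha>)"
proof -
  interpret fppe D s v b DF M X
    by (rule fppe.intro[OF budgets valuations supply_fun(1,3) data smooth pos_def selection])
  show ?thesis
    by (rule coverage_liminf[OF eps(1,2) hess_consistent kappa alpha T_inf cdf_cont])
qed

end
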